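(* Let $n\ge1$ and $i\in\{0,\dots,n\}$. Let $\mathcal P^{(-1)_{2n-2i}}$ be the set of partitions (finite multisets) with parts in $E_1$ such that, letting $f_u$ be the multiplicity of $u\in E_1$ and setting fictitious frequencies $f_u=\chi(u=(-1)_{2n-2i})$ for $u\in E_{-1}\setminus E_1$, one has $f_{e_0}+\dots+f_{e_{2n}}\le1$ for every path $(e_0,\dots,e_{2n})$ in $E_{-1}$. Then $$\sum_{\pi\in\mathcal P^{(-1)_{2n-2i}}}q^{|\pi|}=\mathbb 1\bigl(e^{-\Lambda_i}\mathrm{ch}(L(\Lambda_i))\bigr)=\frac{(q^{2n+4};q^{2n+4})_\infty(q^{2i+2};q^{2n+4})_\infty(q^{2n-2i+2};q^{2n+4})_\infty}{(q;q)_\infty}.$$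
   Context: For $k\in\mathbb Z\cup\{-\infty\}$, $E_k=\{l_d: l\ge k,\ d\in\{0,\dots,2n\},\ l-d\equiv1\pmod 2\}$, where $l_d$ is a symbol with size $l$ and subscript $d$; the size $|\pi|$ of a partition is the sum of the sizes of its parts. A path in $E_k$ is a sequence $((l^{(0)})_0,(l^{(1)})_1,\dots,(l^{(2n)})_{2n})$ of elements of $E_k$ (the $j$-th element having subscript $j$) with $l^{(j+1)}=l^{(j)}\pm1$ for all $j<2n$. $(a;q)_\infty=\prod_{k\ge0}(1-aq^k)$. $L(\Lambda_i)$ is the irreducible highest weight module of the affine Lie algebra of type $C_n^{(1)}$ with fundamental weight $\Lambda_i$, $\mathrm{ch}$ its character, and $\mathbb 1$ the principal specialisation $e^{-\alpha_j}\mapsto q$ for all simple roots $\alpha_0,\dots,\alpha_n$. *)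

theory Defs
  imports "HOL-Analysis.Analysis" "HOL-Library.Function_Algebras" "HOL-Library.Multiset"
begin

section \<open>Partitions with frequency conditions along paths\<close>

text \<open>The symbol $l_d$ of size $l$ and subscript $d$ is the pair \<open>(l, d)\<close>.\<close>

type_synonym part = "int \<times> nat"

definition parts_from :: "nat \<Rightarrow> int \<Rightarrow> part set" where
  "parts_from n k = {(l, d). k \<le> l \<and> d \<le> 2 * n \<and> (l - int d) mod 2 = 1}"

definition is_path :: "nat \<Rightarrow> int \<Rightarrow> part list \<Rightarrow> bool" where
  "is_path n k p \<longleftrightarrow>
     length p = 2 * n + 1 \<and> set p \<subseteq> parts_from n k \<and>
     (\<forall>j\<le>2 * n. snd (p ! j) = j) \<and>
     (\<forall>j<2 * n. fst (p ! (j + 1)) = fst (p ! j) + 1 \<or> fst (p ! (j + 1)) = fst (p ! j) - 1)"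

definition freq :: "nat \<Rightarrow> part \<Rightarrow> part multiset \<Rightarrow> part \<Rightarrow> nat" where
  "freq n u\<^sub>0 \<pi> u = (if u \<in> parts_from n 1 then count \<pi> u else of_bool (u = u\<^sub>0))"

definition path_partitions :: "nat \<Rightarrow> part \<Rightarrow> part multiset set" where
  "path_partitions n u\<^sub>0 =
     {\<pi>. set_mset \<pi> \<subseteq> parts_from n 1 \<and>
         (\<forall>p. is_path n (-1) p \<longrightarrow> (\<Sum>j\<le>2 * n. freq n u\<^sub>0 \<pi> (p ! j)) \<le> 1)}"

definition part_size :: "part multiset \<Rightarrow> nat" where
  "part_size \<pi> = nat (\<Sum>u\<in>#\<pi>. fst u)"

definition qpoch :: "complex fps \<Rightarrow> complex fps \<Rightarrow> complex fps" where
  "qpoch a q = (\<Prod>k. 1 - a * q ^ k)"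


section \<open>The affine Lie algebra of type $C_n^{(1)}$\<close>

text \<open>
  Entry \<open>(i, j)\<close> is $a_{ij} = \alpha_j(h_i)$, for the Dynkin diagram
  $0 \Rightarrow 1 - \cdots - (n-1) \Leftarrow n$ with $\alpha_0$ and $\alpha_n$ long. For \<open>n = 1\<close> both
  off-diagonal entries are $-2$, that is, $C_1^{(1)} = A_1^{(1)}$.
\<close>

definition cartan :: "nat \<Rightarrow> nat \<Rightarrow> nat \<Rightarrow> int" where
  "cartan n i j =
     (if i = j then 2
      else if i \<noteq> j + 1 \<and> j \<noteq> i + 1 then 0
      else if i = 1 \<and> j = 0 \<or> i + 1 = n \<and> j = n then -2
      else -1)"

text \<open>
  The Lie algebra is given by the Chevalley generators $e_j, f_j, h_j$ ($0 \le j \le n$) and the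
  degree derivation $d$, subject to the Chevalley--Serre relations. Its elements are the classes
  of Lie expressions over $\mathbb{C}$ in these generators modulo the congruence generated by
  the axioms of a complex Lie algebra and the defining relations.
\<close>

datatype lie_expr =
    Gen_e nat | Gen_f nat | Gen_h nat | Gen_d
  | Zero | Add lie_expr lie_expr | Scale complex lie_expr | Bracket lie_expr lie_expr

inductive lie_eq :: "nat \<Rightarrow> lie_expr \<Rightarrow> lie_expr \<Rightarrow> bool" for n :: nat where
  refl: "lie_eq n x x"
| sym: "lie_eq n x y \<Longrightarrow> lie_eq n y x"
| trans: "lie_eq n x y \<Longrightarrow> lie_eq n y z \<Longrightarrow> lie_eq n x z"
| cong_add: "lie_eq n x x' \<Longrightarrow> lie_eq n y y' \<Longrightarrow> lie_eq n (Add x y) (Add x' y')"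
| cong_scale: "lie_eq n x x' \<Longrightarrow> lie_eq n (Scale c x) (Scale c x')"
| cong_bracket: "lie_eq n x x' \<Longrightarrow> lie_eq n y y' \<Longrightarrow> lie_eq n (Bracket x y) (Bracket x' y')"
| add_assoc: "lie_eq n (Add (Add x y) z) (Add x (Add y z))"
| add_commute: "lie_eq n (Add x y) (Add y x)"
| add_zero: "lie_eq n (Add x Zero) x"
| add_inverse: "lie_eq n (Add x (Scale (-1) x)) Zero"
| scale_one: "lie_eq n (Scale 1 x) x"
| scale_scale: "lie_eq n (Scale a (Scale b x)) (Scale (a * b) x)"
| scale_add: "lie_eq n (Scale a (Add x y)) (Add (Scale a x) (Scale a y))"
| add_scale: "lie_eq n (Scale (a + b) x) (Add (Scale a x) (Scale b x))"
| bracket_add_left: "lie_eq n (Bracket (Add x y) z) (Add (Bracket x z) (Bracket y z))"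
| bracket_add_right: "lie_eq n (Bracket x (Add y z)) (Add (Bracket x y) (Bracket x z))"
| bracket_scale_left: "lie_eq n (Bracket (Scale a x) y) (Scale a (Bracket x y))"
| bracket_scale_right: "lie_eq n (Bracket x (Scale a y)) (Scale a (Bracket x y))"
| alternating: "lie_eq n (Bracket x x) Zero"
| jacobi: "lie_eq n (Add (Bracket x (Bracket y z))
                      (Add (Bracket y (Bracket z x)) (Bracket z (Bracket x y)))) Zero"
  \<comment> \<open>the constructors provide generators for all indices; those beyond \<open>n\<close> are discarded\<close>
| no_e: "n < j \<Longrightarrow> lie_eq n (Gen_e j) Zero"
| no_f: "n < j \<Longrightarrow> lie_eq n (Gen_f j) Zero"
| no_h: "n < j \<Longrightarrow> lie_eq n (Gen_h j) Zero"
| h_h: "i \<le> n \<Longrightarrow> j \<le> n \<Longrightarrow> lie_eq n (Bracket (Gen_h i) (Gen_h j)) Zero"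
| d_h: "j \<le> n \<Longrightarrow> lie_eq n (Bracket Gen_d (Gen_h j)) Zero"
| e_f: "i \<le> n \<Longrightarrow> j \<le> n \<Longrightarrow>
    lie_eq n (Bracket (Gen_e i) (Gen_f j)) (if i = j then Gen_h i else Zero)"
| h_e: "i \<le> n \<Longrightarrow> j \<le> n \<Longrightarrow>
    lie_eq n (Bracket (Gen_h i) (Gen_e j)) (Scale (of_int (cartan n i j)) (Gen_e j))"
| h_f: "i \<le> n \<Longrightarrow> j \<le> n \<Longrightarrow>
    lie_eq n (Bracket (Gen_h i) (Gen_f j)) (Scale (- of_int (cartan n i j)) (Gen_f j))"
| d_e: "j \<le> n \<Longrightarrow> lie_eq n (Bracket Gen_d (Gen_e j)) (Scale (of_bool (j = 0)) (Gen_e j))"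
| d_f: "j \<le> n \<Longrightarrow> lie_eq n (Bracket Gen_d (Gen_f j)) (Scale (- of_bool (j = 0)) (Gen_f j))"
| serre_e: "i \<le> n \<Longrightarrow> j \<le> n \<Longrightarrow> i \<noteq> j \<Longrightarrow>
    lie_eq n ((Bracket (Gen_e i) ^^ nat (1 - cartan n i j)) (Gen_e j)) Zero"
| serre_f: "i \<le> n \<Longrightarrow> j \<le> n \<Longrightarrow> i \<noteq> j \<Longrightarrow>
    lie_eq n ((Bracket (Gen_f i) ^^ nat (1 - cartan n i j)) (Gen_f j)) Zero"

type_synonym lie_elem = "lie_expr set"

definition lie_class :: "nat \<Rightarrow> lie_expr \<Rightarrow> lie_elem" where
  "lie_class n x = {y. lie_eq n x y}"


section \<open>Weights\<close>

text \<open>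
  The Cartan subalgebra has basis $h_0, \ldots, h_n, d$. A weight is the pair consisting of its
  values on the $h_k$ (only \<open>k \<le> n\<close> is relevant) and its value on $d$.
\<close>

type_synonym weight = "(nat \<Rightarrow> complex) \<times> complex"

definition simple_root :: "nat \<Rightarrow> nat \<Rightarrow> weight" where
  "simple_root n j = ((\<lambda>k. if k \<le> n then of_int (cartan n k j) else 0), of_bool (j = 0))"

definition fund_weight :: "nat \<Rightarrow> weight" where
  "fund_weight i = ((\<lambda>k. of_bool (k = i)), 0)"

definition root_combination :: "nat \<Rightarrow> (nat \<Rightarrow> nat) \<Rightarrow> weight" where
  "root_combination n m =
     (\<Sum>j\<le>n. ((\<lambda>k. of_nat (m j) * fst (simple_root n j) k), of_nat (m j) * snd (simple_root n j)))"


section \<open>Modules\<close>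

locale C1_module = vector_space scale
  for scale :: "complex \<Rightarrow> 'v::ab_group_add \<Rightarrow> 'v" +
  fixes n :: nat and V :: "'v set" and act :: "lie_elem \<Rightarrow> 'v \<Rightarrow> 'v"
  assumes subspace_V: "subspace V"
    and act_closed: "v \<in> V \<Longrightarrow> act (lie_class n x) v \<in> V"
    and act_vec_add: "u \<in> V \<Longrightarrow> v \<in> V \<Longrightarrow>
      act (lie_class n x) (u + v) = act (lie_class n x) u + act (lie_class n x) v"
    and act_vec_scale: "v \<in> V \<Longrightarrow>
      act (lie_class n x) (scale c v) = scale c (act (lie_class n x) v)"
    and act_add: "v \<in> V \<Longrightarrow>
      act (lie_class n (Add x y)) v = act (lie_class n x) v + act (lie_class n y) v"
    and act_scale: "v \<in> V \<Longrightarrow>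
      act (lie_class n (Scale c x)) v = scale c (act (lie_class n x) v)"
    and act_bracket: "v \<in> V \<Longrightarrow>
      act (lie_class n (Bracket x y)) v =
        act (lie_class n x) (act (lie_class n y) v) - act (lie_class n y) (act (lie_class n x) v)"
begin

definition submodule :: "'v set \<Rightarrow> bool" where
  "submodule W \<longleftrightarrow> subspace W \<and> W \<subseteq> V \<and> (\<forall>x. \<forall>v\<in>W. act (lie_class n x) v \<in> W)"

definition irreducible_module :: bool where
  "irreducible_module \<longleftrightarrow> V \<noteq> {0} \<and> (\<forall>W. submodule W \<longrightarrow> W = {0} \<or> W = V)"

definition weight_space :: "weight \<Rightarrow> 'v set" where
  "weight_space \<mu> =
     {v \<in> V. (\<forall>k\<le>n. act (lie_class n (Gen_h k)) v = scale (fst \<mu> k) v) \<and>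
             act (lie_class n Gen_d) v = scale (snd \<mu>) v}"

definition highest_weight_module :: "weight \<Rightarrow> bool" where
  "highest_weight_module \<Lambda> \<longleftrightarrow>
     (\<exists>v\<in>weight_space \<Lambda>. v \<noteq> 0 \<and> (\<forall>j\<le>n. act (lie_class n (Gen_e j)) v = 0) \<and>
        (\<forall>W. submodule W \<and> v \<in> W \<longrightarrow> W = V))"

text \<open>A formal sum $\sum_\mu a_\mu e^\mu$ is represented by the function $\mu \mapsto a_\mu$.
  The constant \<open>dim\<close> is $0$ on spaces of infinite dimension, but the weight spaces of a highest
  weight module have finite dimension.\<close>

definition ch :: "weight \<Rightarrow> nat" where
  "ch \<mu> = dim (weight_space \<mu>)"

end

text \<open>
  \<open>V\<close> with the action \<open>act\<close> is a realisation of $L(\Lambda)$, which is unique up to isomorphism;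
  that one exists is shown at the end of this theory.
\<close>

locale irreducible_highest_weight_module = C1_module +
  fixes \<Lambda> :: weight
  assumes irreducible: "irreducible_module"
    and highest_weight: "highest_weight_module \<Lambda>"

text \<open>Multiplication of a formal sum by $e^\nu$.\<close>

definition exp_times :: "weight \<Rightarrow> (weight \<Rightarrow> nat) \<Rightarrow> weight \<Rightarrow> nat" where
  "exp_times \<nu> a = (\<lambda>\<mu>. a (\<mu> - \<nu>))"

text \<open>
  The substitution $e^{-\alpha_j} \mapsto q$ for a formal sum supported on
  $-\sum_j \mathbb{N} \alpha_j$. Since the simple roots are linearly independent, the elements of
  this set are indexed by their coefficient vectors \<open>m\<close>.
\<close>

definition principal_specialisation :: "nat \<Rightarrow> (weight \<Rightarrow> nat) \<Rightarrow> complex fps" where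
  "principal_specialisation n a =
     (\<Sum>\<^sub>\<infinity>m\<in>{m. \<forall>j>n. m j = 0}. of_nat (a (- root_combination n m)) * fps_X ^ (\<Sum>j\<le>n. m j))"


section \<open>Existence of $L(\Lambda)$\<close>

text \<open>
  The module $L(\Lambda)$ is realised on functions of words: the vector $x$ corresponds to the function
  mapping $u_1 \ldots u_k$ to the coefficient of the highest weight vector in
  $e_{u_k} \cdots e_{u_1} x$.
\<close>

type_synonym wfun = "nat list \<Rightarrow> complex"

lemmas fun_simps = plus_fun_apply zero_fun_apply minus_apply uminus_apply fun_eq_iff

declare plus_fun_apply [simp del] zero_fun_apply [simp del] minus_apply [simp del]
  uminus_apply [simp del]

definition wscale :: "complex \<Rightarrow> wfun \<Rightarrow> wfun" where
  "wscale c \<phi> = (\<lambda>u. c * \<phi> u)"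

definition e_op :: "nat \<Rightarrow> wfun \<Rightarrow> wfun" where
  "e_op j \<phi> = (\<lambda>u. \<phi> (j # u))"

definition diag_op :: "complex \<Rightarrow> (nat \<Rightarrow> complex) \<Rightarrow> wfun \<Rightarrow> wfun" where
  "diag_op b c \<phi> = (\<lambda>u. (b - (\<Sum>l\<leftarrow>u. c l)) * \<phi> u)"

definition h_op :: "nat \<Rightarrow> weight \<Rightarrow> nat \<Rightarrow> wfun \<Rightarrow> wfun" where
  "h_op n \<Lambda> k = diag_op (fst \<Lambda> k) (\<lambda>l. of_int (cartan n k l))"

primrec f_word :: "nat \<Rightarrow> weight \<Rightarrow> nat \<Rightarrow> nat list \<Rightarrow> wfun \<Rightarrow> complex" where
  "f_word n \<Lambda> j [] \<phi> = 0"
| "f_word n \<Lambda> j (i # u) \<phi> =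
     f_word n \<Lambda> j u (e_op i \<phi>) + (if i = j then h_op n \<Lambda> j \<phi> u else 0)"

definition f_op :: "nat \<Rightarrow> weight \<Rightarrow> nat \<Rightarrow> wfun \<Rightarrow> wfun" where
  "f_op n \<Lambda> j \<phi> = (\<lambda>u. f_word n \<Lambda> j u \<phi>)"

definition vac :: wfun where
  "vac u = of_bool (u = [])"

definition commutator :: "(wfun \<Rightarrow> wfun) \<Rightarrow> (wfun \<Rightarrow> wfun) \<Rightarrow> wfun \<Rightarrow> wfun" where
  "commutator A B = (\<lambda>\<phi>. A (B \<phi>) - B (A \<phi>))"

definition lin :: "(wfun \<Rightarrow> wfun) \<Rightarrow> bool" where
  "lin A \<longleftrightarrow> (\<forall>\<phi> \<psi>. A (\<phi> + \<psi>) = A \<phi> + A \<psi>) \<and> (\<forall>c \<phi>. A (wscale c \<phi>) = wscale c (A \<phi>))"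

lemma wscale_vector_space: "vector_space wscale"
  by unfold_locales (auto simp: wscale_def fun_simps algebra_simps)

lemma lin_add: "lin A \<Longrightarrow> A (\<phi> + \<psi>) = A \<phi> + A \<psi>"
  and lin_scale: "lin A \<Longrightarrow> A (wscale c \<phi>) = wscale c (A \<phi>)"
  by (auto simp: lin_def)

lemma wscale_simps: "wscale c (\<phi> + \<psi>) = wscale c \<phi> + wscale c \<psi>"
  "wscale c (\<phi> - \<psi>) = wscale c \<phi> - wscale c \<psi>" "wscale a (wscale b \<phi>) = wscale (a * b) \<phi>"
  "wscale (a + b) \<phi> = wscale a \<phi> + wscale b \<phi>" "wscale (a - b) \<phi> = wscale a \<phi> - wscale b \<phi>"
  "wscale 0 \<phi> = 0" "wscale 1 \<phi> = \<phi>" "wscale (- a) \<phi> = - wscale a \<phi>" "wscale a 0 = 0"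
  "wscale a (- \<phi>) = - wscale a \<phi>"
  by (auto simp: wscale_def fun_simps algebra_simps)

lemma lin_zero: "lin A \<Longrightarrow> A 0 = 0"
  using lin_scale[of A 0 0] by (simp add: wscale_simps)

lemma lin_diff: "lin A \<Longrightarrow> A (\<phi> - \<psi>) = A \<phi> - A \<psi>"
  using lin_add[of A "\<phi> - \<psi>" \<psi>] by simp

lemma lin_minus: "lin A \<Longrightarrow> A (- \<phi>) = - A \<phi>"
  using lin_diff[of A 0 \<phi>] by (simp add: lin_zero[of A])

lemma lin_e: "lin (e_op j)"
  by (auto simp: lin_def e_op_def wscale_def fun_simps)

lemma lin_diag: "lin (diag_op b c)"
  by (auto simp: lin_def diag_op_def wscale_def fun_simps algebra_simps)

lemma lin_h: "lin (h_op n \<Lambda> k)"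
  unfolding h_op_def by (rule lin_diag)

lemma f_word_add: "f_word n \<Lambda> j u (\<phi> + \<psi>) = f_word n \<Lambda> j u \<phi> + f_word n \<Lambda> j u \<psi>"
  by (induction u arbitrary: \<phi> \<psi>)
     (simp_all add: lin_add[OF lin_e] lin_add[OF lin_h] plus_fun_apply)

lemma f_word_scale: "f_word n \<Lambda> j u (wscale c \<phi>) = c * f_word n \<Lambda> j u \<phi>"
proof (induction u arbitrary: \<phi>)
  case (Cons i u)
  then show ?case
    by (simp add: lin_scale[OF lin_e] lin_scale[OF lin_h] algebra_simps)
       (simp add: wscale_def)
qed simp

lemmas f_word_lin = f_word_add f_word_scale

lemma f_word_zero: "f_word n \<Lambda> j u 0 = 0"
  using f_word_scale[of n \<Lambda> j u 0 0] by (simp add: wscale_simps)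

lemma lin_f: "lin (f_op n \<Lambda> j)"
  by (auto simp: lin_def f_op_def f_word_lin fun_simps wscale_def[of _ "\<lambda>u. f_word n \<Lambda> j u _"])

lemma lin_commutator: "lin A \<Longrightarrow> lin B \<Longrightarrow> lin (commutator A B)"
  by (auto simp: lin_def commutator_def wscale_simps algebra_simps)

lemma lin_commutator_pow: "lin A \<Longrightarrow> lin B \<Longrightarrow> lin ((commutator A ^^ m) B)"
  by (induction m) (auto intro: lin_commutator)

lemma comm_diag_e: "commutator (diag_op b c) (e_op j) \<phi> = wscale (c j) (e_op j \<phi>)"
  by (auto simp: commutator_def diag_op_def e_op_def wscale_def fun_simps algebra_simps)

lemma comm_diag_diag: "commutator (diag_op b c) (diag_op b' c') \<phi> = 0"
  by (auto simp: commutator_def diag_op_def fun_simps algebra_simps)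

lemma comm_e_f: "commutator (e_op i) (f_op n \<Lambda> j) \<phi> = (if i = j then h_op n \<Lambda> i \<phi> else 0)"
  by (auto simp: commutator_def f_op_def e_op_def fun_simps)

lemma comm_diag_f: "commutator (diag_op b c) (f_op n \<Lambda> j) \<phi> = - wscale (c j) (f_op n \<Lambda> j \<phi>)"
proof -
  have "diag_op b c (f_op n \<Lambda> j \<phi>) u - f_op n \<Lambda> j (diag_op b c \<phi>) u = - c j * f_op n \<Lambda> j \<phi> u" for u
  proof (induction u arbitrary: \<phi>)
    case Nil
    show ?case by (simp add: f_op_def diag_op_def)
  next
    case (Cons i u)
    define \<psi> where "\<psi> = e_op i \<phi>"
    have 1: "e_op i (diag_op b c \<phi>) = diag_op b c \<psi> - wscale (c i) \<psi>"
      using comm_diag_e[of b c i \<phi>] by (simp add: commutator_def \<psi>_def algebra_simps)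
    have 2: "f_word n \<Lambda> j u (diag_op b c \<psi> - wscale (c i) \<psi>)
        = f_word n \<Lambda> j u (diag_op b c \<psi>) - c i * f_word n \<Lambda> j u \<psi>"
      using lin_diff[OF lin_f, of n \<Lambda> j "diag_op b c \<psi>" "wscale (c i) \<psi>"]
      by (auto simp: f_op_def fun_simps f_word_lin)
    have 3: "h_op n \<Lambda> j (diag_op b c \<phi>) u = (b - (\<Sum>l\<leftarrow>u. c l)) * h_op n \<Lambda> j \<phi> u"
      by (simp add: h_op_def diag_op_def)
    have 4: "f_word n \<Lambda> j u (diag_op b c \<psi>)
        = (b - (\<Sum>l\<leftarrow>u. c l)) * f_word n \<Lambda> j u \<psi> + c j * f_word n \<Lambda> j u \<psi>"
      using Cons.IH[of \<psi>] by (simp add: f_op_def diag_op_def algebra_simps)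
    show ?case
      by (simp add: f_op_def diag_op_def[of b c "\<lambda>u. f_word n \<Lambda> j u \<phi>"] 1 2 3 4 flip: \<psi>_def)
         (simp add: algebra_simps)
  qed
  then show ?thesis
    by (auto simp: commutator_def wscale_def fun_simps)
qed

lemma commutator_jacobi:
  assumes "lin A" "lin B" "lin C"
  shows "commutator A (commutator B C) \<phi> =
    commutator (commutator A B) C \<phi> + commutator B (commutator A C) \<phi>"
  by (simp add: commutator_def assms[THEN lin_diff])

text \<open>Both families of Serre elements are covered: take $(e, f, h)$ or $(f, e, -h)$ for \<open>(x, y, z)\<close>.\<close>

lemma serre_commutes:
  fixes x y z :: "nat \<Rightarrow> wfun \<Rightarrow> wfun"
  assumes lin: "\<And>k. lin (x k)" "\<And>k. lin (y k)" "\<And>k. lin (z k)"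
    and xy: "\<And>k l \<phi>. commutator (x k) (y l) \<phi> = (if k = l then z k \<phi> else 0)"
    and zy: "\<And>k l \<phi>. commutator (z k) (y l) \<phi> = - wscale (of_int (cartan n k l)) (y l \<phi>)"
    and ij: "i \<noteq> j"
  shows "x k ((commutator (y i) ^^ nat (1 - cartan n i j)) (y j) \<phi>) =
    (commutator (y i) ^^ nat (1 - cartan n i j)) (y j) (x k \<phi>)"
proof -
  define S where "S m = (commutator (y i) ^^ m) (y j)" for m
  have S0: "S 0 = y j" and SS: "S (Suc m) = commutator (y i) (S m)" for m
    by (simp_all add: S_def)
  have linS: "lin (S m)" for m
    unfolding S_def by (intro lin_commutator_pow lin)
  define a :: complex where "a = of_int (cartan n i j)"
  have zS: "commutator (z i) (S m) \<phi> = - wscale (2 * of_nat m + a) (S m \<phi>)" for m \<phi>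
  proof (induction m arbitrary: \<phi>)
    case 0
    show ?case by (simp add: S0 zy a_def)
  next
    case (Suc m)
    have zyi: "commutator (z i) (y i) = (\<lambda>\<phi>. - wscale 2 (y i \<phi>))"
      by (rule ext) (simp add: zy cartan_def)
    have IH: "commutator (z i) (S m) = (\<lambda>\<phi>. - wscale (2 * of_nat m + a) (S m \<phi>))"
      by (rule ext) (rule Suc)
    have "commutator (z i) (S (Suc m)) \<phi> =
        commutator (\<lambda>\<phi>. - wscale 2 (y i \<phi>)) (S m) \<phi> +
        commutator (y i) (\<lambda>\<phi>. - wscale (2 * of_nat m + a) (S m \<phi>)) \<phi>"
      unfolding SS commutator_jacobi[OF lin(3) lin(2) linS] zyi IH ..
    also have "\<dots> = - wscale (2 * of_nat (Suc m) + a) (S (Suc m) \<phi>)"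
      unfolding SS
      by (simp add: commutator_def lin_minus[OF lin(2)] lin_minus[OF linS] lin_scale[OF lin(2)]
          lin_scale[OF linS] lin_add[OF lin(2)] lin_diff[OF lin(2)] wscale_simps algebra_simps)
    finally show ?case .
  qed
  have xi: "commutator (x i) (S (Suc m)) \<phi> =
      wscale (of_nat (Suc m) * (- of_nat m - a)) (S m \<phi>)" for m \<phi>
  proof (induction m arbitrary: \<phi>)
    case 0
    have c: "commutator (x i) (y i) = z i" "commutator (x i) (y j) = (\<lambda>_. 0)"
      using ij by (auto simp: xy)
    have "commutator (x i) (S (Suc 0)) \<phi> = commutator (z i) (S 0) \<phi> + commutator (y i) (\<lambda>_. 0) \<phi>"
      using commutator_jacobi[OF lin(1) lin(2) linS, of i i 0 \<phi>] by (simp add: SS S0 c)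
    also have "commutator (y i) (\<lambda>_. 0) \<phi> = 0"
      by (simp add: commutator_def lin_zero[OF lin(2)])
    finally show ?case
      by (simp add: zS wscale_simps)
  next
    case (Suc m)
    have c: "commutator (x i) (y i) = z i"
      by (auto simp: xy)
    have IH: "commutator (x i) (S (Suc m)) =
        (\<lambda>\<phi>. wscale (of_nat (Suc m) * (- of_nat m - a)) (S m \<phi>))"
      by (rule ext) (rule Suc)
    have "commutator (x i) (S (Suc (Suc m))) \<phi> = commutator (z i) (S (Suc m)) \<phi> +
        commutator (y i) (\<lambda>\<phi>. wscale (of_nat (Suc m) * (- of_nat m - a)) (S m \<phi>)) \<phi>"
      unfolding SS[of "Suc m"] commutator_jacobi[OF lin(1) lin(2) linS] c IH ..
    also have "commutator (y i) (\<lambda>\<phi>. wscale (of_nat (Suc m) * (- of_nat m - a)) (S m \<phi>)) \<phi> =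
        wscale (of_nat (Suc m) * (- of_nat m - a)) (S (Suc m) \<phi>)"
      unfolding SS by (simp only: commutator_def lin_scale[OF lin(2)] wscale_simps)
    also have "commutator (z i) (S (Suc m)) \<phi> + \<dots> =
        wscale (of_nat (Suc (Suc m)) * (- of_nat (Suc m) - a)) (S (Suc m) \<phi>)"
      unfolding zS by (simp add: wscale_def fun_simps algebra_simps)
    finally show ?case .
  qed
  have xk: "commutator (x k) (S m) \<phi> = 0" if "k \<noteq> i" "k \<noteq> j" for m \<phi>
  proof (induction m arbitrary: \<phi>)
    case 0
    show ?case using that by (simp add: S0 xy)
  next
    case (Suc m)
    have c: "commutator (x k) (y i) = (\<lambda>_. 0)" "commutator (x k) (S m) = (\<lambda>_. 0)"
      using that Suc by (auto simp: xy)
    show ?case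
      unfolding SS commutator_jacobi[OF lin(1) lin(2) linS] c
      by (simp add: commutator_def lin_zero[OF linS] lin_zero[OF lin(2)])
  qed
  have xj: "commutator (x j) (S (Suc m)) \<phi> =
      (if m = 0 then wscale (of_int (cartan n j i)) (y i \<phi>) else 0)" for m \<phi>
  proof (induction m arbitrary: \<phi>)
    case 0
    have c: "commutator (x j) (y i) = (\<lambda>_. 0)" "commutator (x j) (y j) = z j"
      using ij by (auto simp: xy)
    have "commutator (x j) (S (Suc 0)) \<phi> = commutator (\<lambda>_. 0) (S 0) \<phi> + commutator (y i) (z j) \<phi>"
      using commutator_jacobi[OF lin(1) lin(2) linS, of j i 0 \<phi>] by (simp add: SS S0 c)
    also have "commutator (\<lambda>_. 0) (S 0) \<phi> = 0"
      by (simp add: commutator_def lin_zero[OF linS])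
    also have "commutator (y i) (z j) \<phi> = - commutator (z j) (y i) \<phi>"
      by (simp add: commutator_def)
    finally show ?case
      by (simp add: zy)
  next
    case (Suc m)
    have c: "commutator (x j) (y i) = (\<lambda>_. 0)"
      using ij by (auto simp: xy)
    have IH: "commutator (x j) (S (Suc m)) =
        (\<lambda>\<phi>. if m = 0 then wscale (of_int (cartan n j i)) (y i \<phi>) else 0)"
      by (rule ext) (rule Suc)
    show ?case
      unfolding SS[of "Suc m"] commutator_jacobi[OF lin(1) lin(2) linS] c IH
      by (simp add: commutator_def lin_zero[OF linS] lin_zero[OF lin(2)] lin_scale[OF lin(2)])
  qed
  obtain m where m: "nat (1 - cartan n i j) = Suc m" "a = - of_nat m"
  proof
    have "cartan n i j \<le> 0" using ij by (auto simp: cartan_def)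
    then show "nat (1 - cartan n i j) = Suc (nat (- cartan n i j))" "a = - of_nat (nat (- cartan n i j))"
      by (auto simp: a_def of_nat_nat)
  qed
  have "cartan n j i = 0" if "m = 0"
    using m that by (auto simp: a_def cartan_def split: if_splits)
  then have "commutator (x k) (S (Suc m)) \<phi> = 0"
    using xk[of "Suc m" \<phi>] xi[of m \<phi>] xj[of m \<phi>] m
    by (cases "k = i"; cases "k = j") (auto simp: wscale_simps)
  then show ?thesis
    unfolding m S_def[symmetric] by (simp add: commutator_def)
qed

inductive_set L_carrier :: "nat \<Rightarrow> weight \<Rightarrow> wfun set" for n \<Lambda> where
  vac: "vac \<in> L_carrier n \<Lambda>"
| add: "\<phi> \<in> L_carrier n \<Lambda> \<Longrightarrow> \<psi> \<in> L_carrier n \<Lambda> \<Longrightarrow> \<phi> + \<psi> \<in> L_carrier n \<Lambda>"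
| scale: "\<phi> \<in> L_carrier n \<Lambda> \<Longrightarrow> wscale c \<phi> \<in> L_carrier n \<Lambda>"
| f: "\<phi> \<in> L_carrier n \<Lambda> \<Longrightarrow> j \<le> n \<Longrightarrow> f_op n \<Lambda> j \<phi> \<in> L_carrier n \<Lambda>"

lemma zero_L: "0 \<in> L_carrier n \<Lambda>"
  using L_carrier.scale[OF L_carrier.vac, where c = 0] by (simp add: wscale_simps)

lemma diff_L: "\<phi> \<in> L_carrier n \<Lambda> \<Longrightarrow> \<psi> \<in> L_carrier n \<Lambda> \<Longrightarrow> \<phi> - \<psi> \<in> L_carrier n \<Lambda>"
  using L_carrier.add[of \<phi> n \<Lambda> "wscale (-1) \<psi>"] L_carrier.scale[of \<psi> n \<Lambda> "-1"]
  by (simp add: wscale_simps)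

lemma diag_vac: "diag_op b c vac = wscale b vac"
  by (auto simp: diag_op_def wscale_def vac_def)

lemma e_vac: "e_op j vac = 0"
  by (auto simp: e_op_def vac_def fun_simps)

lemma diag_L: "\<phi> \<in> L_carrier n \<Lambda> \<Longrightarrow> diag_op b c \<phi> \<in> L_carrier n \<Lambda>"
proof (induction rule: L_carrier.induct)
  case vac
  then show ?case by (simp add: diag_vac L_carrier.intros)
next
  case (f \<phi> j)
  have "diag_op b c (f_op n \<Lambda> j \<phi>) = f_op n \<Lambda> j (diag_op b c \<phi>) - wscale (c j) (f_op n \<Lambda> j \<phi>)"
    using comm_diag_f[of b c n \<Lambda> j \<phi>] by (simp add: commutator_def algebra_simps)
  with f show ?case by (simp add: L_carrier.intros diff_L)
qed (simp_all add: lin_add[OF lin_diag] lin_scale[OF lin_diag] L_carrier.intros)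

lemma e_L: "\<phi> \<in> L_carrier n \<Lambda> \<Longrightarrow> e_op j \<phi> \<in> L_carrier n \<Lambda>"
proof (induction rule: L_carrier.induct)
  case vac
  then show ?case by (simp add: e_vac zero_L)
next
  case (f \<phi> k)
  have "e_op j (f_op n \<Lambda> k \<phi>) = f_op n \<Lambda> k (e_op j \<phi>) + (if j = k then h_op n \<Lambda> j \<phi> else 0)"
    using comm_e_f[of j n \<Lambda> k \<phi>] by (simp add: commutator_def algebra_simps)
  with f show ?case by (cases "j = k") (auto simp: h_op_def intro!: L_carrier.intros diag_L)
qed (simp_all add: lin_add[OF lin_e] lin_scale[OF lin_e] L_carrier.intros)

lemma f_word_support:
  assumes "\<And>u. length u \<ge> N \<Longrightarrow> \<phi> u = 0" "length u > N"
  shows "f_word n \<Lambda> j u \<phi> = 0"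
  using assms
proof (induction u arbitrary: N \<phi>)
  case (Cons i u)
  have "f_word n \<Lambda> j u (e_op i \<phi>) = 0"
  proof (cases N)
    case 0
    then have "e_op i \<phi> = 0" using Cons by (auto simp: e_op_def fun_simps)
    then show ?thesis by (simp add: f_word_zero)
  next
    case (Suc M)
    show ?thesis
      by (rule Cons.IH[of M]) (use Cons.prems Suc in \<open>auto simp: e_op_def\<close>)
  qed
  moreover have "h_op n \<Lambda> j \<phi> u = 0"
    using Cons.prems by (simp add: h_op_def diag_op_def)
  ultimately show ?case by simp
qed simp

lemma f_word_good:
  assumes "\<And>u. \<not> set u \<subseteq> {..n} \<Longrightarrow> \<phi> u = 0" "\<not> set u \<subseteq> {..n}" "j \<le> n"
  shows "f_word n \<Lambda> j u \<phi> = 0"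
  using assms
proof (induction u arbitrary: \<phi>)
  case (Cons i u)
  show ?case
  proof (cases "i \<le> n")
    case True
    have "f_word n \<Lambda> j u (e_op i \<phi>) = 0"
      by (rule Cons.IH) (use Cons.prems True in \<open>auto simp: e_op_def\<close>)
    moreover have "h_op n \<Lambda> j \<phi> u = 0"
      using Cons.prems True by (auto simp: h_op_def diag_op_def)
    ultimately show ?thesis by simp
  next
    case False
    then have "e_op i \<phi> = 0" using Cons by (auto simp: e_op_def fun_simps)
    then show ?thesis using False \<open>j \<le> n\<close> by (auto simp: f_word_zero)
  qed
qed simp

lemma L_support:
  assumes "\<phi> \<in> L_carrier n \<Lambda>"
  shows "\<exists>N. \<forall>u. length u \<ge> N \<longrightarrow> \<phi> u = 0" and "\<not> set u \<subseteq> {..n} \<Longrightarrow> \<phi> u = 0"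
proof -
  show "\<exists>N. \<forall>u. length u \<ge> N \<longrightarrow> \<phi> u = 0" using assms
  proof induction
    case vac
    show ?case by (rule exI[of _ 1]) (auto simp: vac_def)
  next
    case (add \<phi> \<psi>)
    then obtain M N where "\<forall>u. length u \<ge> M \<longrightarrow> \<phi> u = 0" "\<forall>u. length u \<ge> N \<longrightarrow> \<psi> u = 0" by blast
    then show ?case by (intro exI[of _ "max M N"]) (auto simp: plus_fun_apply)
  next
    case (scale \<phi> c)
    then show ?case by (auto simp: wscale_def)
  next
    case (f \<phi> j)
    then obtain N where "\<forall>u. length u \<ge> N \<longrightarrow> \<phi> u = 0" by blast
    then show ?case
      by (intro exI[of _ "Suc N"]) (auto simp: f_op_def intro!: f_word_support[of N])
  qed
  show "\<phi> u = 0" if "\<not> set u \<subseteq> {..n}" using assms that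
  proof (induction arbitrary: u)
    case vac
    then show ?case by (auto simp: vac_def)
  next
    case (f \<phi> j)
    then show ?case by (simp add: f_op_def f_word_good)
  qed (simp_all add: wscale_def plus_fun_apply)
qed

lemma serre_f_zero:
  assumes "i \<noteq> j"
  shows "(commutator (f_op n \<Lambda> i) ^^ nat (1 - cartan n i j)) (f_op n \<Lambda> j) \<phi> = 0"
proof -
  let ?S = "(commutator (f_op n \<Lambda> i) ^^ nat (1 - cartan n i j)) (f_op n \<Lambda> j)"
  have nil: "(commutator (f_op n \<Lambda> i) ^^ m) (f_op n \<Lambda> j) \<phi> [] = 0" for m \<phi>
    by (induction m arbitrary: \<phi>) (auto simp: commutator_def f_op_def[of n \<Lambda> _ "_ :: wfun"] minus_apply)
  have "?S \<phi> u = 0" for u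
  proof (induction u arbitrary: \<phi>)
    case (Cons k u)
    have "e_op k (?S \<phi>) = ?S (e_op k \<phi>)"
    proof (rule serre_commutes[where z = "h_op n \<Lambda>" and n = n])
      show "commutator (h_op n \<Lambda> k) (f_op n \<Lambda> l) \<phi> =
        - wscale (of_int (cartan n k l)) (f_op n \<Lambda> l \<phi>)" for k l \<phi>
        unfolding h_op_def by (rule comm_diag_f)
    qed (use assms in \<open>auto simp: lin_e lin_f lin_h comm_e_f\<close>)
    then have "?S \<phi> (k # u) = ?S (e_op k \<phi>) u"
      by (auto simp: e_op_def[of k "?S \<phi>"] fun_simps)
    with Cons show ?case by simp
  qed (rule nil)
  then show ?thesis by (auto simp: fun_simps)
qed

lemma serre_e_zero:
  assumes "i \<noteq> j" "\<phi> \<in> L_carrier n \<Lambda>"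
  shows "(commutator (e_op i) ^^ nat (1 - cartan n i j)) (e_op j) \<phi> = 0"
  using assms(2)
proof induction
  let ?S = "(commutator (e_op i) ^^ nat (1 - cartan n i j)) (e_op j)"
  have lS: "lin ?S" by (intro lin_commutator_pow lin_e)
  {
    case vac
    have "(commutator (e_op i) ^^ m) (e_op j) vac = 0" for m
    proof (induction m)
      case (Suc m)
      then show ?case
        using lin_zero[OF lin_commutator_pow[OF lin_e lin_e]]
        by (simp add: commutator_def[of "e_op i" "_ _"] e_vac lin_zero[OF lin_e])
    qed (simp add: e_vac)
    then show ?case .
  next
    case (add \<phi> \<psi>)
    then show ?case by (simp add: lin_add[OF lS])
  next
    case (scale \<phi> c)
    then show ?case by (simp add: lin_scale[OF lS] wscale_simps)
  next
    case (f \<phi> k)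
    let ?z = "\<lambda>k \<phi>. - h_op n \<Lambda> k \<phi>"
    have "f_op n \<Lambda> k (?S \<phi>) = ?S (f_op n \<Lambda> k \<phi>)"
    proof (rule serre_commutes[where z = ?z and n = n])
      show "commutator (?z k) (e_op l) \<phi> = - wscale (of_int (cartan n k l)) (e_op l \<phi>)" for k l \<phi>
        using comm_diag_e[of "fst \<Lambda> k" "\<lambda>l. of_int (cartan n k l)" l \<phi>]
        by (simp add: commutator_def h_op_def lin_minus[OF lin_e] algebra_simps)
      show "commutator (f_op n \<Lambda> k) (e_op l) \<phi> = (if k = l then ?z k \<phi> else 0)" for k l \<phi>
        using comm_e_f[of l n \<Lambda> k \<phi>] by (auto simp: commutator_def algebra_simps split: if_splits)
      show "lin (?z k)" for k
        using lin_h[of n \<Lambda> k] by (auto simp: lin_def wscale_simps)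
    qed (use assms in \<open>auto simp: lin_e lin_f\<close>)
    with f show ?case by (simp add: lin_zero[OF lin_f])
  }
qed

primrec interp :: "nat \<Rightarrow> weight \<Rightarrow> lie_expr \<Rightarrow> wfun \<Rightarrow> wfun" where
  "interp n \<Lambda> (Gen_e j) = (if j \<le> n then e_op j else (\<lambda>_. 0))"
| "interp n \<Lambda> (Gen_f j) = (if j \<le> n then f_op n \<Lambda> j else (\<lambda>_. 0))"
| "interp n \<Lambda> (Gen_h j) = (if j \<le> n then h_op n \<Lambda> j else (\<lambda>_. 0))"
| "interp n \<Lambda> Gen_d = diag_op (snd \<Lambda>) (\<lambda>l. of_bool (l = 0))"
| "interp n \<Lambda> Zero = (\<lambda>_. 0)"
| "interp n \<Lambda> (Add x y) = (\<lambda>\<phi>. interp n \<Lambda> x \<phi> + interp n \<Lambda> y \<phi>)"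
| "interp n \<Lambda> (Scale c x) = (\<lambda>\<phi>. wscale c (interp n \<Lambda> x \<phi>))"
| "interp n \<Lambda> (Bracket x y) = commutator (interp n \<Lambda> x) (interp n \<Lambda> y)"

lemma lin_interp: "lin (interp n \<Lambda> x)"
proof (induction x)
  case (Scale c x)
  then show ?case by (auto simp: lin_def wscale_simps mult.commute)
next
  case (Add x y)
  then show ?case by (auto simp: lin_def wscale_simps)
qed (auto simp: lin_e lin_f lin_h lin_diag lin_commutator, auto simp: lin_def wscale_simps)

lemma interp_L: "\<phi> \<in> L_carrier n \<Lambda> \<Longrightarrow> interp n \<Lambda> x \<phi> \<in> L_carrier n \<Lambda>"
  by (induction x arbitrary: \<phi>)
     (auto simp: zero_L e_L diag_L h_op_def commutator_def intro: L_carrier.intros diff_L)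

lemma interp_pow: "interp n \<Lambda> ((Bracket x ^^ m) y) = (commutator (interp n \<Lambda> x) ^^ m) (interp n \<Lambda> y)"
  by (induction m) auto

lemma interp_lie_eq:
  "lie_eq n x y \<Longrightarrow> \<phi> \<in> L_carrier n \<Lambda> \<Longrightarrow> interp n \<Lambda> x \<phi> = interp n \<Lambda> y \<phi>"
proof (induction arbitrary: \<phi> rule: lie_eq.induct)
  case (cong_bracket x x' y y')
  then show ?case by (simp add: commutator_def interp_L)
next
  case (serre_e i j)
  then show ?case by (simp add: interp_pow serre_e_zero)
next
  case (serre_f i j)
  then show ?case by (simp add: interp_pow serre_f_zero)
next
  case (jacobi x y z)
  then show ?case by (simp add: commutator_def lin_diff[OF lin_interp])
next
  case (e_f i j)
  then show ?case by (simp add: comm_e_f)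
next
  case (h_e i j)
  then show ?case by (simp add: h_op_def comm_diag_e)
next
  case (h_f i j)
  then show ?case by (simp add: h_op_def comm_diag_f wscale_simps)
next
  case (d_e j)
  then show ?case by (simp add: comm_diag_e)
next
  case (d_f j)
  then show ?case by (simp add: comm_diag_f wscale_simps)
next
  case (h_h i j)
  then show ?case by (simp add: h_op_def comm_diag_diag)
next
  case (d_h j)
  then show ?case by (simp add: h_op_def comm_diag_diag)
next
  case (bracket_add_left x y z)
  then show ?case by (simp add: commutator_def lin_add[OF lin_interp])
next
  case (bracket_add_right x y z)
  then show ?case by (simp add: commutator_def lin_add[OF lin_interp])
next
  case (bracket_scale_left a x y)
  then show ?case by (simp add: commutator_def lin_scale[OF lin_interp] wscale_simps)
next
  case (bracket_scale_right x a y)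
  then show ?case by (simp add: commutator_def lin_scale[OF lin_interp] wscale_simps)
next
  case (alternating x)
  then show ?case by (simp add: commutator_def)
qed (simp_all add: wscale_simps algebra_simps)

definition L_act :: "nat \<Rightarrow> weight \<Rightarrow> lie_elem \<Rightarrow> wfun \<Rightarrow> wfun" where
  "L_act n \<Lambda> c = interp n \<Lambda> (SOME x. x \<in> c)"

lemma L_act: "\<phi> \<in> L_carrier n \<Lambda> \<Longrightarrow> L_act n \<Lambda> (lie_class n x) \<phi> = interp n \<Lambda> x \<phi>"
proof -
  assume "\<phi> \<in> L_carrier n \<Lambda>"
  moreover have "(SOME y. y \<in> lie_class n x) \<in> lie_class n x"
    by (rule someI[of _ x]) (simp add: lie_class_def lie_eq.refl)
  ultimately show ?thesis
    unfolding L_act_def by (metis interp_lie_eq lie_class_def mem_Collect_eq)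
qed

lemma irreducible_highest_weight_module_exists:
  "irreducible_highest_weight_module wscale n (L_carrier n \<Lambda>) (L_act n \<Lambda>) \<Lambda>"
proof -
  interpret vector_space wscale by (rule wscale_vector_space)
  interpret C1_module wscale n "L_carrier n \<Lambda>" "L_act n \<Lambda>"
  proof
    show "subspace (L_carrier n \<Lambda>)"
      by (rule subspaceI) (auto intro: zero_L L_carrier.intros)
  qed (simp_all add: L_act interp_L L_carrier.intros lin_add[OF lin_interp] lin_scale[OF lin_interp]
        commutator_def)
  have e_sub: "e_op j \<phi> \<in> W" if "submodule W" "\<phi> \<in> W" "j \<le> n" for W \<phi> j
  proof -
    have "L_act n \<Lambda> (lie_class n (Gen_e j)) \<phi> \<in> W" "\<phi> \<in> L_carrier n \<Lambda>"
      using that by (auto simp: submodule_def)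
    then show ?thesis using that by (simp add: L_act)
  qed
  have generated: "W = L_carrier n \<Lambda>" if W: "submodule W" "vac \<in> W" for W
  proof
    show "W \<subseteq> L_carrier n \<Lambda>" using W by (auto simp: submodule_def)
    have sub: "subspace W" using W by (simp add: submodule_def)
    show "L_carrier n \<Lambda> \<subseteq> W"
    proof
      fix \<phi> assume "\<phi> \<in> L_carrier n \<Lambda>"
      then show "\<phi> \<in> W"
      proof induction
        case (f \<phi> j)
        then have "L_act n \<Lambda> (lie_class n (Gen_f j)) \<phi> \<in> W"
          using W by (auto simp: submodule_def)
        with f show ?case by (simp add: L_act)
      qed (use W sub in \<open>auto intro: subspace_add subspace_scale\<close>)
    qed
  qed
  have vac0: "vac \<noteq> 0" by (auto simp: vac_def fun_simps)
  show ?thesis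
  proof unfold_locales
    show "highest_weight_module \<Lambda>"
      unfolding highest_weight_module_def
    proof (intro bexI[of _ vac] conjI allI impI)
      show "vac \<in> weight_space \<Lambda>"
        by (simp add: weight_space_def L_act L_carrier.vac h_op_def diag_vac)
    qed (use vac0 generated in \<open>auto simp: L_act L_carrier.vac e_vac\<close>)
    show irreducible_module
      unfolding irreducible_module_def
    proof (intro conjI allI impI)
      show "L_carrier n \<Lambda> \<noteq> {0}" using L_carrier.vac vac0 by blast
      fix W assume W: "submodule W"
      then have sub: "subspace W" by (simp add: submodule_def)
      show "W = {0} \<or> W = L_carrier n \<Lambda>"
      proof (cases "W = {0}")
        case False
        then obtain \<phi> where \<phi>: "\<phi> \<in> W" "\<phi> \<noteq> 0" using subspace_0[OF sub] by blast
        then have \<phi>L: "\<phi> \<in> L_carrier n \<Lambda>" using W by (auto simp: submodule_def)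
        obtain N where N: "\<And>u. length u \<ge> N \<Longrightarrow> \<phi> u = 0" using L_support(1)[OF \<phi>L] by blast
        obtain w where "\<phi> w \<noteq> 0" using \<phi> by (auto simp: fun_simps)
        then obtain u where u: "\<phi> u \<noteq> 0" "\<And>v. \<phi> v \<noteq> 0 \<Longrightarrow> length v \<le> length u"
          using ex_has_greatest_nat[of "\<lambda>u. \<phi> u \<noteq> 0" w length N] N by (meson not_le_imp_less less_imp_le)
        have good: "set u \<subseteq> {..n}" using L_support(2)[OF \<phi>L] u by blast
        have "(\<lambda>v. \<phi> (u @ v)) \<in> W" using \<phi>(1) good
        proof (induction u arbitrary: \<phi>)
          case (Cons k u)
          then show ?case using Cons.IH[of "e_op k \<phi>"] e_sub[OF W] by (simp add: e_op_def)
        qed simp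
        moreover have "(\<lambda>v. \<phi> (u @ v)) = wscale (\<phi> u) vac"
        proof
          fix v show "\<phi> (u @ v) = wscale (\<phi> u) vac v"
            using u(2)[of "u @ v"] by (cases "v = []") (auto simp: wscale_def vac_def)
        qed
        ultimately have "wscale (inverse (\<phi> u)) (wscale (\<phi> u) vac) \<in> W"
          using subspace_scale[OF sub] by metis
        then have "vac \<in> W" using u by (simp add: wscale_simps)
        then show ?thesis using generated[OF W] by simp
      qed simp
    qed
  qed
qed

declare plus_fun_apply [simp] zero_fun_apply [simp] minus_apply [simp] uminus_apply [simp]

end

theory Submission
  imports Defs
begin

text \<open>
  The module \<open>L(\<Lambda>\<^sub>i)\<close> is compared with a fermionic Fock space on which the lowering operator
  \<open>f\<^sub>j\<close> moves one particle from a site \<open>a \<equiv> \<plusminus>j (mod 2n)\<close> to the site \<open>a + 1\<close>. In both spaces a vector of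
  positive degree that is killed by all raising operators vanishes: in \<open>L(\<Lambda>\<^sub>i)\<close> by irreducibility, in
  the space generated from the vacuum of charge \<open>i\<close> because \<open>e\<^sub>j\<close> is adjoint to \<open>f\<^sub>j\<close> for a positive form. By induction
  on the degree, words in the \<open>f\<^sub>j\<close> applied to the highest weight vector and to the vacuum satisfy the same
  linear relations, so the components of degree \<open>N\<close> have the same dimension.

  Basis states of the Fock space are lists of nested hooks (hole \<open>a \<le> i\<close>, particle \<open>p > i\<close>). Call
  such a list good if \<open>1 \<le> a + p \<le> 2n + 1\<close> for all its hooks. Commutators of the \<open>f\<^sub>j\<close> give longer hops, and
  applying the hops of a good list to the vacuum yields a triangular system, so there are at least as many
  independent vectors as good lists. Conversely, an operator creating pairs of particles at
  \<open>r\<close> and \<open>1 - r\<close> commutes with all \<open>f\<^sub>j\<close> and kills the vacuum. The resulting Garnir relations, together with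
  particle-hole duality, show that a generated vector vanishing at all good lists is zero. Hence the dimension
  in degree \<open>N\<close> is the number of good lists of size \<open>N\<close>.

  The hook \<open>(a, p)\<close> corresponds to the part of size \<open>p - a\<close> with subscript \<open>2n + 1 - a - p\<close>. Two parts lie on
  a common path unless their sizes differ by more than their subscripts, that is, unless the hooks are
  nested; so good lists are the path partitions. Finally, good lists in a box are counted by an alternating
  sum of Gaussian binomials (method of images), and the Jacobi triple product evaluates the limit.
\<close>

section \<open>Gaussian binomials and the Jacobi triple product\<close>

text \<open>The ambient Fock space belongs to affine sl_2n. Folding its cycle of 2n residues by the
  reflection a to -a gives type C; the fixed residues 0 and n become the two long nodes. The pairing
  of site r with site 1 - r is the symplectic form preserved by the folding, so \<open>raise\<close>
  is the analogue of multiplying an exterior algebra by the symplectic bivector, whose kernel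
  consists of fundamental modules of sp_2n. Particle-hole duality turns it into a second operator
  that pairs sites with sum 2n + 1. These two pair sums are the two bounds on a + p in a good list.
  The obstacle is that each of the two operators yields only one of the bounds, while a single
  configuration has to satisfy both. It is chosen extremal for two quantities, the number of holes
  and \<open>energy\<close>, and both are designed to be invariant under the duality. The same kind
  of symmetry governs the counting: the two bounds confine good lists to a strip, and the
  alternating sum over reflections in its two mirrors is already a theta series.\<close>

primrec gauss_binomial :: "complex fps \<Rightarrow> nat \<Rightarrow> int \<Rightarrow> complex fps" where
  "gauss_binomial q 0 k = (if k = 0 then 1 else 0)"
| "gauss_binomial q (Suc m) k = gauss_binomial q m (k - 1) + q ^ nat k * gauss_binomial q m k"

text \<open>Vanishing outside 0..m makes the truncation in \<open>nat k\<close> harmless and allows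
  sums over symmetric integer ranges.\<close>

lemma gauss_binomial_eq_0: "k < 0 \<or> int m < k \<Longrightarrow> gauss_binomial q m k = 0"
  by (induction m arbitrary: k) auto

lemma gauss_binomial_0_right: "gauss_binomial q m 0 = 1"
  by (induction m) (auto simp: gauss_binomial_eq_0)

lemma gauss_binomial_self: "gauss_binomial q m (int m) = 1"
  by (induction m) (auto simp: gauss_binomial_eq_0)

text \<open>The second Pascal rule; together with the defining one it yields symmetry and
  absorption.\<close>

lemma gauss_binomial_Suc':
  "gauss_binomial q (Suc m) k = q ^ nat (int m + 1 - k) * gauss_binomial q m (k - 1) + gauss_binomial q m k"
proof (induction m arbitrary: k)
  case 0
  show ?case by auto
next
  case (Suc m)
  \<comment> \<open>Both exponents are m + 1 when 1 <= k <= m + 1; elsewhere the binomial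
    vanishes.\<close>
  have eq: "q ^ nat k * (q ^ nat (int m + 1 - k) * gauss_binomial q m (k - 1))
     = q ^ nat (int m + 2 - k) * (q ^ nat (k - 1) * gauss_binomial q m (k - 1))"
  proof (cases "1 \<le> k \<and> k \<le> int m + 1")
    case True
    then have "nat k + nat (int m + 1 - k) = nat (int m + 2 - k) + nat (k - 1)" by linarith
    then show ?thesis by (metis (no_types, lifting) mult.assoc power_add)
  qed (auto simp: gauss_binomial_eq_0)
  have "gauss_binomial q (Suc (Suc m)) k
      = gauss_binomial q (Suc m) (k - 1) + q ^ nat k * gauss_binomial q (Suc m) k"
    by (rule gauss_binomial.simps(2))
  also have "\<dots> = q ^ nat (int m + 2 - k) * gauss_binomial q m (k - 2) + gauss_binomial q m (k - 1)
      + q ^ nat k * (q ^ nat (int m + 1 - k) * gauss_binomial q m (k - 1) + gauss_binomial q m k)"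
    unfolding Suc.IH by (simp add: algebra_simps)
  also have "\<dots> = q ^ nat (int (Suc m) + 1 - k) * gauss_binomial q (Suc m) (k - 1) + gauss_binomial q (Suc m) k"
    using eq by (simp add: algebra_simps)
  finally show ?case .
qed

text \<open>The reflection k to m - k interchanges the two Pascal rules.\<close>

lemma gauss_binomial_sym: "gauss_binomial q m (int m - k) = gauss_binomial q m k"
proof (induction m arbitrary: k)
  case (Suc m)
  have "gauss_binomial q (Suc m) (int (Suc m) - k)
      = q ^ nat k * gauss_binomial q m (int m - k) + gauss_binomial q m (int m - (k - 1))"
    unfolding gauss_binomial_Suc' by (simp add: algebra_simps)
  then show ?case unfolding Suc.IH by simp
qed auto

text \<open>Multiply the second Pascal rule by q^k and subtract it from the first.\<close>

lemma gauss_binomial_absorption: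
  "(1 - q ^ nat k) * gauss_binomial q (Suc m) k = (1 - q ^ Suc m) * gauss_binomial q m (k - 1)"
proof (cases "1 \<le> k \<and> k \<le> int m + 1")
  case True
  have "q ^ nat k * gauss_binomial q (Suc m) k
      = q ^ (nat k + nat (int m + 1 - k)) * gauss_binomial q m (k - 1) + q ^ nat k * gauss_binomial q m k"
    unfolding gauss_binomial_Suc' by (simp add: power_add algebra_simps)
  moreover have "nat k + nat (int m + 1 - k) = Suc m" using True by linarith
  ultimately show ?thesis by (simp add: algebra_simps)
qed (cases "k = 0"; auto simp: gauss_binomial_eq_0)

text \<open>This is the inclusion-exclusion recursion of the box counts inside the strip, see
  \<open>box_gf_Suc\<close>; it is why binomials can count boxed lists.\<close>

lemma gauss_binomial_four_term:
  "gauss_binomial q (Suc (Suc m)) k =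
     gauss_binomial q (Suc m) k + gauss_binomial q (Suc m) (k - 1) - (1 - q ^ Suc m) * gauss_binomial q m (k - 1)"
  using gauss_binomial_absorption[of q k m] gauss_binomial.simps(2)[of q "Suc m" k]
  by (simp add: algebra_simps del: gauss_binomial.simps)

definition q_factorial :: "complex fps \<Rightarrow> nat \<Rightarrow> complex fps" where
  "q_factorial q m = (\<Prod>j<m. 1 - q ^ Suc j)"

lemma gauss_binomial_q_factorial:
  "0 \<le> k \<Longrightarrow> k \<le> int m \<Longrightarrow>
   gauss_binomial q m k * q_factorial q (nat k) * q_factorial q (m - nat k) = q_factorial q m"
proof (induction m arbitrary: k)
  case (Suc m)
  show ?case
  proof (cases "k = 0")
    case True
    then show ?thesis by (simp only: gauss_binomial_0_right) (simp add: q_factorial_def)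
  next
    case False
    with Suc.prems have k: "nat k = Suc (nat (k - 1))" by linarith
    have "gauss_binomial q (Suc m) k * q_factorial q (nat k) * q_factorial q (Suc m - nat k)
       = ((1 - q ^ nat k) * gauss_binomial q (Suc m) k) * q_factorial q (nat (k - 1)) * q_factorial q (m - nat (k - 1))"
      using k by (simp add: q_factorial_def del: gauss_binomial.simps)
    also have "\<dots> = (1 - q ^ Suc m) * (gauss_binomial q m (k - 1) * q_factorial q (nat (k - 1)) * q_factorial q (m - nat (k - 1)))"
      unfolding gauss_binomial_absorption by simp
    also have "\<dots> = q_factorial q (Suc m)"
      using Suc.IH[of "k - 1"] Suc.prems False by (simp add: q_factorial_def)
    finally show ?thesis .
  qed
qed (simp add: q_factorial_def)


section \<open>Power series modulo X^(N+1) and truncated products\<close>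

definition agree_upto :: "nat \<Rightarrow> complex fps \<Rightarrow> complex fps \<Rightarrow> bool" where
  "agree_upto N f g \<longleftrightarrow> (\<forall>j\<le>N. fps_nth f j = fps_nth g j)"

lemma agree_upto_refl [simp]: "agree_upto N f f"
  by (simp add: agree_upto_def)

lemma agree_upto_sym: "agree_upto N f g \<Longrightarrow> agree_upto N g f"
  by (simp add: agree_upto_def)

lemma agree_upto_trans [trans]: "agree_upto N f g \<Longrightarrow> agree_upto N g h \<Longrightarrow> agree_upto N f h"
  by (simp add: agree_upto_def)

lemma agree_upto_mult: "agree_upto N f g \<Longrightarrow> agree_upto N f' g' \<Longrightarrow> agree_upto N (f * f') (g * g')"
  unfolding agree_upto_def fps_mult_nth by (auto intro!: sum.cong)

lemma agree_upto_diff: "agree_upto N f g \<Longrightarrow> agree_upto N f' g' \<Longrightarrow> agree_upto N (f - f') (g - g')"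
  unfolding agree_upto_def by simp

lemma agree_upto_add: "agree_upto N f g \<Longrightarrow> agree_upto N f' g' \<Longrightarrow> agree_upto N (f + f') (g + g')"
  unfolding agree_upto_def by simp

lemma agree_upto_sum: "(\<And>k. k \<in> A \<Longrightarrow> agree_upto N (f k) (g k)) \<Longrightarrow> agree_upto N (sum f A) (sum g A)"
  unfolding agree_upto_def fps_sum_nth by (auto intro!: sum.cong)

lemma agree_upto_X_power: "N < m \<Longrightarrow> agree_upto N (fps_X ^ m * f) 0"
  unfolding agree_upto_def by (auto simp: fps_X_power_mult_nth)

lemma agree_upto_cancel:
  assumes "agree_upto N (f * g) (f * h)" "fps_nth f 0 \<noteq> 0"
  shows "agree_upto N g h"
proof -
  have "agree_upto N (inverse f * (f * g)) (inverse f * (f * h))"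
    by (rule agree_upto_mult[OF agree_upto_refl assms(1)])
  moreover have "inverse f * f = 1" using assms(2) by (rule inverse_mult_eq_1)
  ultimately show ?thesis by (simp flip: mult.assoc)
qed

text \<open>The finite product (X^s; X^M)_m. For positive s and M its coefficients up to X^N are
  final once m reaches N.\<close>

definition qpoch_partial :: "nat \<Rightarrow> nat \<Rightarrow> nat \<Rightarrow> complex fps" where
  "qpoch_partial s M m = (\<Prod>k<m. 1 - fps_X ^ s * (fps_X ^ M) ^ k)"

lemma qpoch_partial_nth_0: "s > 0 \<Longrightarrow> fps_nth (qpoch_partial s M m) 0 = 1"
  by (induction m) (simp_all add: qpoch_partial_def)

lemma agree_upto_qpoch_partial:
  assumes "s > 0" "M > 0" "N \<le> m" "m \<le> m'"
  shows "agree_upto N (qpoch_partial s M m') (qpoch_partial s M m)"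
  using assms(4)
proof (induction m' rule: dec_induct)
  case (step k)
  \<comment> \<open>A factor of index k >= N deviates from 1 only in degree s + M k > N.\<close>
  have "k \<le> M * k" using assms(2) by simp
  then have "N < s + M * k" using assms step by linarith
  then have "agree_upto N (fps_X ^ (s + M * k) * 1) 0" by (rule agree_upto_X_power)
  then have "agree_upto N (1 - fps_X ^ s * (fps_X ^ M) ^ k) (1 - 0)"
    by (intro agree_upto_diff) (simp_all add: power_add power_mult)
  then have "agree_upto N (qpoch_partial s M k * (1 - fps_X ^ s * (fps_X ^ M) ^ k)) (qpoch_partial s M m * (1 - 0))"
    using step by (intro agree_upto_mult)
  then show ?case by (simp add: qpoch_partial_def)
qed simp

lemma agree_upto_qpoch:
  assumes "s > 0" "M > 0" "N \<le> m"
  shows "agree_upto N (qpoch (fps_X ^ s) (fps_X ^ M)) (qpoch_partial s M m)"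
proof -
  \<comment> \<open>The candidate limit takes its N-th coefficient from the N-th partial product,
    where it has become stationary.\<close>
  define P where "P = Abs_fps (\<lambda>N. fps_nth (qpoch_partial s M N) N)"
  let ?f = "\<lambda>k. 1 - fps_X ^ s * (fps_X ^ M) ^ k :: complex fps"
  have P: "agree_upto N P (qpoch_partial s M m)" if "N \<le> m" for N m
    unfolding agree_upto_def P_def fps_nth_Abs_fps
    using agree_upto_qpoch_partial[OF assms(1,2), of _ _ m] that
    by (metis agree_upto_def le_trans order_refl)
  have "(\<lambda>n. \<Prod>k\<le>n. ?f k) \<longlonglongrightarrow> P"
  proof (rule tendsto_fpsI)
    fix N
    show "\<forall>\<^sub>F n in sequentially. fps_nth (\<Prod>k\<le>n. ?f k) N = fps_nth P N"
      using eventually_ge_at_top[of N]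
    proof eventually_elim
      case (elim n)
      with P[of N "Suc n"] show ?case
        by (simp add: agree_upto_def qpoch_partial_def lessThan_Suc_atMost)
    qed
  qed
  \<comment> \<open>Convergence of a product requires a nonzero limit; the constant term 1 provides
    it.\<close>
  moreover have "fps_nth P 0 \<noteq> 0" using qpoch_partial_nth_0[OF assms(1)] by (simp add: P_def)
  ultimately have "?f has_prod P" by (auto simp: has_prod_def raw_has_prod_def)
  then have "qpoch (fps_X ^ s) (fps_X ^ M) = P" by (simp add: qpoch_def has_prod_unique[symmetric])
  with P[OF assms(3)] show ?thesis by simp
qed

lemma qpoch_nth_0: "s > 0 \<Longrightarrow> M > 0 \<Longrightarrow> fps_nth (qpoch (fps_X ^ s) (fps_X ^ M)) 0 = 1"
  using agree_upto_qpoch[of s M 0 0] by (simp add: agree_upto_def qpoch_partial_def)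

lemma q_factorial_eq: "q_factorial (fps_X ^ M) m = qpoch_partial M M m"
  by (simp add: q_factorial_def qpoch_partial_def)

text \<open>Away from both ends all three q-factorials of the quotient formula agree with the
  infinite product, so the binomial is its inverse up to order N.\<close>

lemma agree_upto_gauss_binomial:
  assumes "M > 0" "int N \<le> k" "k \<le> int m - int N"
  shows "agree_upto N (gauss_binomial (fps_X ^ M) m k * qpoch (fps_X ^ M) (fps_X ^ M)) 1"
proof -
  let ?Q = "qpoch (fps_X ^ M) (fps_X ^ M)" and ?g = "gauss_binomial (fps_X ^ M) m k"
  have ag: "agree_upto N ?Q (q_factorial (fps_X ^ M) l)" if "N \<le> l" for l
    using agree_upto_qpoch[OF assms(1,1) that] by (simp add: q_factorial_eq)
  have "agree_upto N (?g * ?Q * ?Q) (?g * q_factorial (fps_X ^ M) (nat k) * q_factorial (fps_X ^ M) (m - nat k))"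
    using assms by (intro agree_upto_mult ag) auto
  also have "?g * q_factorial (fps_X ^ M) (nat k) * q_factorial (fps_X ^ M) (m - nat k) = q_factorial (fps_X ^ M) m"
    using assms by (intro gauss_binomial_q_factorial) auto
  also have "agree_upto N (q_factorial (fps_X ^ M) m) ?Q"
    using assms by (intro agree_upto_sym[OF ag]) auto
  finally have "agree_upto N (?Q * (?g * ?Q)) (?Q * 1)" by (simp add: mult_ac)
  then show ?thesis by (rule agree_upto_cancel) (simp add: qpoch_nth_0 assms)
qed

section \<open>Theta series and the triple product\<close>

definition theta_exponent :: "int \<Rightarrow> int \<Rightarrow> int \<Rightarrow> int" where
  "theta_exponent M s r = M * (r * (r - 1) div 2) + s * r"

lemma theta_exponent_add1: "theta_exponent M s (r + 1) = theta_exponent M s r + M * r + s"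
proof -
  have "(r + 1) * (r + 1 - 1) = r * (r - 1) + r * 2" by (simp add: algebra_simps)
  then have "(r + 1) * (r + 1 - 1) div 2 = r * (r - 1) div 2 + r" by simp
  then show ?thesis by (simp add: theta_exponent_def algebra_simps)
qed

text \<open>For 0 < s < M the exponent is at least |r|, which cuts theta sums down to |r| <= N. For
  negative r the triangular number r(r-1)/2 is at least |r|, and the resulting M|r| outweighs s
  r.\<close>

lemma theta_exponent_ge:
  assumes "0 \<le> s" "s \<le> M"
  shows "min s (M - s) * \<bar>r\<bar> \<le> theta_exponent M s r"
proof (cases "r \<ge> 0")
  case True
  have "0 \<le> r * (r - 1) div 2" using True by (cases "r = 0") auto
  then have "0 \<le> M * (r * (r - 1) div 2)" using assms by simp
  moreover have "min s (M - s) * r \<le> s * r" using True by (intro mult_right_mono) auto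
  ultimately show ?thesis using True by (simp add: theta_exponent_def)
next
  case False
  have "r * (r - 1) = (- r) * (- r - 1) + (- r) * 2" by (simp add: algebra_simps)
  then have "r * (r - 1) div 2 = (- r) * (- r - 1) div 2 + (- r)" by simp
  moreover have "0 \<le> (- r) * (- r - 1)" using False by (intro mult_nonneg_nonneg) auto
  then have "0 \<le> (- r) * (- r - 1) div 2" by simp
  ultimately have "- r \<le> r * (r - 1) div 2" by simp
  then have "M * (- r) \<le> M * (r * (r - 1) div 2)" using assms by (intro mult_left_mono) auto
  moreover have "min s (M - s) * (- r) \<le> (M - s) * (- r)" using False by (intro mult_right_mono) auto
  ultimately show ?thesis using False by (simp add: theta_exponent_def algebra_simps)
qed

lemma theta_exponent_nonneg:
  assumes "0 \<le> s" "s \<le> M"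
  shows "0 \<le> theta_exponent M s r"
proof -
  have "0 \<le> min s (M - s) * \<bar>r\<bar>" using assms by (intro mult_nonneg_nonneg) auto
  also note theta_exponent_ge[OF assms, of r]
  finally show ?thesis .
qed

text \<open>Serves as reindexing over all integers: in a symmetric window only two boundary values
  have to vanish.\<close>

lemma sum_int_shift:
  fixes f :: "int \<Rightarrow> 'a::comm_monoid_add"
  assumes "f (- K) = 0" "f (K + 1) = 0"
  shows "(\<Sum>r=-K..K. f r) = (\<Sum>r=-K..K. f (r + 1))"
proof -
  have "(\<Sum>r=-K..K. f (r + 1)) = (\<Sum>r=-K+1..K+1. f r)"
    by (rule sum.reindex_bij_witness[of _ "\<lambda>r. r - 1" "\<lambda>r. r + 1"]) auto
  also have "\<dots> = (\<Sum>r=-K..K+1. f r)"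
  proof (rule sum.mono_neutral_left)
    have "{-K..K+1} - {-K+1..K+1} \<subseteq> {-K}" by auto
    then show "\<forall>r\<in>{-K..K+1} - {-K+1..K+1}. f r = 0" using assms by blast
  qed auto
  also have "\<dots> = (\<Sum>r=-K..K. f r)"
  proof (rule sum.mono_neutral_right)
    have "{-K..K+1} - {-K..K} \<subseteq> {K+1}" by auto
    then show "\<forall>r\<in>{-K..K+1} - {-K..K}. f r = 0" using assms by blast
  qed auto
  finally show ?thesis by simp
qed

text \<open>The r-th term of the theta series; r may be negative, so the sign is given by
  parity.\<close>

definition theta_term :: "nat \<Rightarrow> nat \<Rightarrow> int \<Rightarrow> complex fps" where
  "theta_term M s r = (if even r then 1 else - 1) * fps_X ^ nat (theta_exponent M s r)"

text \<open>Consecutive exponents differ by M r + s. Every cancellation of neighbouring theta terms,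
  in the triple product and in the method of images, is an instance; powers on both sides avoid
  negative exponents.\<close>

lemma theta_term_shift:
  assumes "s \<le> M" "int u - int v = int M * r + int s"
  shows "theta_term M s (r + 1) * fps_X ^ v = - (theta_term M s r * fps_X ^ u)"
proof -
  have "int (nat (theta_exponent M s (r + 1)) + v) = int (nat (theta_exponent M s r) + u)"
    using assms theta_exponent_nonneg[of s M r] theta_exponent_nonneg[of s M "r + 1"]
    unfolding theta_exponent_add1 by simp
  then have "nat (theta_exponent M s (r + 1)) + v = nat (theta_exponent M s r) + u" by (simp only: of_nat_eq_iff)
  then have "fps_X ^ nat (theta_exponent M s (r + 1)) * fps_X ^ v = (fps_X ^ nat (theta_exponent M s r) * fps_X ^ u :: complex fps)"
    by (metis power_add)
  then show ?thesis by (simp add: theta_term_def)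
qed

text \<open>Each factor comes from one Pascal step: one of the two Pascal terms, shifted by one in
  r, is a constant multiple of the other by \<open>theta_term_shift\<close>. Enlarging m uses the
  defining rule and gives a factor with M - s, enlarging m' the other rule and a factor with s. The
  bound on K keeps the support of the binomials inside the window.\<close>

lemma finite_jacobi_triple_product:
  assumes "s \<le> M" "int m + int m' < K"
  shows "(\<Sum>r=-K..K. theta_term M s r * gauss_binomial (fps_X ^ M) (m + m') (int m + r))
     = qpoch_partial (M - s) M m * qpoch_partial s M m'"
  using assms(2)
proof (induction m')
  case 0
  then show ?case
  proof (induction m)
    case 0
    have "(\<Sum>r=-K..K. theta_term M s r * gauss_binomial (fps_X ^ M) (0 + 0) (int 0 + r))
      = (\<Sum>r=-K..K. if r = 0 then 1 else 0)"
      by (intro sum.cong) (auto simp: theta_term_def theta_exponent_def)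
    also have "\<dots> = 1" using 0 by simp
    finally show ?case by (simp add: qpoch_partial_def)
  next
    case (Suc m)
    let ?g = "\<lambda>r. gauss_binomial (fps_X ^ M) m (int m + r)"
    \<comment> \<open>\<open>h (r + 1)\<close> is the second Pascal term at r; \<open>h r\<close>
      carries the same binomial as the first term, so the two can be compared.\<close>
    define h where "h r = theta_term M s (r - 1) * (fps_X ^ M) ^ nat (int m + r) * ?g r" for r
    have h: "h r = - (fps_X ^ (M - s) * (fps_X ^ M) ^ m) * (theta_term M s r * ?g r)" for r
    proof (cases "0 \<le> int m + r")
      case True
      have "theta_term M s (r - 1 + 1) * fps_X ^ (M - s + M * m) = - (theta_term M s (r - 1) * fps_X ^ (M * nat (int m + r)))"
        using assms(1) True by (intro theta_term_shift) (auto simp: algebra_simps of_nat_diff)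
      then have "theta_term M s (r - 1) * (fps_X ^ M) ^ nat (int m + r)
          = - (fps_X ^ (M - s) * (fps_X ^ M) ^ m) * theta_term M s r"
        by (simp add: power_add power_mult mult_ac equation_minus_iff)
      then show ?thesis unfolding h_def by (simp only: mult.assoc)
    qed (simp add: h_def gauss_binomial_eq_0)
    have "(\<Sum>r=-K..K. theta_term M s r * gauss_binomial (fps_X ^ M) (Suc m + 0) (int (Suc m) + r))
      = (\<Sum>r=-K..K. theta_term M s r * ?g r) + (\<Sum>r=-K..K. h (r + 1))"
      by (simp add: h_def algebra_simps flip: sum.distrib)
    also have "(\<Sum>r=-K..K. h (r + 1)) = (\<Sum>r=-K..K. h r)"
      by (rule sum_int_shift[symmetric]) (use Suc.prems in \<open>auto simp: h_def gauss_binomial_eq_0\<close>)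
    also have "\<dots> = - (fps_X ^ (M - s) * (fps_X ^ M) ^ m) * (\<Sum>r=-K..K. theta_term M s r * ?g r)"
      unfolding h by (simp only: sum_distrib_left)
    finally show ?case using Suc by (simp add: qpoch_partial_def algebra_simps)
  qed
next
  case (Suc m')
  let ?g = "\<lambda>r. gauss_binomial (fps_X ^ M) (m + m') (int m + r)"
  define h where "h r = theta_term M s r * (fps_X ^ M) ^ nat (int m' + 1 - r) * ?g (r - 1)" for r
  have h: "h (r + 1) = - (fps_X ^ s * (fps_X ^ M) ^ m') * (theta_term M s r * ?g r)" for r
  proof (cases "r \<le> int m'")
    case True
    have "theta_term M s (r + 1) * fps_X ^ (M * nat (int m' - r)) = - (theta_term M s r * fps_X ^ (s + M * m'))"
      using assms(1) True by (intro theta_term_shift) (auto simp: algebra_simps)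
    then show ?thesis by (simp add: h_def power_add power_mult mult_ac)
  qed (simp add: h_def gauss_binomial_eq_0)
  have "(\<Sum>r=-K..K. theta_term M s r * gauss_binomial (fps_X ^ M) (m + Suc m') (int m + r))
    = (\<Sum>r=-K..K. theta_term M s r * ?g r) + (\<Sum>r=-K..K. h r)"
    by (simp add: h_def gauss_binomial_Suc' algebra_simps del: gauss_binomial.simps flip: sum.distrib)
  also have "(\<Sum>r=-K..K. h r) = (\<Sum>r=-K..K. h (r + 1))"
    by (rule sum_int_shift) (use Suc.prems in \<open>auto simp: h_def gauss_binomial_eq_0\<close>)
  also have "\<dots> = - (fps_X ^ s * (fps_X ^ M) ^ m') * (\<Sum>r=-K..K. theta_term M s r * ?g r)"
    unfolding h by (simp only: sum_distrib_left)
  finally show ?case using Suc by (simp add: qpoch_partial_def algebra_simps)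
qed

lemma agree_upto_theta_term:
  assumes "0 < s" "s < M" "int N < \<bar>r\<bar>"
  shows "agree_upto N (theta_term M s r * f) 0"
proof -
  have "1 * \<bar>r\<bar> \<le> min (int s) (int M - int s) * \<bar>r\<bar>" using assms by (intro mult_right_mono) auto
  also have "\<dots> \<le> theta_exponent M s r" using assms by (intro theta_exponent_ge) auto
  finally have "N < nat (theta_exponent M s r)" using assms by linarith
  from agree_upto_X_power[OF this] show ?thesis
    unfolding theta_term_def mult.assoc by (auto simp: agree_upto_def)
qed

lemma agree_upto_theta_sum:
  assumes "0 < s" "s < M" "{- int N..int N} \<subseteq> A" "finite A"
  shows "agree_upto N (\<Sum>r\<in>A. theta_term M s r * f r) (\<Sum>r=-int N..int N. theta_term M s r * f r)"
proof -
  have "agree_upto N (\<Sum>r\<in>A. theta_term M s r * f r)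
      (\<Sum>r\<in>A. if r \<in> {- int N..int N} then theta_term M s r * f r else 0)"
    by (rule agree_upto_sum) (use assms in \<open>auto intro!: agree_upto_theta_term\<close>)
  also have "(\<Sum>r\<in>A. if r \<in> {- int N..int N} then theta_term M s r * f r else 0)
      = (\<Sum>r=-int N..int N. theta_term M s r * f r)"
    using sum.inter_restrict[OF assms(4), of "\<lambda>r. theta_term M s r * f r" "{- int N..int N}"]
    by (simp only: Int_absorb1[OF assms(3)])
  finally show ?thesis .
qed

lemma jacobi_triple_product:
  assumes "0 < s" "s < M"
  shows "agree_upto N (\<Sum>r=-int N..int N. theta_term M s r)
     (qpoch (fps_X ^ M) (fps_X ^ M) * qpoch (fps_X ^ (M - s)) (fps_X ^ M) * qpoch (fps_X ^ s) (fps_X ^ M))"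
proof -
  \<comment> \<open>With m = 2 N the index m + r stays N away from 0 and 2 m for all |r| <= N; K
    only has to exceed 2 m.\<close>
  define m where "m = 2 * N"
  define K where "K = 4 * int N + 1"
  let ?Q = "qpoch (fps_X ^ M) (fps_X ^ M)" and ?g = "\<lambda>r. gauss_binomial (fps_X ^ M) (m + m) (int m + r)"
  have "agree_upto N (theta_term M s r * 1) (theta_term M s r * (?g r * ?Q))" if "r \<in> {- int N..int N}" for r
    using that assms by (intro agree_upto_mult agree_upto_sym[OF agree_upto_gauss_binomial]) (auto simp: m_def)
  then have "agree_upto N (\<Sum>r=-int N..int N. theta_term M s r) (\<Sum>r=-int N..int N. theta_term M s r * (?g r * ?Q))"
    by (intro agree_upto_sum) simp
  also have "agree_upto N \<dots> (\<Sum>r=-K..K. theta_term M s r * (?g r * ?Q))"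
    by (intro agree_upto_sym[OF agree_upto_theta_sum]) (use assms in \<open>auto simp: K_def\<close>)
  also have "\<dots> = ?Q * (\<Sum>r=-K..K. theta_term M s r * ?g r)"
    by (simp add: sum_distrib_left mult_ac)
  also have "(\<Sum>r=-K..K. theta_term M s r * ?g r) = qpoch_partial (M - s) M m * qpoch_partial s M m"
    using assms by (intro finite_jacobi_triple_product) (auto simp: m_def K_def)
  also have "agree_upto N (?Q * (qpoch_partial (M - s) M m * qpoch_partial s M m))
      (?Q * (qpoch (fps_X ^ (M - s)) (fps_X ^ M) * qpoch (fps_X ^ s) (fps_X ^ M)))"
    using assms by (intro agree_upto_mult agree_upto_sym[OF agree_upto_qpoch]) (auto simp: m_def)
  finally show ?thesis by (simp add: mult.assoc)
qed

section \<open>Nested lists of hooks\<close>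

text \<open>Frobenius coordinates of a partition, outermost hook first: arm p - i - 1 and leg i - a.
  The bounds on a + p say that arm minus leg lies between -2 i and 2 n - 2 i, a condition of
  prescribed hook differences.\<close>

definition good_list :: "nat \<Rightarrow> nat \<Rightarrow> (int \<times> int) list \<Rightarrow> bool" where
  "good_list n i hs \<longleftrightarrow> sorted_wrt (\<lambda>(a, p) (a', p'). a < a' \<and> p' < p) hs \<and>
     (\<forall>(a, p)\<in>set hs. a \<le> int i \<and> int i < p \<and> 1 \<le> a + p \<and> a + p \<le> 2 * int n + 1)"

definition hooks_size :: "(int \<times> int) list \<Rightarrow> nat" where
  "hooks_size hs = nat (\<Sum>(a, p)\<leftarrow>hs. p - a)"

text \<open>In Frobenius terms, the partition fits into a rectangle with sides x and y.\<close>

definition good_box :: "nat \<Rightarrow> nat \<Rightarrow> nat \<Rightarrow> nat \<Rightarrow> (int \<times> int) list set" where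
  "good_box n i x y = {hs. good_list n i hs \<and> (\<forall>(a, p)\<in>set hs. p \<le> int i + int x \<and> int i - int y < a)}"

lemma hooks_size_Nil [simp]: "hooks_size [] = 0"
  by (simp add: hooks_size_def)

lemma good_list_Nil [simp]: "good_list n i []"
  by (simp add: good_list_def)

lemma good_list_Cons:
  "good_list n i ((a, p) # hs) \<longleftrightarrow> good_list n i hs \<and> (\<forall>(a', p')\<in>set hs. a < a' \<and> p' < p) \<and>
     a \<le> int i \<and> int i < p \<and> 1 \<le> a + p \<and> a + p \<le> 2 * int n + 1"
  by (auto simp: good_list_def)

lemma good_list_sum_nonneg: "good_list n i hs \<Longrightarrow> 0 \<le> (\<Sum>(a, p)\<leftarrow>hs. p - a)"
  by (induction hs) (auto simp: good_list_Cons)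

lemma hooks_size_Cons:
  "good_list n i ((a, p) # hs) \<Longrightarrow> hooks_size ((a, p) # hs) = nat (p - a) + hooks_size hs"
  using good_list_sum_nonneg[of n i hs] by (auto simp: hooks_size_def good_list_Cons nat_add_distrib)

lemma hook_le_hooks_size:
  "good_list n i hs \<Longrightarrow> (a, p) \<in> set hs \<Longrightarrow> p \<le> int i + int (hooks_size hs) \<and> int i - int (hooks_size hs) < a"
proof (induction hs)
  case (Cons h hs)
  obtain a' p' where h: "h = (a', p')" by (cases h)
  have "hooks_size (h # hs) = nat (p' - a') + hooks_size hs"
    unfolding h by (rule hooks_size_Cons) (use Cons.prems h in simp)
  with Cons h show ?case by (auto simp: good_list_Cons)
qed simp

lemma good_list_distinct: "good_list n i hs \<Longrightarrow> distinct hs"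
  by (induction hs) (auto simp: good_list_Cons)

lemma finite_good_box: "finite (good_box n i x y)"
proof (rule finite_subset)
  let ?A = "{int i - int y..int i} \<times> {int i..int i + int x}"
  show "good_box n i x y \<subseteq> {hs. set hs \<subseteq> ?A \<and> distinct hs}"
    by (auto simp: good_box_def good_list_distinct) (auto simp: good_list_def)
  show "finite {hs. set hs \<subseteq> ?A \<and> distinct hs}" by (rule finite_subset_distinct) auto
qed

lemma good_box_0: "x = 0 \<or> y = 0 \<Longrightarrow> good_box n i x y = {[]}"
proof -
  assume xy: "x = 0 \<or> y = 0"
  have "hs = []" if "hs \<in> good_box n i x y" for hs
    using that xy by (cases hs) (auto simp: good_box_def good_list_def)
  then show ?thesis by (auto simp: good_box_def)
qed

text \<open>Only the outermost hook can touch the new boundary sites. It misses the largest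
  particle, or it misses the smallest hole, or it is the corner hook, which is admissible exactly
  inside the strip.\<close>

lemma good_box_Suc:
  "good_box n i (Suc x) (Suc y) = good_box n i x (Suc y) \<union> good_box n i (Suc x) y \<union>
     (if 0 \<le> 2 * int i + int x - int y \<and> 2 * int i + int x - int y \<le> 2 * int n
      then Cons (int i - int y, int i + int x + 1) ` good_box n i x y else {})" (is "?L = ?A \<union> ?B \<union> ?C")
proof
  show "?A \<union> ?B \<union> ?C \<subseteq> ?L"
  proof (intro Un_least)
    show "?A \<subseteq> ?L" "?B \<subseteq> ?L" by (auto simp: good_box_def)
    show "?C \<subseteq> ?L"
      by (force simp: good_box_def good_list_Cons split: if_splits)
  qed
  show "?L \<subseteq> ?A \<union> ?B \<union> ?C"
  proof
    fix hs assume hs: "hs \<in> ?L"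
    show "hs \<in> ?A \<union> ?B \<union> ?C"
    proof (cases hs)
      case Nil
      then show ?thesis by (simp add: good_box_def)
    next
      case (Cons ap hs')
      obtain a p where ap: "ap = (a, p)" by (cases ap)
      have g: "good_list n i hs'" "\<And>a' p'. (a', p') \<in> set hs' \<Longrightarrow> a < a' \<and> p' < p"
        "a \<le> int i" "int i < p" "1 \<le> a + p" "a + p \<le> 2 * int n + 1" "p \<le> int i + int x + 1" "int i - int y \<le> a"
        using hs Cons ap by (auto simp: good_box_def good_list_Cons)
      consider "p \<le> int i + int x" | "int i - int y < a" | "p = int i + int x + 1" "a = int i - int y"
        using g by linarith
      then show ?thesis
      proof cases
        case 1
        then have "\<forall>(a', p')\<in>set hs. p' \<le> int i + int x" using g(2) by (force simp: Cons ap)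
        then have "hs \<in> ?A" using hs by (auto simp: good_box_def)
        then show ?thesis by blast
      next
        case 2
        then have "\<forall>(a', p')\<in>set hs. int i - int y < a'" using g(2) by (force simp: Cons ap)
        then have "hs \<in> ?B" using hs by (auto simp: good_box_def)
        then show ?thesis by blast
      next
        case 3
        then have "hs' \<in> good_box n i x y" using g(1) g(2) by (force simp: good_box_def)
        then have "hs \<in> ?C" using 3 g by (auto simp: Cons ap)
        then show ?thesis by blast
      qed
    qed
  qed
qed

lemma good_box_Int: "good_box n i x (Suc y) \<inter> good_box n i (Suc x) y = good_box n i x y"
  by (auto simp: good_box_def)

definition box_gf :: "nat \<Rightarrow> nat \<Rightarrow> nat \<Rightarrow> nat \<Rightarrow> complex fps" where
  "box_gf n i x y = (\<Sum>hs\<in>good_box n i x y. fps_X ^ hooks_size hs)"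

lemma box_gf_0: "x = 0 \<or> y = 0 \<Longrightarrow> box_gf n i x y = 1"
  by (simp add: box_gf_def good_box_0)

text \<open>Inclusion-exclusion for the two overlapping cases; the corner hook has length x + y +
  1.\<close>

lemma box_gf_Suc:
  "box_gf n i (Suc x) (Suc y) = box_gf n i x (Suc y) + box_gf n i (Suc x) y - box_gf n i x y +
     (if 0 \<le> 2 * int i + int x - int y \<and> 2 * int i + int x - int y \<le> 2 * int n
      then fps_X ^ Suc (x + y) * box_gf n i x y else 0)"
proof -
  let ?A = "good_box n i x (Suc y)" and ?B = "good_box n i (Suc x) y"
  let ?h = "(int i - int y, int i + int x + 1)"
  let ?c = "0 \<le> 2 * int i + int x - int y \<and> 2 * int i + int x - int y \<le> 2 * int n"
  let ?C = "if ?c then Cons ?h ` good_box n i x y else {}"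
  let ?w = "\<lambda>hs. fps_X ^ hooks_size hs :: complex fps"
  have disj: "(?A \<union> ?B) \<inter> ?C = {}" by (auto simp: good_box_def)
  have "box_gf n i (Suc x) (Suc y) = sum ?w (?A \<union> ?B) + sum ?w ?C"
    unfolding box_gf_def good_box_Suc using disj
    by (intro sum.union_disjoint) (auto simp: finite_good_box)
  also have "sum ?w (?A \<union> ?B) = box_gf n i x (Suc y) + box_gf n i (Suc x) y - box_gf n i x y"
    unfolding box_gf_def by (subst sum_Un) (simp_all add: finite_good_box good_box_Int)
  also have "sum ?w ?C = (if ?c then fps_X ^ Suc (x + y) * box_gf n i x y else 0)"
  proof (cases ?c)
    case True
    have size: "hooks_size (?h # hs) = Suc (x + y) + hooks_size hs" if "hs \<in> good_box n i x y" for hs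
    proof -
      have "good_list n i (?h # hs)" using that True by (auto simp: good_box_def good_list_Cons)
      from hooks_size_Cons[OF this] show ?thesis by (simp add: nat_add_distrib)
    qed
    have "sum ?w (Cons ?h ` good_box n i x y) = (\<Sum>hs\<in>good_box n i x y. ?w (?h # hs))"
      by (subst sum.reindex) auto
    also have "\<dots> = fps_X ^ Suc (x + y) * box_gf n i x y"
      unfolding box_gf_def sum_distrib_left by (intro sum.cong) (auto simp: size power_add)
    finally show ?thesis using True by simp
  next
    case False
    then show ?thesis by (simp only: if_False sum.empty)
  qed
  finally show ?thesis .
qed

text \<open>Here a particle at i + x + 1 would have a sum a + p of at least 2 n + 2 with any hole of
  the box.\<close>

lemma good_box_upper_edge:
  "2 * int i + int x - int y \<ge> 2 * int n \<Longrightarrow> good_box n i (Suc x) y = good_box n i x y"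
  unfolding good_box_def good_list_def by (intro Collect_cong conj_cong HOL.refl ball_cong) auto

text \<open>Here a hole at i - y would have a sum a + p of at most 0 with any particle of the
  box.\<close>

lemma good_box_lower_edge:
  "2 * int i + int x - int y \<le> 0 \<Longrightarrow> good_box n i x (Suc y) = good_box n i x y"
  unfolding good_box_def good_list_def by (intro Collect_cong conj_cong HOL.refl ball_cong) auto

text \<open>The method of images: both edge conditions of the strip are met by adding to the binomial
  coefficient of the unrestricted problem its reflections with suitable weights.\<close>

definition image_sum :: "nat \<Rightarrow> nat \<Rightarrow> int \<Rightarrow> nat \<Rightarrow> nat \<Rightarrow> complex fps" where
  "image_sum M s K x y =
     (\<Sum>k=-K..K. theta_term M s (- 2 * k) * gauss_binomial fps_X (x + y) (int x - int M * k)) +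
     (\<Sum>k=-K..K. theta_term M s (1 - 2 * k) * gauss_binomial fps_X (x + y) (int x - int s + int M * k))"

text \<open>The coefficients of the four-term relation depend on x + y alone, so it passes to every
  combination of shifted binomials.\<close>

lemma image_sum_Suc:
  "image_sum M s K (Suc x) (Suc y) = image_sum M s K x (Suc y) + image_sum M s K (Suc x) y
     - (1 - fps_X ^ Suc (x + y)) * image_sum M s K x y"
proof -
  have g: "gauss_binomial fps_X (Suc x + Suc y) (int (Suc x) - c) =
      gauss_binomial fps_X (x + Suc y) (int x - c) + gauss_binomial fps_X (Suc x + y) (int (Suc x) - c)
      - (1 - fps_X ^ Suc (x + y)) * gauss_binomial fps_X (x + y) (int x - c)" for c
    using gauss_binomial_four_term[of fps_X "x + y" "int (Suc x) - c"]
    by (simp add: algebra_simps del: gauss_binomial.simps)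
  have alg: "t * (a + b - C * d) = t * a + t * b - C * (t * d)" for t a b C d :: "complex fps"
    by (simp add: algebra_simps)
  have S: "(\<Sum>k=-K..K. t k * gauss_binomial fps_X (Suc x + Suc y) (int (Suc x) - c k)) =
      (\<Sum>k=-K..K. t k * gauss_binomial fps_X (x + Suc y) (int x - c k)) +
      (\<Sum>k=-K..K. t k * gauss_binomial fps_X (Suc x + y) (int (Suc x) - c k)) -
      (1 - fps_X ^ Suc (x + y)) * (\<Sum>k=-K..K. t k * gauss_binomial fps_X (x + y) (int x - c k))"
    for t :: "int \<Rightarrow> complex fps" and c
    unfolding g sum_distrib_left sum.distrib[symmetric] sum_subtractf[symmetric]
    by (rule sum.cong[OF HOL.refl alg])
  have c: "int x - int s + int M * k = int x - (int s - int M * k)" for x k by simp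
  show ?thesis
    unfolding image_sum_def c S by (simp only: distrib_left right_diff_distrib add_diff_eq diff_add_eq add_ac diff_diff_eq2 diff_diff_eq)
qed

text \<open>Growing x adds one Pascal term to every image. On this edge the extra terms of translate
  k and of reflection k carry equal binomials by symmetry, with theta terms that cancel.\<close>

lemma image_sum_upper_edge:
  assumes "s \<le> M" "int x + 2 = int y + int s"
  shows "image_sum M s K (Suc x) y = image_sum M s K x y"
proof -
  let ?g = "\<lambda>k. fps_X ^ nat k * gauss_binomial fps_X (x + y) k"
  have "theta_term M s (- 2 * k) * ?g (int x + 1 - int M * k)
      + theta_term M s (1 - 2 * k) * ?g (int x + 1 - int s + int M * k) = 0" for k
  proof -
    have sym: "gauss_binomial fps_X (x + y) (int x + 1 - int s + int M * k) = gauss_binomial fps_X (x + y) (int x + 1 - int M * k)"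
    proof -
      have "int (x + y) - (int x + 1 - int M * k) = int x + 1 - int s + int M * k" using assms by simp
      then show ?thesis by (metis gauss_binomial_sym)
    qed
    show ?thesis
    proof (cases "int x + 1 - int M * k < 0 \<or> int (x + y) < int x + 1 - int M * k")
      case True
      then show ?thesis using sym gauss_binomial_eq_0 by simp
    next
      case False
      then have "theta_term M s (- 2 * k + 1) * fps_X ^ nat (int x + 1 - int s + int M * k)
          = - (theta_term M s (- 2 * k) * fps_X ^ nat (int x + 1 - int M * k))"
        using assms by (intro theta_term_shift) (auto simp: algebra_simps)
      then have "theta_term M s (1 - 2 * k) * fps_X ^ nat (int x + 1 - int s + int M * k)
          = - (theta_term M s (- 2 * k) * fps_X ^ nat (int x + 1 - int M * k))"
        by (simp add: add.commute)
      then show ?thesis unfolding sym by (simp flip: mult.assoc)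
    qed
  qed
  then have "(\<Sum>k=-K..K. theta_term M s (- 2 * k) * ?g (int x + 1 - int M * k))
      + (\<Sum>k=-K..K. theta_term M s (1 - 2 * k) * ?g (int x + 1 - int s + int M * k)) = 0"
    by (simp flip: sum.distrib)
  moreover have g1: "gauss_binomial fps_X (Suc x + y) (int (Suc x) - int M * k)
      = gauss_binomial fps_X (x + y) (int x - int M * k) + ?g (int x + 1 - int M * k)" for k
    by (simp add: algebra_simps)
  have g2: "gauss_binomial fps_X (Suc x + y) (int (Suc x) - int s + int M * k)
      = gauss_binomial fps_X (x + y) (int x - int s + int M * k) + ?g (int x + 1 - int s + int M * k)" for k
    by (simp add: algebra_simps)
  have "image_sum M s K (Suc x) y = image_sum M s K x y +
      ((\<Sum>k=-K..K. theta_term M s (- 2 * k) * ?g (int x + 1 - int M * k))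
      + (\<Sum>k=-K..K. theta_term M s (1 - 2 * k) * ?g (int x + 1 - int s + int M * k)))"
    unfolding image_sum_def g1 g2 by (simp only: distrib_left sum.distrib add_ac)
  ultimately show ?thesis by simp
qed

text \<open>As on the upper edge, but translate k now cancels against reflection k + 1. The second
  sum is therefore shifted, and its boundary terms have to lie outside the support of the
  binomials.\<close>

lemma image_sum_lower_edge:
  assumes "s < M" "1 < M" "int y + 2 + int s = int x + int M" "int x + int y < K"
  shows "image_sum M s K x (Suc y) = image_sum M s K x y"
proof -
  let ?g = "\<lambda>k. fps_X ^ nat (int (x + y) + 1 - k) * gauss_binomial fps_X (x + y) (k - 1)"
  define h where "h k = theta_term M s (1 - 2 * k) * ?g (int x - int s + int M * k)" for k
  have eq: "theta_term M s (- 2 * k) * ?g (int x - int M * k) + h (k + 1) = 0" for k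
  proof -
    have sym: "gauss_binomial fps_X (x + y) (int x - int s + int M * (k + 1) - 1) = gauss_binomial fps_X (x + y) (int x - int M * k - 1)"
    proof -
      have "int (x + y) - (int x - int M * k - 1) = int x - int s + int M * (k + 1) - 1"
        using assms by (simp add: algebra_simps)
      then show ?thesis by (metis gauss_binomial_sym)
    qed
    show ?thesis
    proof (cases "int x - int M * k - 1 < 0 \<or> int (x + y) < int x - int M * k - 1")
      case True
      then have "gauss_binomial fps_X (x + y) (int x - int M * k - 1) = (0 :: complex fps)" by (rule gauss_binomial_eq_0)
      then show ?thesis using sym by (simp add: h_def)
    next
      case False
      then have "theta_term M s (- 2 * k - 1 + 1) * fps_X ^ nat (int (x + y) + 1 - (int x - int M * k))
          = - (theta_term M s (- 2 * k - 1) * fps_X ^ nat (int (x + y) + 1 - (int x - int s + int M * (k + 1))))"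
        using assms by (intro theta_term_shift) (auto simp: algebra_simps)
      moreover have "- 2 * k - 1 = 1 - 2 * (k + 1)" "- 2 * k - 1 + 1 = - 2 * k" by simp_all
      ultimately have t: "theta_term M s (- 2 * k) * fps_X ^ nat (int (x + y) + 1 - (int x - int M * k))
          = - (theta_term M s (1 - 2 * (k + 1)) * fps_X ^ nat (int (x + y) + 1 - (int x - int s + int M * (k + 1))))"
        by (simp only:)
      show ?thesis unfolding h_def sym by (simp only: mult.assoc[symmetric] t) simp
    qed
  qed
  \<comment> \<open>Naming the product keeps the remaining bounds linear.\<close>
  define z where "z = int M * K"
  have "0 < K" using assms by linarith
  then have z: "K < z" using assms by (simp add: z_def mult_less_cancel_right1)
  have M: "int M * (- K) = - z" "int M * (K + 1) = z + int M" by (simp_all add: z_def distrib_left)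
  have "int x - int s + int M * (- K) - 1 < 0" "int (x + y) < int x - int s + int M * (K + 1) - 1"
    unfolding M using z assms by simp_all
  then have "gauss_binomial fps_X (x + y) (int x - int s + int M * (- K) - 1) = (0 :: complex fps)"
    "gauss_binomial fps_X (x + y) (int x - int s + int M * (K + 1) - 1) = (0 :: complex fps)"
    using gauss_binomial_eq_0 by blast+
  then have "h (- K) = 0" "h (K + 1) = 0" by (simp_all add: h_def)
  then have "(\<Sum>k=-K..K. theta_term M s (- 2 * k) * ?g (int x - int M * k)) + (\<Sum>k=-K..K. h k) = 0"
    using eq by (subst sum_int_shift) (simp_all flip: sum.distrib)
  moreover have "gauss_binomial fps_X (x + Suc y) c = ?g c + gauss_binomial fps_X (x + y) c" for c
    by (simp add: gauss_binomial_Suc' del: gauss_binomial.simps)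
  then have "image_sum M s K x (Suc y) = image_sum M s K x y +
      ((\<Sum>k=-K..K. theta_term M s (- 2 * k) * ?g (int x - int M * k)) + (\<Sum>k=-K..K. h k))"
    unfolding image_sum_def h_def by (simp only: distrib_left sum.distrib add_ac)
  ultimately show ?thesis by simp
qed

text \<open>On the sides of the quadrant every image except the original one falls outside the
  support of the binomial.\<close>

lemma image_sum_0:
  assumes "0 < s" "s < M" "0 \<le> K" "x = 0 \<and> int y + int s + 1 \<le> int M \<or> y = 0 \<and> int x + 1 \<le> int s"
  shows "image_sum M s K x y = 1"
proof -
  have z: "(if k = 0 then 1 else 0) = gauss_binomial fps_X (x + y) (int x - int M * k)"
    "gauss_binomial fps_X (x + y) (int x - int s + int M * k) = 0" for k
  proof -
    have "k = 0 \<or> 1 \<le> k \<or> k \<le> - 1" by linarith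
    moreover have "int M * 1 \<le> int M * k" if "1 \<le> k" using that by (intro mult_left_mono) auto
    moreover have "int M * k \<le> int M * (- 1)" if "k \<le> - 1" using that by (intro mult_left_mono) auto
    ultimately have k: "k = 0 \<or> k \<noteq> 0 \<and> int M \<le> int M * k \<or> k \<noteq> 0 \<and> int M * k \<le> - int M" by auto
    have "k \<noteq> 0 \<Longrightarrow> int x - int M * k < 0 \<or> int (x + y) < int x - int M * k"
      using k assms by linarith
    then show "(if k = 0 then 1 else 0) = (gauss_binomial fps_X (x + y) (int x - int M * k) :: complex fps)"
      using assms gauss_binomial_eq_0[of "int x - int M * k" "x + y" fps_X]
      by (auto simp: gauss_binomial_0_right gauss_binomial_self)
    have "int x - int s + int M * k < 0 \<or> int (x + y) < int x - int s + int M * k"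
    proof -
      have "int M * k = 0 \<or> int M \<le> int M * k \<or> int M * k \<le> - int M" using k by auto
      then show ?thesis using assms by linarith
    qed
    then show "gauss_binomial fps_X (x + y) (int x - int s + int M * k) = (0 :: complex fps)"
      by (rule gauss_binomial_eq_0)
  qed
  show ?thesis
    unfolding image_sum_def z(2) z(1)[symmetric] using assms(3)
    by (simp add: if_distrib[of "(*) _"] theta_term_def theta_exponent_def cong: if_cong)
qed

text \<open>The mirrors are the lines x - y = s and y - x = M - s. They lie one step beyond the
  edges x - y = 2 n - 2 i + 1 and y - x = 2 i + 1 of the region of validity, which fixes s = 2 n - 2
  i + 2 and M = 2 n + 4. The region reaches one step outside the strip so that the recursion inside
  the strip never leaves it.\<close>

lemma box_gf_eq_image_sum:
  assumes "i \<le> n" "int x + int y < K" "int x - int y \<le> 2 * int n - 2 * int i + 1" "int y - int x \<le> 2 * int i + 1"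
  shows "box_gf n i x y = image_sum (2 * n + 4) (2 * n - 2 * i + 2) K x y"
  using assms(2-)
proof (induction "x + y" arbitrary: x y rule: less_induct)
  case less
  let ?M = "2 * n + 4" and ?s = "2 * n - 2 * i + 2"
  have s: "int ?s = 2 * int n - 2 * int i + 2" using assms(1) by simp
  have s': "0 < ?s" "?s < ?M" using assms(1) by auto
  show ?case
  proof (cases "x = 0 \<or> y = 0")
    case True
    then show ?thesis
      using less.prems s s' by (subst box_gf_0, simp) (rule image_sum_0[symmetric], auto)
  next
    case False
    then obtain x' y' where xy: "x = Suc x'" "y = Suc y'" by (cases x; cases y) auto
    consider (up) "int x - int y = 2 * int n - 2 * int i + 1" | (low) "int y - int x = 2 * int i + 1"
      | (strip) "int x - int y \<le> 2 * int n - 2 * int i" "int y - int x \<le> 2 * int i"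
      using less.prems by linarith
    then show ?thesis
    proof cases
      case up
      have "box_gf n i x y = box_gf n i x' y"
        using up xy by (simp add: box_gf_def good_box_upper_edge)
      also have "\<dots> = image_sum ?M ?s K x' y" using less.prems up xy by (intro less.hyps) auto
      also have "\<dots> = image_sum ?M ?s K x y"
        unfolding xy(1) using up xy s by (intro image_sum_upper_edge[symmetric]) auto
      finally show ?thesis .
    next
      case low
      have "box_gf n i x y = box_gf n i x y'"
        using low xy by (simp add: box_gf_def good_box_lower_edge)
      also have "\<dots> = image_sum ?M ?s K x y'" using less.prems low xy by (intro less.hyps) auto
      also have "\<dots> = image_sum ?M ?s K x y"
        unfolding xy(2) using low xy s s' less.prems by (intro image_sum_lower_edge[symmetric]) auto
      finally show ?thesis .
    next
      case strip
      have "box_gf n i x' y = image_sum ?M ?s K x' y"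
        using less.prems strip xy by (intro less.hyps) auto
      moreover have "box_gf n i x y' = image_sum ?M ?s K x y'"
        using less.prems strip xy by (intro less.hyps) auto
      moreover have "box_gf n i x' y' = image_sum ?M ?s K x' y'"
        using less.prems strip xy by (intro less.hyps) auto
      ultimately show ?thesis
        unfolding xy image_sum_Suc box_gf_Suc using strip xy by (simp add: left_diff_distrib)
    qed
  qed
qed

section \<open>Passage to the limit of large boxes\<close>

lemma fps_nth_box_gf:
  assumes "N \<le> x" "N \<le> y"
  shows "fps_nth (box_gf n i x y) N = of_nat (card {hs. good_list n i hs \<and> hooks_size hs = N})"
proof -
  have "{hs. good_list n i hs \<and> hooks_size hs = N} = {hs\<in>good_box n i x y. hooks_size hs = N}"
    using hook_le_hooks_size[of n i] assms by (force simp: good_box_def)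
  then show ?thesis
    using finite_good_box[of n i x y]
    by (simp add: box_gf_def fps_sum_nth sum.inter_filter[symmetric] if_distrib eq_commute[of N] cong: if_cong)
qed

text \<open>Translations carry the even terms and reflections the odd terms of a single theta
  series.\<close>

lemma theta_sum_even_odd:
  "(\<Sum>k=-K..K. theta_term M s (- 2 * k)) + (\<Sum>k=-K..K. theta_term M s (1 - 2 * k))
   = (\<Sum>r=-2*K..2*K+1. theta_term M s r)"
proof -
  let ?e = "\<lambda>k::int. - 2 * k" and ?o = "\<lambda>k::int. 1 - 2 * k"
  have un: "{-2*K..2*K+1} = ?e ` {-K..K} \<union> ?o ` {-K..K}"
  proof (intro equalityI subsetI)
    fix r assume r: "r \<in> {-2*K..2*K+1}"
    show "r \<in> ?e ` {-K..K} \<union> ?o ` {-K..K}"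
    proof (cases "even r")
      case True
      then obtain k where "r = 2 * k" by auto
      with r have "r = ?e (- k)" "- k \<in> {-K..K}" by auto
      then show ?thesis by blast
    next
      case False
      then obtain k where "r = 2 * k + 1" by (elim oddE)
      with r have "r = ?o (- k)" "- k \<in> {-K..K}" by auto
      then show ?thesis by blast
    qed
  qed auto
  have "?e ` {-K..K} \<inter> ?o ` {-K..K} = {}"
  proof -
    have "?e k \<noteq> ?o l" for k l by presburger
    then show ?thesis by blast
  qed
  then show ?thesis
    unfolding un by (subst sum.union_disjoint) (auto simp: sum.reindex inj_on_def)
qed

theorem good_list_gf:
  assumes "i \<le> n"
  shows "Abs_fps (\<lambda>N. of_nat (card {hs. good_list n i hs \<and> hooks_size hs = N})) =
     qpoch (fps_X ^ (2 * n + 4)) (fps_X ^ (2 * n + 4)) * qpoch (fps_X ^ (2 * i + 2)) (fps_X ^ (2 * n + 4))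
     * qpoch (fps_X ^ (2 * n - 2 * i + 2)) (fps_X ^ (2 * n + 4)) / qpoch fps_X fps_X"
proof -
  let ?M = "2 * n + 4" and ?s = "2 * n - 2 * i + 2"
  define P where "P = Abs_fps (\<lambda>N. of_nat (card {hs. good_list n i hs \<and> hooks_size hs = N}) :: complex)"
  let ?E = "qpoch fps_X fps_X"
  let ?R = "qpoch (fps_X ^ ?M) (fps_X ^ ?M) * qpoch (fps_X ^ (2 * i + 2)) (fps_X ^ ?M)
     * qpoch (fps_X ^ ?s) (fps_X ^ ?M)"
  have s: "0 < ?s" "?s < ?M" "?M - ?s = 2 * i + 2" using assms by auto
  have "agree_upto N (P * ?E) ?R" for N
  proof -
    \<comment> \<open>Large enough that for |k| <= N + 1 all image positions keep distance N from
      both ends of 0..2x.\<close>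
    define x where "x = N + ?M * (N + 1) + ?M"
    define K where "K = 2 * int x + 1"
    \<comment> \<open>For |r| > N the theta term alone vanishes to the required order, so the
      position c is constrained only for small r.\<close>
    have gE: "agree_upto N (theta_term ?M ?s r * (gauss_binomial fps_X (x + x) c * ?E)) (theta_term ?M ?s r * 1)"
      if "\<bar>r\<bar> \<le> int N \<Longrightarrow> int N \<le> c \<and> c \<le> int (x + x) - int N" for r c
    proof (cases "\<bar>r\<bar> \<le> int N")
      case True
      then show ?thesis
        using agree_upto_gauss_binomial[of 1 N c "x + x"] that by (intro agree_upto_mult) auto
    next
      case False
      then show ?thesis
        by (intro agree_upto_trans[OF agree_upto_theta_term agree_upto_sym[OF agree_upto_theta_term]])
          (use s in auto)
    qed
    have b: "int ?M * k \<le> int ?M * (int N + 1)" "- (int ?M * (int N + 1)) \<le> int ?M * k"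
      if "\<bar>k\<bar> \<le> int N + 1" for k
    proof -
      show "int ?M * k \<le> int ?M * (int N + 1)" using that by (intro mult_left_mono) auto
      have "int ?M * (- k) \<le> int ?M * (int N + 1)" using that by (intro mult_left_mono) auto
      then show "- (int ?M * (int N + 1)) \<le> int ?M * k" by simp
    qed
    have x: "int x = int N + int ?M * (int N + 1) + int ?M" by (simp add: x_def algebra_simps)
    have "agree_upto N P (box_gf n i x x)"
    proof -
      have "N \<le> x" by (simp add: x_def)
      then show ?thesis by (auto simp: agree_upto_def P_def fps_nth_box_gf)
    qed
    also have "box_gf n i x x = image_sum ?M ?s K x x"
      using assms by (intro box_gf_eq_image_sum) (auto simp: K_def)
    finally have "agree_upto N (P * ?E) (image_sum ?M ?s K x x * ?E)" by (intro agree_upto_mult) auto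
    also have "image_sum ?M ?s K x x * ?E =
       (\<Sum>k=-K..K. theta_term ?M ?s (- 2 * k) * (gauss_binomial fps_X (x + x) (int x - int ?M * k) * ?E)) +
       (\<Sum>k=-K..K. theta_term ?M ?s (1 - 2 * k) * (gauss_binomial fps_X (x + x) (int x - int ?s + int ?M * k) * ?E))"
      by (simp add: image_sum_def sum_distrib_left sum_distrib_right distrib_right mult.assoc)
    also have "agree_upto N \<dots> ((\<Sum>k=-K..K. theta_term ?M ?s (- 2 * k) * 1) + (\<Sum>k=-K..K. theta_term ?M ?s (1 - 2 * k) * 1))"
    proof -
      have "int N \<le> int x - int ?M * k \<and> int x - int ?M * k \<le> int (x + x) - int N"
        if "\<bar>- 2 * k\<bar> \<le> int N" for k
      proof -
        have k: "\<bar>k\<bar> \<le> int N + 1" using that by linarith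
        show ?thesis using b[OF k] x by linarith
      qed
      moreover have "int N \<le> int x - int ?s + int ?M * k \<and> int x - int ?s + int ?M * k \<le> int (x + x) - int N"
        if "\<bar>1 - 2 * k\<bar> \<le> int N" for k
      proof -
        have k: "\<bar>k\<bar> \<le> int N + 1" using that by linarith
        show ?thesis using b[OF k] x s by linarith
      qed
      ultimately show ?thesis by (intro agree_upto_add agree_upto_sum gE) auto
    qed
    also have "\<dots> = (\<Sum>r=-2*K..2*K+1. theta_term ?M ?s r * 1)"
      using theta_sum_even_odd[of ?M ?s K] by simp
    also have "agree_upto N \<dots> (\<Sum>r=-int N..int N. theta_term ?M ?s r * 1)"
    proof (intro agree_upto_theta_sum)
      have "int N \<le> K" by (simp add: K_def x_def)
      then show "{- int N..int N} \<subseteq> {-2*K..2*K+1}" by auto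
    qed (use s in auto)
    also have "\<dots> = (\<Sum>r=-int N..int N. theta_term ?M ?s r)" by simp
    also have "agree_upto N \<dots> ?R" using jacobi_triple_product[OF s(1,2), of N] unfolding s(3) .
    finally show ?thesis .
  qed
  then have "P * ?E = ?R" unfolding agree_upto_def fps_eq_iff by blast
  moreover have "fps_nth ?E 0 \<noteq> 0" using qpoch_nth_0[of 1 1] by simp
  then have "?E \<noteq> 0" by auto
  ultimately show ?thesis unfolding P_def[symmetric] using nonzero_mult_div_cancel_right[of ?E P] by simp
qed

declare plus_fun_apply [simp del] zero_fun_apply [simp del] minus_apply [simp del]
  uminus_apply [simp del]

section \<open>Fermionic Fock space\<close>

type_synonym fock = "int set \<Rightarrow> complex"

text \<open>Everything up to -M is occupied and everything above M is empty. This turns the formally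
  infinite sums over sites into sums over a fixed interval.\<close>

definition window :: "int \<Rightarrow> int set \<Rightarrow> bool" where
  "window M S \<longleftrightarrow> (\<forall>a. a \<notin> S \<longrightarrow> - M < a) \<and> (\<forall>a\<in>S. a \<le> M)"

definition maya :: "int set \<Rightarrow> bool" where
  "maya S \<longleftrightarrow> (\<exists>M. window M S)"

text \<open>The particles above a are counted, since a Maya set contains all sites far
  below.\<close>

definition fermion_sign :: "int set \<Rightarrow> int \<Rightarrow> complex" where
  "fermion_sign S a = (- 1) ^ card {b \<in> S. a < b}"

text \<open>Vectors are coefficient functions, so creation reads off the coefficient of the state
  without the particle. Outside Maya sets, where the sign has no meaning, the value is 0.\<close>

definition cre :: "int \<Rightarrow> fock \<Rightarrow> fock" where
  "cre a x = (\<lambda>S. if maya S \<and> a \<in> S then fermion_sign S a * x (S - {a}) else 0)"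

definition ann :: "int \<Rightarrow> fock \<Rightarrow> fock" where
  "ann a x = (\<lambda>S. if maya S \<and> a \<notin> S then fermion_sign S a * x (insert a S) else 0)"

definition fscale :: "complex \<Rightarrow> fock \<Rightarrow> fock" where
  "fscale c x = (\<lambda>S. c * x S)"

interpretation fock: vector_space fscale
  by unfold_locales (auto simp: fscale_def fun_simps algebra_simps)

definition supp_maya :: "fock \<Rightarrow> bool" where
  "supp_maya x \<longleftrightarrow> (\<forall>S. x S \<noteq> 0 \<longrightarrow> maya S)"

lemma window_notin: "window M S \<Longrightarrow> a \<notin> S \<Longrightarrow> - M < a"
  and window_in: "window M S \<Longrightarrow> a \<in> S \<Longrightarrow> a \<le> M"
  by (auto simp: window_def)

lemma window_insert: "window M S \<Longrightarrow> \<bar>a\<bar> \<le> M' \<Longrightarrow> M \<le> M' \<Longrightarrow> window M' (insert a S)"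
  by (fastforce simp: window_def)

lemma window_remove: "window M S \<Longrightarrow> \<bar>a\<bar> < M' \<Longrightarrow> M \<le> M' \<Longrightarrow> window M' (S - {a})"
  by (fastforce simp: window_def)

lemma maya_insert [simp]: "maya (insert a S) \<longleftrightarrow> maya S"
proof
  assume "maya S"
  then obtain M where "window M S" by (auto simp: maya_def)
  then have "window (max M \<bar>a\<bar>) (insert a S)" by (rule window_insert) auto
  then show "maya (insert a S)" by (auto simp: maya_def)
next
  assume "maya (insert a S)"
  then obtain M where M: "window M (insert a S)" by (auto simp: maya_def)
  have "window (max M (\<bar>a\<bar> + 1)) S"
    unfolding window_def
  proof (intro conjI allI ballI impI)
    fix b
    show "- max M (\<bar>a\<bar> + 1) < b" if "b \<notin> S" using window_notin[OF M, of b] that by (cases "b = a") auto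
    show "b \<le> max M (\<bar>a\<bar> + 1)" if "b \<in> S" using window_in[OF M, of b] that by auto
  qed
  then show "maya S" by (auto simp: maya_def)
qed

lemma maya_remove [simp]: "maya (S - {a}) \<longleftrightarrow> maya S"
  by (metis maya_insert insert_Diff_single)

lemma maya_finite_above: "maya S \<Longrightarrow> finite {b \<in> S. a < b}"
proof -
  assume "maya S"
  then obtain M where "window M S" by (auto simp: maya_def)
  then have "{b \<in> S. a < b} \<subseteq> {a..M}" by (auto simp: window_def)
  then show ?thesis by (rule finite_subset) simp
qed

lemma fermion_sign_insert:
  assumes "maya S" "c \<notin> S"
  shows "fermion_sign (insert c S) a = (if a < c then - 1 else 1) * fermion_sign S a"
proof (cases "a < c")
  case True
  then have "{b \<in> insert c S. a < b} = insert c {b \<in> S. a < b}" by auto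
  then show ?thesis using assms True maya_finite_above[of S a] by (simp add: fermion_sign_def)
next
  case False
  then have "{b \<in> insert c S. a < b} = {b \<in> S. a < b}" by auto
  then show ?thesis using False by (simp add: fermion_sign_def)
qed

lemma fermion_sign_remove:
  assumes "maya S" "c \<in> S"
  shows "fermion_sign (S - {c}) a = (if a < c then - 1 else 1) * fermion_sign S a"
proof -
  have "fermion_sign S a = (if a < c then - 1 else 1) * fermion_sign (S - {c}) a"
    using fermion_sign_insert[of "S - {c}" c a] assms by (simp add: insert_absorb)
  then show ?thesis by auto
qed

lemma fermion_sign_square [simp]: "fermion_sign S a * fermion_sign S a = 1"
  by (simp add: fermion_sign_def flip: power_add mult_2)

lemma fermion_sign_neq_0 [simp]: "fermion_sign S a \<noteq> 0"
  by (simp add: fermion_sign_def)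

lemma cre_cre: "cre a (cre b x) = - cre b (cre a x)"
proof
  fix S
  have "a \<noteq> b \<Longrightarrow> S - {a} - {b} = S - {b} - {a}" by auto
  then show "cre a (cre b x) S = (- cre b (cre a x)) S"
    by (cases "a = b") (auto simp: cre_def fermion_sign_remove fun_simps)
qed

lemma ann_ann: "ann a (ann b x) = - ann b (ann a x)"
proof
  fix S show "ann a (ann b x) S = (- ann b (ann a x)) S"
    by (cases "a = b") (auto simp: ann_def fermion_sign_insert insert_commute fun_simps)
qed

text \<open>The canonical anticommutation relation. Both operators discard everything outside Maya
  sets, so x has to be supported there for the identity term.\<close>

lemma ann_cre:
  assumes "supp_maya x"
  shows "ann a (cre b x) = (if a = b then x else 0) - cre b (ann a x)"
proof
  fix S
  have "a \<noteq> b \<Longrightarrow> insert a S - {b} = insert a (S - {b})" by auto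
  then show "ann a (cre b x) S = ((if a = b then x else 0) - cre b (ann a x)) S"
    using assms
    by (cases "a = b"; cases "maya S"; cases "a \<in> S"; cases "b \<in> S")
       (auto simp: ann_def cre_def supp_maya_def fermion_sign_insert fermion_sign_remove insert_absorb fun_simps
             simp flip: mult.assoc)
qed

lemma supp_maya_cre [simp]: "supp_maya (cre a x)"
  by (auto simp: supp_maya_def cre_def)

lemma supp_maya_ann [simp]: "supp_maya (ann a x)"
  by (auto simp: supp_maya_def ann_def)

lemma cre_add: "cre a (x + y) = cre a x + cre a y"
  and cre_diff: "cre a (x - y) = cre a x - cre a y"
  and cre_minus: "cre a (- x) = - cre a x"
  and cre_0 [simp]: "cre a 0 = 0"
  by (auto simp: cre_def fun_simps algebra_simps)

text \<open>The products of one creation and one annihilation commute like matrix units.\<close>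

lemma cre_ann_commutator:
  assumes "supp_maya x"
  shows "cre p (ann a (cre q (ann b x))) - cre q (ann b (cre p (ann a x)))
    = (if a = q then cre p (ann b x) else 0) - (if b = p then cre q (ann a x) else 0)"
proof -
  have 1: "cre p (ann a (cre q (ann b x))) = (if a = q then cre p (ann b x) else 0) - cre p (cre q (ann a (ann b x)))" for p q a b
    by (simp add: ann_cre cre_diff)
  have "cre q (cre p (ann b (ann a x))) = cre p (cre q (ann a (ann b x)))"
    by (subst cre_cre, subst ann_ann) (simp add: cre_minus)
  then show ?thesis unfolding 1 by simp
qed

lemma cre_ann_apply:
  assumes "p \<noteq> a"
  shows "cre p (ann a x) S = (if maya S \<and> p \<in> S \<and> a \<notin> S
     then fermion_sign S p * fermion_sign (S - {p}) a * x (insert a (S - {p})) else 0)"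
  using assms by (auto simp: cre_def ann_def)

lemma cre_ann_same: "supp_maya x \<Longrightarrow> cre a (ann a x) S = (if a \<in> S then x S else 0)"
  by (auto simp: cre_def ann_def supp_maya_def fermion_sign_remove insert_absorb simp flip: mult.assoc)

section \<open>Hops and their commutators\<close>

definition hop :: "int \<Rightarrow> (int \<Rightarrow> complex) \<Rightarrow> fock \<Rightarrow> fock" where
  "hop l h x = (\<lambda>S. \<Sum>a | a \<notin> S \<and> a + l \<in> S. h a * cre (a + l) (ann a x) S)"

text \<open>With an index set independent of the state, compositions become finite double sums;
  \<open>hop\<close> agrees with this version on a window once the interval is wide enough.\<close>

definition hop_on :: "int set \<Rightarrow> int \<Rightarrow> (int \<Rightarrow> complex) \<Rightarrow> fock \<Rightarrow> fock" where
  "hop_on A l h x = (\<lambda>S. \<Sum>a\<in>A. h a * cre (a + l) (ann a x) S)"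

lemma window_hop:
  assumes "window M S" "a \<notin> S" "a + l \<in> S"
  shows "\<bar>a\<bar> \<le> M + \<bar>l\<bar>" "window (M + \<bar>l\<bar>) (insert a (S - {a + l}))"
proof -
  have "- M < a" "a + l \<le> M" using assms window_notin window_in by blast+
  then show "\<bar>a\<bar> \<le> M + \<bar>l\<bar>" by linarith
  show "window (M + \<bar>l\<bar>) (insert a (S - {a + l}))"
    unfolding window_def
  proof (intro conjI allI ballI impI)
    fix b
    show "- (M + \<bar>l\<bar>) < b" if "b \<notin> insert a (S - {a + l})"
      using window_notin[OF assms(1), of b] that \<open>- M < a\<close> by (cases "b = a + l") auto
    show "b \<le> M + \<bar>l\<bar>" if "b \<in> insert a (S - {a + l})"
      using window_in[OF assms(1), of b] that \<open>a + l \<le> M\<close> by (cases "b = a") auto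
  qed
qed

lemma finite_hop: "maya S \<Longrightarrow> finite {a. a \<notin> S \<and> a + l \<in> S}"
proof -
  assume "maya S"
  then obtain M where "window M S" by (auto simp: maya_def)
  then have "{a. a \<notin> S \<and> a + l \<in> S} \<subseteq> {- (M + \<bar>l\<bar>)..M + \<bar>l\<bar>}" using window_hop(1) by fastforce
  then show ?thesis by (rule finite_subset) simp
qed

text \<open>Displacement 0 is excluded because the index set of \<open>hop\<close> is then empty,
  whereas \<open>cre a (ann a x)\<close> is an occupation number.\<close>

lemma hop_eq_hop_on:
  assumes "window M S" "{- (M + \<bar>l\<bar>)..M + \<bar>l\<bar>} \<subseteq> A" "finite A" "l \<noteq> 0"
  shows "hop l h x S = hop_on A l h x S"
  unfolding hop_def hop_on_def
proof (rule sum.mono_neutral_left)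
  show "{a. a \<notin> S \<and> a + l \<in> S} \<subseteq> A" using window_hop(1)[OF assms(1)] assms(2) by fastforce
  show "\<forall>a\<in>A - {a. a \<notin> S \<and> a + l \<in> S}. h a * cre (a + l) (ann a x) S = 0"
    using assms(4) by (auto simp: cre_ann_apply)
qed (use assms in auto)

lemma hop_not_maya: "\<not> maya S \<Longrightarrow> hop l h x S = 0"
  by (auto simp: hop_def cre_def)

lemma hop_on_cong:
  assumes "window M S" "\<And>S'. window (M + \<bar>l\<bar>) S' \<Longrightarrow> x S' = y S'" "l \<noteq> 0"
  shows "hop_on A l h x S = hop_on A l h y S"
  unfolding hop_on_def
  using assms window_hop(2)[OF assms(1)] by (intro sum.cong) (auto simp: cre_ann_apply)

lemma cre_sum: "cre p (\<lambda>S. \<Sum>b\<in>B. c b * y b S) = (\<lambda>S. \<Sum>b\<in>B. c b * cre p (y b) S)"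
  and ann_sum: "ann p (\<lambda>S. \<Sum>b\<in>B. c b * y b S) = (\<lambda>S. \<Sum>b\<in>B. c b * ann p (y b) S)"
  by (auto simp: cre_def ann_def fun_simps sum_distrib_left mult_ac intro!: sum.cong)

text \<open>Each surviving term contracts the two hops at their intermediate site, which has to lie
  in A; hence the side conditions.\<close>

lemma hop_on_commutator:
  assumes "supp_maya x" "finite A"
  shows "hop_on A l g (hop_on A m h x) S - hop_on A m h (hop_on A l g x) S =
    (\<Sum>b\<in>{b\<in>A. b + m \<in> A}. g (b + m) * h b * cre (b + m + l) (ann b x) S) -
    (\<Sum>a\<in>{a\<in>A. a + l \<in> A}. g a * h (a + l) * cre (a + l + m) (ann a x) S)"
proof -
  let ?c = "\<lambda>p a q b. cre p (ann a (cre q (ann b x))) S"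
  have "hop_on A l g (hop_on A m h x) S = (\<Sum>a\<in>A. \<Sum>b\<in>A. g a * h b * ?c (a + l) a (b + m) b)"
    by (simp add: hop_on_def ann_sum cre_sum sum_distrib_left mult_ac)
  moreover have "hop_on A m h (hop_on A l g x) S = (\<Sum>a\<in>A. \<Sum>b\<in>A. g a * h b * ?c (b + m) b (a + l) a)"
    by (subst sum.swap) (simp add: hop_on_def ann_sum cre_sum sum_distrib_left mult_ac)
  ultimately have "hop_on A l g (hop_on A m h x) S - hop_on A m h (hop_on A l g x) S
     = (\<Sum>a\<in>A. \<Sum>b\<in>A. g a * h b * (?c (a + l) a (b + m) b - ?c (b + m) b (a + l) a))"
    by (simp add: sum_subtractf algebra_simps)
  also have "\<dots> = (\<Sum>a\<in>A. \<Sum>b\<in>A. g a * h b * ((if a = b + m then cre (a + l) (ann b x) S else 0) -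
       (if b = a + l then cre (b + m) (ann a x) S else 0)))"
  proof (intro sum.cong HOL.refl)
    fix a b
    have "?c (a + l) a (b + m) b - ?c (b + m) b (a + l) a
      = (if a = b + m then cre (a + l) (ann b x) S else 0) - (if b = a + l then cre (b + m) (ann a x) S else 0)"
      using fun_cong[OF cre_ann_commutator[OF assms(1), of "a + l" a "b + m" b], of S]
      by (auto simp: fun_simps split: if_splits)
    then show "g a * h b * (?c (a + l) a (b + m) b - ?c (b + m) b (a + l) a) =
      g a * h b * ((if a = b + m then cre (a + l) (ann b x) S else 0) - (if b = a + l then cre (b + m) (ann a x) S else 0))"
      by simp
  qed
  also have "\<dots> = (\<Sum>b\<in>A. \<Sum>a\<in>A. if a = b + m then g a * h b * cre (a + l) (ann b x) S else 0) -
      (\<Sum>a\<in>A. \<Sum>b\<in>A. if b = a + l then g a * h b * cre (b + m) (ann a x) S else 0)"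
  proof -
    have alg: "c * ((if P then u else 0) - (if Q then v else 0)) = (if P then c * u else 0) - (if Q then c * v else 0)"
      for c u v :: complex and P Q by (auto simp: right_diff_distrib)
    have "(\<Sum>a\<in>A. \<Sum>b\<in>A. g a * h b * ((if a = b + m then cre (a + l) (ann b x) S else 0) -
         (if b = a + l then cre (b + m) (ann a x) S else 0)))
      = (\<Sum>a\<in>A. \<Sum>b\<in>A. (if a = b + m then g a * h b * cre (a + l) (ann b x) S else 0) -
         (if b = a + l then g a * h b * cre (b + m) (ann a x) S else 0))"
      by (intro sum.cong HOL.refl alg)
    then show ?thesis
      by (simp only: sum_subtractf sum.swap[of "\<lambda>a b. if a = b + m then g a * h b * cre (a + l) (ann b x) S else 0" A A])
  qed
  also have "\<dots> = (\<Sum>b\<in>A. if b + m \<in> A then g (b + m) * h b * cre (b + m + l) (ann b x) S else 0) -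
      (\<Sum>a\<in>A. if a + l \<in> A then g a * h (a + l) * cre (a + l + m) (ann a x) S else 0)"
    using assms(2) by (simp add: sum.delta' sum.delta)
  finally show ?thesis using assms(2) by (simp add: sum.inter_filter)
qed

text \<open>The truncated sums are kept because for l + m = 0 each of them may grow without bound
  with the interval; their difference retains the boundary contribution responsible for the weight
  of the vacuum.\<close>

lemma hop_commutator_window:
  assumes "supp_maya x" "window M S" "l \<noteq> 0" "m \<noteq> 0" "M + \<bar>l\<bar> + \<bar>m\<bar> \<le> R"
  shows "hop l g (hop m h x) S - hop m h (hop l g x) S =
    (\<Sum>b\<in>{b\<in>{-R..R}. b + m \<in> {-R..R}}. g (b + m) * h b * cre (b + m + l) (ann b x) S) -
    (\<Sum>a\<in>{a\<in>{-R..R}. a + l \<in> {-R..R}}. g a * h (a + l) * cre (a + l + m) (ann a x) S)"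
proof -
  have 1: "hop l g (hop m h x) S = hop_on {-R..R} l g (hop_on {-R..R} m h x) S"
    if "l \<noteq> 0" "m \<noteq> 0" "M + \<bar>l\<bar> + \<bar>m\<bar> \<le> R" for l m g h
  proof -
    have "hop l g (hop m h x) S = hop_on {-R..R} l g (hop m h x) S"
      using that assms(2) by (intro hop_eq_hop_on) auto
    also have "\<dots> = hop_on {-R..R} l g (hop_on {-R..R} m h x) S"
      using that assms(2) by (intro hop_on_cong[OF assms(2)] hop_eq_hop_on) auto
    finally show ?thesis .
  qed
  show ?thesis
    using 1[of l m g h] 1[of m l h g] assms hop_on_commutator[OF assms(1) finite_atLeastAtMost_int]
    by simp
qed

lemma hop_commutator:
  assumes "supp_maya x" "l > 0" "m > 0"
  shows "hop l g (hop m h x) - hop m h (hop l g x) = hop (l + m) (\<lambda>a. g (a + m) * h a - g a * h (a + l)) x"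
proof
  fix S
  show "(hop l g (hop m h x) - hop m h (hop l g x)) S = hop (l + m) (\<lambda>a. g (a + m) * h a - g a * h (a + l)) x S"
  proof (cases "maya S")
    case True
    then obtain M where M: "window M S" by (auto simp: maya_def)
    define R where "R = M + l + m"
    have z: "cre (a + (l + m)) (ann a x) S = 0" if "a + m \<notin> {-R..R} \<or> a + l \<notin> {-R..R}" for a
    proof -
      have "\<not> (a \<notin> S \<and> a + (l + m) \<in> S)"
      proof
        assume "a \<notin> S \<and> a + (l + m) \<in> S"
        then have "- M < a" "a + (l + m) \<le> M" using M window_notin window_in by blast+
        then show False using that assms by (auto simp: R_def)
      qed
      then show ?thesis using assms by (auto simp: cre_ann_apply)
    qed
    let ?c = "\<lambda>a. cre (a + (l + m)) (ann a x) S"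
    have "hop l g (hop m h x) S - hop m h (hop l g x) S =
      (\<Sum>b\<in>{b\<in>{-R..R}. b + m \<in> {-R..R}}. g (b + m) * h b * ?c b) -
      (\<Sum>a\<in>{a\<in>{-R..R}. a + l \<in> {-R..R}}. g a * h (a + l) * ?c a)"
      using hop_commutator_window[OF assms(1) M, of l m R g h] assms by (simp add: R_def add_ac)
    also have "(\<Sum>b\<in>{b\<in>{-R..R}. b + m \<in> {-R..R}}. g (b + m) * h b * ?c b) = (\<Sum>b\<in>{-R..R}. g (b + m) * h b * ?c b)"
      by (rule sum.mono_neutral_left) (use z in auto)
    also have "(\<Sum>a\<in>{a\<in>{-R..R}. a + l \<in> {-R..R}}. g a * h (a + l) * ?c a) = (\<Sum>a\<in>{-R..R}. g a * h (a + l) * ?c a)"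
      by (rule sum.mono_neutral_left) (use z in auto)
    also have "(\<Sum>b\<in>{-R..R}. g (b + m) * h b * ?c b) - (\<Sum>a\<in>{-R..R}. g a * h (a + l) * ?c a)
      = hop_on {-R..R} (l + m) (\<lambda>a. g (a + m) * h a - g a * h (a + l)) x S"
      by (simp add: hop_on_def sum_subtractf[symmetric] algebra_simps)
    also have "\<dots> = hop (l + m) (\<lambda>a. g (a + m) * h a - g a * h (a + l)) x S"
      using assms M by (intro hop_eq_hop_on[symmetric]) (auto simp: R_def)
    finally show ?thesis by (simp add: fun_simps)
  qed (simp add: hop_not_maya fun_simps)
qed

subsection \<open>Charge, degree and configurations\<close>

text \<open>The sum of C over S relative to the vacuum: C = 1 gives the charge, the identity the
  degree, and a difference of residues the weight.\<close>

definition msum :: "nat \<Rightarrow> (int \<Rightarrow> int) \<Rightarrow> int set \<Rightarrow> int" where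
  "msum i C S = sum C {p \<in> S. int i < p} - sum C {a. a \<notin> S \<and> a \<le> int i}"

lemma maya_finite_below: "maya S \<Longrightarrow> finite {a. a \<notin> S \<and> a \<le> c}"
proof -
  assume "maya S"
  then obtain M where "window M S" by (auto simp: maya_def)
  then have "{a. a \<notin> S \<and> a \<le> c} \<subseteq> {- M..c}" using window_notin by force
  then show ?thesis by (rule finite_subset) simp
qed

lemma msum_insert:
  assumes "maya S" "b \<notin> S"
  shows "msum i C (insert b S) = msum i C S + C b"
proof (cases "int i < b")
  case True
  then have "{p \<in> insert b S. int i < p} = insert b {p \<in> S. int i < p}"
    "{a. a \<notin> insert b S \<and> a \<le> int i} = {a. a \<notin> S \<and> a \<le> int i}" by auto
  then show ?thesis using assms maya_finite_above[of S] by (simp add: msum_def)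
next
  case False
  then have "{p \<in> insert b S. int i < p} = {p \<in> S. int i < p}"
    "{a. a \<notin> S \<and> a \<le> int i} = insert b {a. a \<notin> insert b S \<and> a \<le> int i}" using assms by auto
  moreover have "finite {a. a \<notin> insert b S \<and> a \<le> int i}" using assms maya_finite_below by (simp del: insert_iff)
  ultimately show ?thesis by (simp add: msum_def)
qed

lemma msum_remove:
  assumes "maya S" "b \<in> S"
  shows "msum i C (S - {b}) = msum i C S - C b"
  using msum_insert[of "S - {b}" b i C] assms by (simp add: insert_absorb)

lemma msum_hop:
  assumes "maya S" "a \<notin> S" "a + l \<in> S"
  shows "msum i C (insert a (S - {a + l})) = msum i C S + C a - C (a + l)"
  using assms by (simp add: msum_insert msum_remove)

definition vacuum_set :: "nat \<Rightarrow> int set" where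
  "vacuum_set i = {..int i}"

lemma maya_vacuum: "maya (vacuum_set i)"
  unfolding maya_def window_def vacuum_set_def by (rule exI[of _ "int i"]) auto

lemma msum_vacuum [simp]: "msum i C (vacuum_set i) = 0"
proof -
  have "{p \<in> vacuum_set i. int i < p} = {}" "{a. a \<notin> vacuum_set i \<and> a \<le> int i} = {}"
    by (auto simp: vacuum_set_def)
  then show ?thesis by (simp only: msum_def sum.empty diff_self)
qed

definition conf :: "nat \<Rightarrow> nat \<Rightarrow> int set set" where
  "conf i N = {S. maya S \<and> msum i (\<lambda>_. 1) S = 0 \<and> msum i (\<lambda>p. p) S = int N}"

lemma conf_maya: "S \<in> conf i N \<Longrightarrow> maya S"
  by (simp add: conf_def)

lemma conf_card: "S \<in> conf i N \<Longrightarrow> card {p \<in> S. int i < p} = card {a. a \<notin> S \<and> a \<le> int i}"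
  by (simp add: conf_def msum_def)

lemma conf_bounds:
  assumes "S \<in> conf i N"
  shows "p \<in> S \<Longrightarrow> p \<le> int i + int N" "a \<notin> S \<Longrightarrow> int i - int N \<le> a"
proof -
  let ?P = "{p \<in> S. int i < p}" and ?H = "{a. a \<notin> S \<and> a \<le> int i}"
  have fin: "finite ?P" "finite ?H"
    using maya_finite_above[OF conf_maya[OF assms]] maya_finite_below[OF conf_maya[OF assms]] by auto
  \<comment> \<open>At relative charge 0 the degree may be measured from i, which makes every
    summand nonnegative.\<close>
  have sum: "(\<Sum>p\<in>?P. p - int i) + (\<Sum>a\<in>?H. int i - a) = int N"
    using assms conf_card[OF assms] by (simp add: sum_subtractf conf_def msum_def)
  have nn: "0 \<le> (\<Sum>p\<in>?P. p - int i)" "0 \<le> (\<Sum>a\<in>?H. int i - a)" by (auto intro!: sum_nonneg)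
  show "p \<le> int i + int N" if "p \<in> S"
  proof (cases "int i < p")
    case True
    then have "p - int i \<le> (\<Sum>p\<in>?P. p - int i)" using that fin by (intro member_le_sum) auto
    then show ?thesis using sum nn by linarith
  qed simp
  show "int i - int N \<le> a" if "a \<notin> S"
  proof (cases "a \<le> int i")
    case True
    then have "int i - a \<le> (\<Sum>a\<in>?H. int i - a)" using that fin by (intro member_le_sum) auto
    then show ?thesis using sum nn by linarith
  qed simp
qed

lemma finite_conf: "finite (conf i N)"
proof (rule finite_subset)
  let ?I = "{int i - int N..int i + int N}"
  show "conf i N \<subseteq> (\<lambda>T. {..<int i - int N} \<union> T) ` Pow ?I"
  proof
    fix S assume S: "S \<in> conf i N"
    have "S = {..<int i - int N} \<union> (S \<inter> ?I)" using conf_bounds[OF S] by (auto simp: not_less) (meson not_le)+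
    then show "S \<in> (\<lambda>T. {..<int i - int N} \<union> T) ` Pow ?I" by blast
  qed
qed simp

lemma conf_0: "conf i 0 = {vacuum_set i}"
proof -
  have "S = vacuum_set i" if S: "S \<in> conf i 0" for S
  proof -
    have "finite {a. a \<notin> S \<and> a \<le> int i}" using maya_finite_below[OF conf_maya[OF S]] .
    moreover have "{p \<in> S. int i < p} = {}" using conf_bounds(1)[OF S] by force
    ultimately have "{a. a \<notin> S \<and> a \<le> int i} = {}"
      using conf_card[OF S] by (metis card.empty card_0_eq)
    with \<open>{p \<in> S. int i < p} = {}\<close> show ?thesis by (auto simp: vacuum_set_def not_less[symmetric])
  qed
  then show ?thesis by (auto simp: conf_def maya_vacuum)
qed

lemma conf_hop:
  assumes "maya S" "a \<notin> S" "a + int l \<in> S"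
  shows "insert a (S - {a + int l}) \<in> conf i N \<longleftrightarrow> S \<in> conf i (N + l)"
  using assms by (auto simp: conf_def msum_hop)

definition homogeneous :: "nat \<Rightarrow> nat \<Rightarrow> fock \<Rightarrow> bool" where
  "homogeneous i N x \<longleftrightarrow> (\<forall>S. x S \<noteq> 0 \<longrightarrow> S \<in> conf i N)"

lemma homogeneous_supp_maya: "homogeneous i N x \<Longrightarrow> supp_maya x"
  by (auto simp: homogeneous_def supp_maya_def conf_maya)

lemma hop_nonzeroE:
  assumes "hop l h x S \<noteq> 0" "l \<noteq> 0"
  obtains a where "maya S" "a \<notin> S" "a + l \<in> S" "h a \<noteq> 0" "x (insert a (S - {a + l})) \<noteq> 0"
proof -
  obtain a where a: "a \<notin> S" "a + l \<in> S" "h a * cre (a + l) (ann a x) S \<noteq> 0"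
    using assms(1) unfolding hop_def by (metis (mono_tags, lifting) mem_Collect_eq sum.neutral)
  with assms(2) have "maya S" "h a \<noteq> 0" "x (insert a (S - {a + l})) \<noteq> 0"
    by (auto simp: cre_ann_apply split: if_splits)
  with a that show thesis by blast
qed

lemma homogeneous_hop:
  assumes "homogeneous i N x" "l > 0"
  shows "homogeneous i (N + l) (hop (int l) h x)"
  unfolding homogeneous_def
proof (intro allI impI)
  fix S assume "hop (int l) h x S \<noteq> 0"
  then obtain a where "maya S" "a \<notin> S" "a + int l \<in> S" "x (insert a (S - {a + int l})) \<noteq> 0"
    using assms(2) by (elim hop_nonzeroE) auto
  with assms(1) show "S \<in> conf i (N + l)" by (auto simp: homogeneous_def conf_hop)
qed

definition vacuum :: "nat \<Rightarrow> fock" where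
  "vacuum i S = of_bool (S = vacuum_set i)"

lemma homogeneous_vacuum: "homogeneous i 0 (vacuum i)"
  by (auto simp: homogeneous_def vacuum_def conf_0)

lemma hop_add: "hop l h (x + y) = hop l h x + hop l h y"
  and hop_fscale: "hop l h (fscale c x) = fscale c (hop l h x)"
  and hop_coeff_add: "hop l (\<lambda>a. h a + h' a) x = hop l h x + hop l h' x"
  and hop_coeff_scale: "hop l (\<lambda>a. c * h a) x = fscale c (hop l h x)"
proof -
  have "cre p (ann a (x + y)) S = cre p (ann a x) S + cre p (ann a y) S"
    and scale: "cre p (ann a (fscale c x)) S = c * cre p (ann a x) S" for p a S
    by (auto simp: cre_def ann_def fscale_def algebra_simps plus_fun_apply)
  then show "hop l h (x + y) = hop l h x + hop l h y"
    by (auto simp: hop_def fun_simps algebra_simps sum.distrib)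
  show "hop l h (fscale c x) = fscale c (hop l h x)"
    unfolding hop_def scale by (auto simp: fscale_def fun_simps algebra_simps sum_distrib_left)
  show "hop l (\<lambda>a. h a + h' a) x = hop l h x + hop l h' x" "hop l (\<lambda>a. c * h a) x = fscale c (hop l h x)"
    by (auto simp: hop_def fscale_def fun_simps algebra_simps sum.distrib sum_distrib_left)
qed

lemma hop_0: "hop l h 0 = 0"
  using hop_fscale[of l h 0 0] by simp


subsection \<open>The Chevalley generators\<close>

text \<open>The reflection a to -a folds the cycle of 2 n residues onto the nodes 0..n. The two
  classes coincide for j = 0 and j = n; \<open>of_bool\<close> counts them once.\<close>

definition residue :: "nat \<Rightarrow> nat \<Rightarrow> int \<Rightarrow> int" where
  "residue n j a = of_bool (2 * int n dvd a - int j \<or> 2 * int n dvd a + int j)"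

definition fock_f :: "nat \<Rightarrow> nat \<Rightarrow> fock \<Rightarrow> fock" where
  "fock_f n j = hop 1 (\<lambda>a. of_int (residue n j a))"

text \<open>The reverse of the hop a to a + 1, carrying the residue of the lower site: the transpose
  of \<open>fock_f\<close>.\<close>

definition fock_e :: "nat \<Rightarrow> nat \<Rightarrow> fock \<Rightarrow> fock" where
  "fock_e n j = hop (- 1) (\<lambda>a. of_int (residue n j (a - 1)))"

lemma residue_minus: "residue n j (- a) = residue n j a"
proof -
  have "- a - int j = - (a + int j)" "- a + int j = - (a - int j)" by simp_all
  then show ?thesis unfolding residue_def by (simp only: dvd_minus_iff disj_commute)
qed

lemma residue_period: "residue n j (a + 2 * int n * t) = residue n j a"
proof -
  have "2 * int n dvd a + 2 * int n * t + c \<longleftrightarrow> 2 * int n dvd a + c" for c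
  proof -
    have "a + 2 * int n * t + c = a + c + 2 * int n * t" by simp
    then show ?thesis by (simp only: dvd_add_left_iff[OF dvd_triv_left])
  qed
  from this[of "int j"] this[of "- int j"] show ?thesis by (simp add: residue_def)
qed

lemma residue_small:
  assumes "0 \<le> a" "a \<le> int n" "j \<le> n" "n \<ge> 1"
  shows "residue n j a = of_bool (a = int j)"
proof -
  have "\<not> 2 * int n dvd a - int j" if "a \<noteq> int j"
    using dvd_imp_le_int[of "a - int j" "2 * int n"] that assms by auto
  moreover have "a = int j" if "2 * int n dvd a + int j"
  proof -
    obtain k where k: "a + int j = 2 * int n * k" using \<open>2 * int n dvd a + int j\<close> by (elim dvdE)
    have "0 \<le> 2 * int n * k" "2 * int n * k \<le> 2 * int n * 1" using k assms by linarith+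
    then have "0 \<le> k" "k \<le> 1" using assms(4) by (auto simp: zero_le_mult_iff mult_le_cancel_left)
    then have "k = 0 \<or> k = 1" by auto
    then show ?thesis using k assms by auto
  qed
  ultimately show ?thesis by (auto simp: residue_def)
qed

lemma residue_eq_1D:
  assumes "residue n j a = 1"
  shows "\<exists>t. a = int j + 2 * int n * t \<or> a = - int j + 2 * int n * t"
proof -
  have "2 * int n dvd a - int j \<or> 2 * int n dvd a + int j" 
    using assms unfolding residue_def by (simp only: of_bool_eq_1_iff)
  then obtain t where "a - int j = 2 * int n * t \<or> a + int j = 2 * int n * t" by (auto elim!: dvdE)
  then have "a = int j + 2 * int n * t \<or> a = - int j + 2 * int n * t" by linarith
  then show ?thesis ..
qed

lemma residue_exclusive:
  assumes "residue n j a = 1" "residue n k a = 1" "j \<le> n" "k \<le> n" "n \<ge> 1"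
  shows "j = k"
proof -
  obtain t where "a = int j + 2 * int n * t \<or> a = - int j + 2 * int n * t"
    using residue_eq_1D[OF assms(1)] by blast
  then have "residue n k a = residue n k (int j)"
    by (elim disjE) (simp_all only: residue_period residue_minus)
  with assms residue_small[of "int j" n k] show ?thesis by auto
qed

text \<open>The Cartan matrix is a second difference of residues. At the folding points 0 and n both
  neighbours have the same residue, which produces the entries -2.\<close>

lemma residue_cartan:
  assumes "residue n k b = 1" "j \<le> n" "k \<le> n" "n \<ge> 1"
  shows "residue n j (b + 1) + residue n j (b - 1) - 2 * residue n j b = - cartan n j k"
proof -
  obtain t where "b = int k + 2 * int n * t \<or> b = - int k + 2 * int n * t"
    using residue_eq_1D[OF assms(1)] by blast
  then have "residue n j (b + 1) + residue n j (b - 1) - 2 * residue n j b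
     = residue n j (int k + 1) + residue n j (int k - 1) - 2 * residue n j (int k)"
  proof
    assume b: "b = int k + 2 * int n * t"
    have "b + 1 = int k + 1 + 2 * int n * t" "b - 1 = int k - 1 + 2 * int n * t" using b by simp_all
    then show ?thesis using b by (simp only: residue_period)
  next
    assume b: "b = - int k + 2 * int n * t"
    have "b + 1 = - (int k - 1) + 2 * int n * t" "b - 1 = - (int k + 1) + 2 * int n * t" using b by simp_all
    then show ?thesis using b by (simp only: residue_period residue_minus)
  qed
  moreover have "residue n j (int k - 1) = (if k = 0 then of_bool (j = 1) else of_bool (int j = int k - 1))"
    using residue_minus[of n j 1] residue_small[of 1 n j] residue_small[of "int k - 1" n j] assms by auto
  moreover have "residue n j (int k + 1) = (if k = n then of_bool (int j = int n - 1) else of_bool (j = k + 1))"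
  proof (cases "k = n")
    case True
    have "int n + 1 = - (int n - 1) + 2 * int n * 1" by simp
    then have "residue n j (int n + 1) = residue n j (int n - 1)" by (metis residue_period residue_minus)
    then show ?thesis using True residue_small[of "int n - 1" n j] assms by auto
  next
    case False
    then show ?thesis using residue_small[of "int k + 1" n j] assms by auto
  qed
  ultimately show ?thesis
    using residue_small[of "int k" n j] assms by (auto simp: cartan_def)
qed

text \<open>The eigenvalue of h_j on the state S: the vacuum contributes
  \<open>residue n j i\<close>, and a particle at p the difference of the residues of the hops
  leaving and entering p.\<close>

definition fock_weight :: "nat \<Rightarrow> nat \<Rightarrow> nat \<Rightarrow> int set \<Rightarrow> int" where
  "fock_weight n i j S = residue n j (int i) + msum i (\<lambda>p. residue n j p - residue n j (p - 1)) S"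

lemma sum_telescope_int:
  fixes r :: "int \<Rightarrow> int"
  assumes "a \<le> b"
  shows "(\<Sum>p=a+1..b. r p - r (p - 1)) = r b - r a"
  using assms
proof (induction b rule: int_ge_induct)
  case (step b)
  then have "{a+1..b+1} = insert (b+1) {a+1..b}" by auto
  then show ?case using step by simp
qed simp

lemma msum_window:
  assumes "window M S" "M < R" "int i < R"
  shows "msum i C S = sum C (S \<inter> {-R+1..R-1}) - sum C {-R+1..int i}"
proof -
  have 1: "{p \<in> S. int i < p} = S \<inter> {int i + 1..R - 1}" using window_in[OF assms(1)] assms(2) by force
  have 2: "{a. a \<notin> S \<and> a \<le> int i} = {-R+1..int i} - S" using window_notin[OF assms(1)] assms(2) by force
  have "sum C {-R+1..int i} = sum C ({-R+1..int i} - S) + sum C (S \<inter> {-R+1..int i})"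
    by (subst sum.union_disjoint[symmetric]) (auto intro!: arg_cong2[of _ _ _ _ sum])
  moreover have "sum C (S \<inter> {-R+1..R-1}) = sum C (S \<inter> {-R+1..int i}) + sum C (S \<inter> {int i + 1..R - 1})"
  proof -
    have "S \<inter> {-R+1..R-1} = (S \<inter> {-R+1..int i}) \<union> (S \<inter> {int i + 1..R - 1})"
      using assms by auto
    then show ?thesis by (simp only:) (rule sum.union_disjoint, auto)
  qed
  ultimately show ?thesis unfolding msum_def 1 2 by simp
qed

text \<open>The two intervals are offset by one, so the occupied site -R contributes an unmatched
  residue; together with the telescoping sum over the vacuum it leaves the residue at i.\<close>

lemma fock_weight_window:
  assumes "window M S" "M < R" "int i < R"
  shows "fock_weight n i j S = (\<Sum>b=-R..R-1. of_bool (b \<in> S) * residue n j b)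
      - (\<Sum>a=-R+1..R. of_bool (a \<in> S) * residue n j (a - 1))"
proof -
  let ?r = "residue n j"
  have R: "- R \<in> S" "R \<notin> S" using window_notin[OF assms(1), of "- R"] window_in[OF assms(1), of R] assms(2) by auto
  have "0 < R" using assms(3) by linarith
  then have "{-R..R-1} = insert (-R) {-R+1..R-1}" "{-R+1..R} = insert R {-R+1..R-1}" by auto
  then have "(\<Sum>b=-R..R-1. of_bool (b \<in> S) * ?r b) - (\<Sum>a=-R+1..R. of_bool (a \<in> S) * ?r (a - 1))
     = ?r (- R) + (\<Sum>b=-R+1..R-1. of_bool (b \<in> S) * (?r b - ?r (b - 1)))"
    using R by (simp add: right_diff_distrib sum_subtractf)
  also have "(\<Sum>b=-R+1..R-1. of_bool (b \<in> S) * (?r b - ?r (b - 1))) = (\<Sum>b\<in>S \<inter> {-R+1..R-1}. ?r b - ?r (b - 1))"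
    by (intro sum.mono_neutral_cong_right) auto
  finally show ?thesis
    using msum_window[OF assms, of "\<lambda>p. ?r p - ?r (p - 1)"] sum_telescope_int[of "- R" "int i" ?r] \<open>0 < R\<close>
    by (simp add: fock_weight_def)
qed

text \<open>The commutator of hops with total displacement 0 is a combination of occupation numbers,
  with eigenvalue \<open>fock_weight\<close>.\<close>

lemma fock_e_f:
  assumes "supp_maya x" "n \<ge> 1" "j \<le> n" "k \<le> n"
  shows "fock_e n j (fock_f n k x) = fock_f n k (fock_e n j x) +
     (\<lambda>S. if j = k then of_int (fock_weight n i j S) * x S else 0)"
proof
  fix S
  show "fock_e n j (fock_f n k x) S = (fock_f n k (fock_e n j x) +
     (\<lambda>S. if j = k then of_int (fock_weight n i j S) * x S else 0)) S"
  proof (cases "maya S")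
    case True
    then obtain M where M: "window M S" by (auto simp: maya_def)
    define R where "R = max (M + 2) (int i + 1)"
    let ?g = "\<lambda>j a. complex_of_int (residue n j a)"
    \<comment> \<open>Distinct nodes have disjoint residue classes, and indicators are
      idempotent.\<close>
    have jk: "?g j a * ?g k a = of_bool (j = k) * ?g j a" for a
    proof (cases "j = k")
      case False
      have "residue n l a = 0 \<or> residue n l a = 1" for l by (auto simp: residue_def)
      then have "residue n j a = 0 \<or> residue n k a = 0" using residue_exclusive[of n j a k] assms False by metis
      then show ?thesis using False by auto
    qed (auto simp: residue_def)
    have "fock_e n j (fock_f n k x) S - fock_f n k (fock_e n j x) S =
      (\<Sum>b\<in>{b\<in>{-R..R}. b + 1 \<in> {-R..R}}. ?g j b * ?g k b * cre b (ann b x) S) -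
      (\<Sum>a\<in>{a\<in>{-R..R}. a - 1 \<in> {-R..R}}. ?g j (a - 1) * ?g k (a - 1) * cre a (ann a x) S)"
      unfolding fock_e_def fock_f_def
      using hop_commutator_window[OF assms(1) M, of "- 1" 1 R "\<lambda>a. ?g j (a - 1)" "?g k"] by (simp add: R_def)
    also have "{b\<in>{-R..R}. b + 1 \<in> {-R..R}} = {-R..R-1}" by auto
    also have "{a\<in>{-R..R}. a - 1 \<in> {-R..R}} = {-R+1..R}" by auto
    also have "(\<Sum>b=-R..R-1. ?g j b * ?g k b * cre b (ann b x) S) - (\<Sum>a=-R+1..R. ?g j (a - 1) * ?g k (a - 1) * cre a (ann a x) S)
      = of_bool (j = k) * ((\<Sum>b=-R..R-1. of_bool (b \<in> S) * ?g j b) - (\<Sum>a=-R+1..R. of_bool (a \<in> S) * ?g j (a - 1))) * x S"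
      unfolding jk cre_ann_same[OF assms(1)]
      unfolding right_diff_distrib left_diff_distrib sum_distrib_left sum_distrib_right
      by (intro arg_cong2[of _ _ _ _ minus] sum.cong HOL.refl) auto
    also have "\<dots> = of_bool (j = k) * of_int (fock_weight n i j S) * x S"
      by (subst fock_weight_window[OF M]) (auto simp: R_def)
    finally show ?thesis by (auto simp: algebra_simps fun_simps)
  qed (use assms in \<open>auto simp: fun_simps fock_e_def fock_f_def hop_not_maya supp_maya_def\<close>)
qed

text \<open>A hop between neighbours passes no particle, so the two fermionic signs cancel.\<close>

lemma fock_f_apply:
  assumes "maya S"
  shows "fock_f n j x S = (\<Sum>a | a \<notin> S \<and> a + 1 \<in> S. of_int (residue n j a) * x (insert a (S - {a + 1})))"
  unfolding fock_f_def hop_def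
proof (intro sum.cong HOL.refl)
  fix a assume a: "a \<in> {a. a \<notin> S \<and> a + 1 \<in> S}"
  have "{b \<in> S - {a + 1}. a < b} = {b \<in> S. a + 1 < b}" by auto
  then have "fermion_sign (S - {a + 1}) a = fermion_sign S (a + 1)" by (simp only: fermion_sign_def)
  then show "of_int (residue n j a) * cre (a + 1) (ann a x) S = of_int (residue n j a) * x (insert a (S - {a + 1}))"
    using a assms by (simp add: cre_ann_apply)
qed

lemma fock_e_apply:
  assumes "maya S"
  shows "fock_e n j x S = (\<Sum>a | a \<in> S \<and> a + 1 \<notin> S. of_int (residue n j a) * x (insert (a + 1) (S - {a})))"
proof -
  have "fock_e n j x S = (\<Sum>a | a \<notin> S \<and> a - 1 \<in> S. of_int (residue n j (a - 1)) * x (insert a (S - {a - 1})))"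
    unfolding fock_e_def hop_def
  proof (intro sum.cong)
    fix a assume a: "a \<in> {a. a \<notin> S \<and> a - 1 \<in> S}"
    have "{b \<in> S - {a - 1}. a < b} = {b \<in> S. a - 1 < b}"
    proof -
      have "b = a \<or> a < b" if "a - 1 < b" for b using that by linarith
      then show ?thesis using a by auto
    qed
    then have "fermion_sign (S - {a - 1}) a = fermion_sign S (a - 1)" by (simp only: fermion_sign_def)
    then show "of_int (residue n j (a - 1)) * cre (a + - 1) (ann a x) S = of_int (residue n j (a - 1)) * x (insert a (S - {a - 1}))"
      using a assms by (simp add: cre_ann_apply)
  qed simp
  also have "\<dots> = (\<Sum>a | a \<in> S \<and> a + 1 \<notin> S. of_int (residue n j a) * x (insert (a + 1) (S - {a})))"
    by (rule sum.reindex_bij_witness[of _ "\<lambda>a. a + 1" "\<lambda>a. a - 1"]) auto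
  finally show ?thesis .
qed

text \<open>Moving one particle up or down matches the pairs of state and site in the two sums, and
  the coefficients are real. This drives \<open>fock_no_singular_vector\<close>.\<close>

lemma fock_adjoint:
  "(\<Sum>S\<in>conf i (Suc N). fock_f n j x S * cnj (y S)) = (\<Sum>S\<in>conf i N. x S * cnj (fock_e n j y S))"
proof -
  let ?r = "\<lambda>a. complex_of_int (residue n j a)"
  have fin: "finite {a. a \<notin> S \<and> a + 1 \<in> S}" "finite {a. a \<in> S \<and> a + 1 \<notin> S}" if "maya S" for S
  proof -
    show "finite {a. a \<notin> S \<and> a + 1 \<in> S}" using finite_hop[OF that, of 1] .
    have "{a. a \<in> S \<and> a + 1 \<notin> S} = (\<lambda>a. a - 1) ` {a. a \<notin> S \<and> a + (- 1) \<in> S}"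
      by (auto simp: image_iff) (metis add_diff_cancel_right')
    then show "finite {a. a \<in> S \<and> a + 1 \<notin> S}" using finite_hop[OF that, of "- 1"] by simp
  qed
  have "(\<Sum>S\<in>conf i (Suc N). fock_f n j x S * cnj (y S)) =
    (\<Sum>S\<in>conf i (Suc N). \<Sum>a | a \<notin> S \<and> a + 1 \<in> S. ?r a * x (insert a (S - {a + 1})) * cnj (y S))"
    by (intro sum.cong) (auto simp: fock_f_apply conf_maya sum_distrib_right)
  also have "\<dots> = (\<Sum>(S, a)\<in>Sigma (conf i (Suc N)) (\<lambda>S. {a. a \<notin> S \<and> a + 1 \<in> S}). ?r a * x (insert a (S - {a + 1})) * cnj (y S))"
    using fin by (intro sum.Sigma) (auto simp: finite_conf conf_maya)
  also have "\<dots> = (\<Sum>(S, a)\<in>Sigma (conf i N) (\<lambda>S. {a. a \<in> S \<and> a + 1 \<notin> S}). x S * (?r a * cnj (y (insert (a + 1) (S - {a})))))"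
  proof (rule sum.reindex_bij_witness[of _ "\<lambda>(S, a). (insert (a + 1) (S - {a}), a)" "\<lambda>(S, a). (insert a (S - {a + 1}), a)"])
    fix Sa assume "Sa \<in> Sigma (conf i (Suc N)) (\<lambda>S. {a. a \<notin> S \<and> a + 1 \<in> S})"
    then obtain S a where S: "Sa = (S, a)" "S \<in> conf i (Suc N)" "a \<notin> S" "a + 1 \<in> S" by auto
    have orig: "insert (a + 1) (insert a (S - {a + 1}) - {a}) = S" using S by auto
    show "(case (case Sa of (S, a) \<Rightarrow> (insert a (S - {a + 1}), a)) of (S, a) \<Rightarrow> (insert (a + 1) (S - {a}), a)) = Sa"
      using orig S by simp
    have "insert a (S - {a + 1}) \<in> conf i N" using conf_hop[of S a 1 i N] S conf_maya by simp
    then show "(case Sa of (S, a) \<Rightarrow> (insert a (S - {a + 1}), a)) \<in> Sigma (conf i N) (\<lambda>S. {a. a \<in> S \<and> a + 1 \<notin> S})"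
      using S by simp
    show "(case case Sa of (S, a) \<Rightarrow> (insert a (S - {a + 1}), a) of (S, a) \<Rightarrow> x S * (?r a * cnj (y (insert (a + 1) (S - {a}))))) =
        (case Sa of (S, a) \<Rightarrow> ?r a * x (insert a (S - {a + 1})) * cnj (y S))"
      using orig S by simp
  next
    fix Sa assume "Sa \<in> Sigma (conf i N) (\<lambda>S. {a. a \<in> S \<and> a + 1 \<notin> S})"
    then obtain S a where S: "Sa = (S, a)" "S \<in> conf i N" "a \<in> S" "a + 1 \<notin> S" by auto
    have orig: "insert a (insert (a + 1) (S - {a}) - {a + 1}) = S" using S by auto
    show "(case (case Sa of (S, a) \<Rightarrow> (insert (a + 1) (S - {a}), a)) of (S, a) \<Rightarrow> (insert a (S - {a + 1}), a)) = Sa"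
      using orig S by simp
    have "insert (a + 1) (S - {a}) \<in> conf i (Suc N)"
      using conf_hop[of "insert (a + 1) (S - {a})" a 1 i N] S conf_maya[OF S(2)] orig by simp
    then show "(case Sa of (S, a) \<Rightarrow> (insert (a + 1) (S - {a}), a)) \<in> Sigma (conf i (Suc N)) (\<lambda>S. {a. a \<notin> S \<and> a + 1 \<in> S})"
      using S by simp
  qed
  also have "\<dots> = (\<Sum>S\<in>conf i N. \<Sum>a | a \<in> S \<and> a + 1 \<notin> S. x S * (?r a * cnj (y (insert (a + 1) (S - {a})))))"
    using fin by (intro sum.Sigma[symmetric]) (auto simp: finite_conf conf_maya)
  also have "\<dots> = (\<Sum>S\<in>conf i N. x S * cnj (fock_e n j y S))"
    by (intro sum.cong) (auto simp: fock_e_apply conf_maya sum_distrib_left)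
  finally show ?thesis .
qed

primrec fock_word :: "nat \<Rightarrow> nat \<Rightarrow> nat list \<Rightarrow> fock" where
  "fock_word n i [] = vacuum i"
| "fock_word n i (k # w) = fock_f n k (fock_word n i w)"

lemma homogeneous_fock_f: "homogeneous i N x \<Longrightarrow> homogeneous i (Suc N) (fock_f n j x)"
  using homogeneous_hop[of i N x 1] by (simp add: fock_f_def)

lemma homogeneous_fock_word: "homogeneous i (length w) (fock_word n i w)"
  by (induction w) (auto simp: homogeneous_vacuum homogeneous_fock_f)

lemma fock_e_vacuum: "fock_e n j (vacuum i) = 0"
proof
  fix S show "fock_e n j (vacuum i) S = 0 S"
  proof (rule ccontr)
    assume "fock_e n j (vacuum i) S \<noteq> 0 S"
    then have "hop (- 1) (\<lambda>a. of_int (residue n j (a - 1))) (vacuum i) S \<noteq> 0" by (simp add: fock_e_def fun_simps)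
    then obtain a where a: "maya S" "a \<notin> S" "a - 1 \<in> S" "insert a (S - {a - 1}) = vacuum_set i"
      by (elim hop_nonzeroE) (auto simp: vacuum_def)
    have "a \<in> insert a (S - {a - 1})" "a - 1 \<notin> insert a (S - {a - 1})" by auto
    then show False unfolding a(4) by (auto simp: vacuum_set_def)
  qed
qed

text \<open>The vacuum has weight \<Lambda>_i, and each letter k lowers the value on h_j by a Cartan
  entry, through \<open>residue_cartan\<close>.\<close>

lemma fock_weight_word:
  assumes "fock_word n i w S \<noteq> 0" "set w \<subseteq> {..n}" "j \<le> n" "i \<le> n" "n \<ge> 1"
  shows "fock_weight n i j S = of_bool (j = i) - (\<Sum>k\<leftarrow>w. cartan n j k)"
  using assms(1,2)
proof (induction w arbitrary: S)
  case Nil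
  then show ?case using residue_small[of "int i" n j] assms by (auto simp: vacuum_def fock_weight_def split: if_splits)
next
  case (Cons k w)
  from Cons.prems(1) obtain a where a: "maya S" "a \<notin> S" "a + 1 \<in> S" "residue n k a \<noteq> 0"
      "fock_word n i w (insert a (S - {a + 1})) \<noteq> 0"
    unfolding fock_word.simps fock_f_def by (elim hop_nonzeroE) auto
  have "residue n k a = 1" using a(4) by (auto simp: residue_def)
  then have "residue n j (a + 1) + residue n j (a - 1) - 2 * residue n j a = - cartan n j k"
    using Cons.prems assms by (intro residue_cartan) auto
  moreover have "fock_weight n i j (insert a (S - {a + 1})) = of_bool (j = i) - (\<Sum>k\<leftarrow>w. cartan n j k)"
    using Cons.prems a by (intro Cons.IH) auto
  ultimately show ?case using msum_hop[OF a(1-3), of i "\<lambda>p. residue n j p - residue n j (p - 1)"]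
    by (simp add: fock_weight_def)
qed

text \<open>The same recursion with the same scalars as \<open>op_e_word\<close> in the module; the
  comparison rests on this parallel.\<close>

lemma fock_e_word:
  assumes "set w \<subseteq> {..n}" "j \<le> n" "k \<le> n" "i \<le> n" "n \<ge> 1"
  shows "fock_e n j (fock_f n k (fock_word n i w)) = fock_f n k (fock_e n j (fock_word n i w)) +
    (if j = k then fscale (of_bool (j = i) - (\<Sum>k\<leftarrow>w. of_int (cartan n j k))) (fock_word n i w) else 0)"
proof -
  have "of_int (fock_weight n i j S) * fock_word n i w S = (of_bool (j = i) - (\<Sum>k\<leftarrow>w. of_int (cartan n j k))) * fock_word n i w S" for S
  proof (cases "fock_word n i w S = 0")
    case False
    have "complex_of_int (\<Sum>k\<leftarrow>w. cartan n j k) = (\<Sum>k\<leftarrow>w. of_int (cartan n j k))" by (induction w) auto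
    with fock_weight_word[OF False] assms show ?thesis by simp
  qed simp
  then have "(\<lambda>S. if j = k then of_int (fock_weight n i j S) * fock_word n i w S else 0) =
    (if j = k then fscale (of_bool (j = i) - (\<Sum>k\<leftarrow>w. of_int (cartan n j k))) (fock_word n i w) else 0)"
    by (cases "j = k") (simp_all only: simp_thms if_True if_False fscale_def zero_fun_def)
  then show ?thesis
    using fock_e_f[of "fock_word n i w" n j k i] homogeneous_supp_maya[OF homogeneous_fock_word] assms by simp
qed

subsection \<open>The submodule generated by the vacuum\<close>

definition word_space :: "nat \<Rightarrow> nat \<Rightarrow> nat \<Rightarrow> fock set" where
  "word_space n i N = fock.span (fock_word n i ` {w. length w = N \<and> set w \<subseteq> {..n}})"

lemma word_space_induct [consumes 1, case_names zero add]:
  assumes "x \<in> word_space n i N" "P 0"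
    "\<And>c w y. length w = N \<Longrightarrow> set w \<subseteq> {..n} \<Longrightarrow> P y \<Longrightarrow> y \<in> word_space n i N \<Longrightarrow>
       P (fscale c (fock_word n i w) + y)"
  shows "P x"
proof -
  have "P x \<and> x \<in> word_space n i N"
    using assms(1) unfolding word_space_def
  proof (induction rule: fock.span_induct_alt)
    case base
    show ?case using assms(2) by (simp add: fock.span_zero)
  next
    case (step c x y)
    then obtain w where w: "length w = N" "set w \<subseteq> {..n}" "x = fock_word n i w" by auto
    have "fscale c x + y \<in> fock.span (fock_word n i ` {w. length w = N \<and> set w \<subseteq> {..n}})"
      by (rule fock.span_add[OF fock.span_scale[OF fock.span_base[OF step(1)]]]) (use step in blast)
    then show ?case using step w assms(3) unfolding word_space_def by blast
  qed
  then show ?thesis ..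
qed

lemma word_space_word: "length w = N \<Longrightarrow> set w \<subseteq> {..n} \<Longrightarrow> fock_word n i w \<in> word_space n i N"
  unfolding word_space_def by (intro fock.span_base) auto

lemma word_space_zero [simp]: "0 \<in> word_space n i N"
  and word_space_add: "x \<in> word_space n i N \<Longrightarrow> y \<in> word_space n i N \<Longrightarrow> x + y \<in> word_space n i N"
  and word_space_diff: "x \<in> word_space n i N \<Longrightarrow> y \<in> word_space n i N \<Longrightarrow> x - y \<in> word_space n i N"
  and word_space_scale: "x \<in> word_space n i N \<Longrightarrow> fscale c x \<in> word_space n i N"
  unfolding word_space_def
  by (auto intro: fock.span_zero fock.span_add fock.span_diff fock.span_scale)

lemma homogeneous_add: "homogeneous i N x \<Longrightarrow> homogeneous i N y \<Longrightarrow> homogeneous i N (x + y)"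
  unfolding homogeneous_def plus_fun_apply by (metis add.right_neutral)

lemma homogeneous_scale: "homogeneous i N x \<Longrightarrow> homogeneous i N (fscale c x)"
  by (auto simp: homogeneous_def fscale_def)

lemma homogeneous_word_space: "x \<in> word_space n i N \<Longrightarrow> homogeneous i N x"
proof (induction rule: word_space_induct)
  case zero
  show ?case by (simp add: homogeneous_def fun_simps)
next
  case (add c w y)
  then show ?case using homogeneous_fock_word by (auto intro!: homogeneous_add homogeneous_scale)
qed

text \<open>Coefficients are collected by their effect on the generated space, so closure under
  sums, multiples and commutators is immediate.\<close>

definition word_hops :: "nat \<Rightarrow> nat \<Rightarrow> nat \<Rightarrow> (int \<Rightarrow> complex) set" where
  "word_hops n i l = {h. \<forall>N. \<forall>x\<in>word_space n i N. hop (int l) h x \<in> word_space n i (N + l)}"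

lemma word_hops_f:
  assumes "j \<le> n"
  shows "(\<lambda>a. of_int (residue n j a)) \<in> word_hops n i 1"
proof -
  have "fock_f n j x \<in> word_space n i (Suc N)" if "x \<in> word_space n i N" for x N
    using that
  proof (induction rule: word_space_induct)
    case (add c w y)
    have "fock_f n j (fock_word n i w) \<in> word_space n i (Suc N)"
      using word_space_word[of "j # w" "Suc N" n i] add assms by simp
    then show ?case using add by (simp add: fock_f_def hop_add hop_fscale word_space_add word_space_scale)
  qed (simp add: fock_f_def hop_0)
  then show ?thesis by (simp add: word_hops_def fock_f_def)
qed

lemma word_hops_add: "h \<in> word_hops n i l \<Longrightarrow> h' \<in> word_hops n i l \<Longrightarrow> (\<lambda>a. h a + h' a) \<in> word_hops n i l"
  by (simp add: word_hops_def hop_coeff_add word_space_add)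

lemma word_hops_scale: "h \<in> word_hops n i l \<Longrightarrow> (\<lambda>a. c * h a) \<in> word_hops n i l"
  by (simp add: word_hops_def hop_coeff_scale word_space_scale)

lemma word_hops_commutator:
  assumes "g \<in> word_hops n i 1" "h \<in> word_hops n i l" "l \<ge> 1"
  shows "(\<lambda>a. g (a + int l) * h a - g a * h (a + 1)) \<in> word_hops n i (Suc l)"
  unfolding word_hops_def
proof (intro CollectI allI ballI)
  fix N x assume x: "x \<in> word_space n i N"
  have "hop (int l) h x \<in> word_space n i (N + l)" "hop 1 g x \<in> word_space n i (N + 1)"
    using assms x by (auto simp: word_hops_def)
  then have "hop 1 g (hop (int l) h x) \<in> word_space n i (N + l + 1)" "hop (int l) h (hop 1 g x) \<in> word_space n i (N + 1 + l)"
    using assms unfolding word_hops_def by (metis (no_types, lifting) mem_Collect_eq of_nat_1, blast)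
  then have "hop 1 g (hop (int l) h x) - hop (int l) h (hop 1 g x) \<in> word_space n i (N + Suc l)"
    by (intro word_space_diff) (simp_all add: add.commute)
  also have "hop 1 g (hop (int l) h x) - hop (int l) h (hop 1 g x) = hop (1 + int l) (\<lambda>a. g (a + int l) * h a - g a * h (a + 1)) x"
    using homogeneous_supp_maya[OF homogeneous_word_space[OF x]] assms(3) by (intro hop_commutator) auto
  finally show "hop (int (Suc l)) (\<lambda>a. g (a + int l) * h a - g a * h (a + 1)) x \<in> word_space n i (N + Suc l)"
    by simp
qed

section \<open>Long hops as iterated commutators\<close>

definition delta_mod :: "nat \<Rightarrow> int \<Rightarrow> int \<Rightarrow> complex" where
  "delta_mod n s a = of_bool (2 * int n dvd a - s)"

text \<open>The mirror image under r to 1 - r of a hop from s to s + l is the hop from 1 - l - s to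
  1 - s. The sign is the one for which the sum of the two preserves the pairing in
  \<open>raise\<close>; for l = 1 the starting points are s and -s, as in
  \<open>residue\<close>.\<close>

definition hook_coeff :: "nat \<Rightarrow> nat \<Rightarrow> int \<Rightarrow> int \<Rightarrow> complex" where
  "hook_coeff n l s a = delta_mod n s a + (- 1) ^ (l + 1) * delta_mod n (1 - int l - s) a"

lemma delta_mod_shift: "delta_mod n s (a + c) = delta_mod n (s - c) a"
  by (simp add: delta_mod_def algebra_simps)

lemma delta_mod_cong:
  assumes "2 * int n dvd s - s'"
  shows "delta_mod n s = delta_mod n s'"
proof
  fix a
  have "a - s' = (a - s) + (s - s')" by simp
  then have "2 * int n dvd a - s' \<longleftrightarrow> 2 * int n dvd a - s"
    using assms by (metis dvd_add_left_iff)
  then show "delta_mod n s a = delta_mod n s' a" by (simp add: delta_mod_def)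
qed

lemma delta_mod_mult:
  assumes "\<And>a t. g (a + 2 * int n * t) = g a"
  shows "g (a + c) * delta_mod n s a = g (s + c) * delta_mod n s a"
proof (cases "2 * int n dvd a - s")
  case True
  then obtain t where "a - s = 2 * int n * t" by (elim dvdE)
  then have "a + c = s + c + 2 * int n * t" by simp
  then show ?thesis using assms by metis
qed (simp add: delta_mod_def)

lemma hook_coeff_1:
  assumes "n \<ge> 1"
  obtains j c where "j \<le> n" "hook_coeff n 1 s = (\<lambda>a. c * of_int (residue n j a))"
proof -
  define m where "m = s mod (2 * int n)"
  have m: "0 \<le> m" "m < 2 * int n" "2 * int n dvd s - m" using assms by (auto simp: m_def)
  define j where "j = nat (if m \<le> int n then m else 2 * int n - m)"
  have j: "j \<le> n" using m by (auto simp: j_def)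
  have *: "2 * int n dvd s - int j \<or> 2 * int n dvd s + int j"
  proof (cases "m \<le> int n")
    case False
    have "s + (2 * int n - m) = (s - m) + 2 * int n" by simp
    then have "2 * int n dvd s + (2 * int n - m)" using m by (metis dvd_add dvd_refl)
    then show ?thesis using False m by (simp add: j_def)
  qed (use m in \<open>simp add: j_def\<close>)
  have "hook_coeff n 1 s a = delta_mod n (int j) a + delta_mod n (- int j) a" for a
    using *
  proof
    assume "2 * int n dvd s - int j"
    moreover have "- s - - int j = - (s - int j)" by simp
    ultimately have "2 * int n dvd s - int j" "2 * int n dvd - s - - int j" by (simp_all only: dvd_minus_iff)
    from delta_mod_cong[OF this(1)] delta_mod_cong[OF this(2)] show ?thesis by (simp add: hook_coeff_def)
  next
    assume "2 * int n dvd s + int j"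
    moreover have "s - - int j = s + int j" "- s - int j = - (s + int j)" by simp_all
    ultimately have "2 * int n dvd s - - int j" "2 * int n dvd - s - int j" by (simp_all only: dvd_minus_iff)
    from delta_mod_cong[OF this(1)] delta_mod_cong[OF this(2)] show ?thesis by (simp add: hook_coeff_def)
  qed
  \<comment> \<open>At the fixed residues 0 and n both deltas are the same function, hence the
    factor 2.\<close>
  moreover have "delta_mod n (int j) a + delta_mod n (- int j) a = (if j = 0 \<or> j = n then 2 else 1) * of_int (residue n j a)" for a
  proof (cases "j = 0 \<or> j = n")
    case True
    have "a + int n = (a - int n) + 2 * int n" by simp
    then have "2 * int n dvd a + int n \<longleftrightarrow> 2 * int n dvd a - int n" by (metis dvd_add_left_iff dvd_refl)
    then show ?thesis using True by (auto simp: delta_mod_def residue_def)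
  next
    case False
    have "\<not> (2 * int n dvd a - int j \<and> 2 * int n dvd a + int j)"
    proof
      assume "2 * int n dvd a - int j \<and> 2 * int n dvd a + int j"
      then have "2 * int n dvd (a + int j) - (a - int j)" by (meson dvd_diff)
      then have "2 * int n dvd 2 * int j" by simp
      then have "int n dvd int j" by simp
      then show False using False j by (auto dest: zdvd_imp_le)
    qed
    then show ?thesis using False by (auto simp: delta_mod_def residue_def)
  qed
  ultimately have "hook_coeff n 1 s = (\<lambda>a. (if j = 0 \<or> j = n then 2 else 1) * of_int (residue n j a))" by auto
  with j that show thesis by blast
qed

text \<open>A unit hop from s + l prolongs the hop s to s + l at its end. Its coefficient is even
  and periodic, so it may also be nonzero at s - 1 and prolong the hop at its beginning: the second
  term.\<close>

lemma hook_coeff_commutator: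
  fixes n l :: nat and s :: int
  defines "g \<equiv> hook_coeff n 1 (s + int l)"
  shows "(\<lambda>a. g (a + int l) * hook_coeff n l s a - g a * hook_coeff n l s (a + 1)) =
    (\<lambda>a. g (s + int l) * hook_coeff n (Suc l) s a + (- g (s - 1)) * hook_coeff n (Suc l) (s - 1) a)"
proof
  fix a
  have even: "g (- b) = g b" for b
  proof -
    have "- b - c = - (b + c)" for c :: int by simp
    then have "delta_mod n c (- b) = delta_mod n (- c) b" for c
      by (simp only: delta_mod_def dvd_minus_iff diff_minus_eq_add)
    then show ?thesis by (simp add: g_def hook_coeff_def add.commute)
  qed
  have period: "g (b + 2 * int n * t) = g b" for b t
    using delta_mod_cong[of n "c - 2 * int n * t" c for c]
    by (simp add: g_def hook_coeff_def delta_mod_shift)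
  note m = delta_mod_mult[of g n, OF period]
  have 1: "g (a + int l) * delta_mod n s a = g (s + int l) * delta_mod n s a" by (rule m)
  have 2: "g (a + int l) * delta_mod n (1 - int l - s) a = g (s - 1) * delta_mod n (1 - int l - s) a"
    using m[of a "int l" "1 - int l - s"] even[of "s - 1"] by simp
  have 3: "g a * delta_mod n (s - 1) a = g (s - 1) * delta_mod n (s - 1) a"
    using m[of a 0 "s - 1"] by simp
  have 4: "g a * delta_mod n (- int l - s) a = g (s + int l) * delta_mod n (- int l - s) a"
  proof -
    have "- int l - s = - (s + int l)" by simp
    then show ?thesis using m[of a 0 "- (s + int l)"] even[of "s + int l"] by (simp only: add_0_right)
  qed
  have "g (a + int l) * hook_coeff n l s a =
      g (a + int l) * delta_mod n s a + (- 1) ^ (l + 1) * (g (a + int l) * delta_mod n (1 - int l - s) a)"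
    by (simp add: hook_coeff_def algebra_simps)
  moreover have "g a * hook_coeff n l s (a + 1) =
      g a * delta_mod n (s - 1) a + (- 1) ^ (l + 1) * (g a * delta_mod n (- int l - s) a)"
    by (simp add: hook_coeff_def delta_mod_shift[of n _ a 1] distrib_left right_diff_distrib mult.left_commute)
  moreover have "hook_coeff n (Suc l) s a = delta_mod n s a - (- 1) ^ (l + 1) * delta_mod n (- int l - s) a"
    "hook_coeff n (Suc l) (s - 1) a = delta_mod n (s - 1) a - (- 1) ^ (l + 1) * delta_mod n (1 - int l - s) a"
  proof -
    have "1 - int (Suc l) - (s - 1) = 1 - int l - s" "1 - int (Suc l) - s = - int l - s" by simp_all
    then show "hook_coeff n (Suc l) s a = delta_mod n s a - (- 1) ^ (l + 1) * delta_mod n (- int l - s) a"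
      "hook_coeff n (Suc l) (s - 1) a = delta_mod n (s - 1) a - (- 1) ^ (l + 1) * delta_mod n (1 - int l - s) a"
      by (simp_all only: hook_coeff_def) simp_all
  qed
  ultimately show "g (a + int l) * hook_coeff n l s a - g a * hook_coeff n l s (a + 1) =
    g (s + int l) * hook_coeff n (Suc l) s a + (- g (s - 1)) * hook_coeff n (Suc l) (s - 1) a"
    unfolding 1 2 3 4 by (simp add: algebra_simps)
qed

text \<open>Commutators give c H_s - d H_(s-1), where H_s is the coefficient of length l + 1. If 2 n
  does not divide l + 1, then d = 0 or H_(s-1) = - H_s, and H_s can be solved for. If it does, only
  multiples of H_s - H_(s-1) appear, and the family is recovered from H_0 = - H_1.\<close>

lemma hook_coeff_word_hops:
  assumes "n \<ge> 1" "l \<ge> 1"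
  shows "hook_coeff n l s \<in> word_hops n i l"
  using assms(2)
proof (induction l arbitrary: s rule: nat_induct_at_least)
  case base
  obtain j c where "j \<le> n" "hook_coeff n 1 s = (\<lambda>a. c * of_int (residue n j a))"
    using hook_coeff_1[OF assms(1)] .
  then show ?case using word_hops_scale[OF word_hops_f] by metis
next
  case (Suc l)
  let ?H = "hook_coeff n (Suc l)"
  define c where "c s = hook_coeff n 1 (s + int l) (s + int l)" for s
  define d where "d s = hook_coeff n 1 (s + int l) (s - 1)" for s
  have base: "hook_coeff n 1 s \<in> word_hops n i 1" for s
  proof -
    obtain j c where "j \<le> n" "hook_coeff n 1 s = (\<lambda>a. c * of_int (residue n j a))"
      using hook_coeff_1[OF assms(1)] .
    then show ?thesis using word_hops_scale[OF word_hops_f] by metis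
  qed
  have mem: "(\<lambda>a. c s * ?H s a + (- d s) * ?H (s - 1) a) \<in> word_hops n i (Suc l)" for s
    using word_hops_commutator[OF base Suc.IH Suc.hyps, of "s + int l" s]
    unfolding hook_coeff_commutator c_def d_def .
  have c: "c s = 1 + of_bool (2 * int n dvd 2 * s + 2 * int l)" for s
    by (simp add: c_def hook_coeff_def delta_mod_def algebra_simps)
  have d: "d s = of_bool (2 * int n dvd int l + 1) + of_bool (2 * int n dvd 2 * s + int l - 1)" for s
  proof -
    have "s - 1 - (s + int l) = - (int l + 1)" "s - 1 - (1 - int 1 - (s + int l)) = 2 * s + int l - 1" by simp_all
    then show ?thesis by (simp only: d_def hook_coeff_def delta_mod_def dvd_minus_iff) simp
  qed
  \<comment> \<open>Divisibility by an even number fixes the parity of l, hence the sign in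
    \<open>?H\<close>.\<close>
  have odd: "odd l" if "2 * int n dvd 2 * t + int l - 1 \<or> 2 * int n dvd int l + 1" for t
  proof -
    have "2 dvd 2 * t + int l - 1 \<or> 2 dvd int l + 1" using that by (meson dvd_trans dvd_triv_left)
    then have "even (int l + 1)" by presburger
    then show ?thesis by simp
  qed
  have scaleD: "?H s \<in> word_hops n i (Suc l)" if "(\<lambda>a. k * ?H s a) \<in> word_hops n i (Suc l)" "k \<noteq> 0" for k s
    using word_hops_scale[OF that(1), of "inverse k"] that(2) by (simp flip: mult.assoc)
  show ?case
  proof (cases "2 * int n dvd int l + 1")
    case False
    show ?thesis
    proof (cases "2 * int n dvd 2 * s + int l - 1")
      \<comment> \<open>The hop from s - 1 is the mirror image of the hop from s with sign -1, so
        the two terms add up instead of cancelling.\<close>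
      case True
      have "odd l" using odd True by blast
      have "s - 1 - (- int l - s) = 2 * s + int l - 1" "1 - int l - s - s = - (2 * s + int l - 1)" by simp_all
      then have "delta_mod n (s - 1) = delta_mod n (- int l - s)" "delta_mod n (1 - int l - s) = delta_mod n s"
        using True by (auto intro!: delta_mod_cong simp only: dvd_minus_iff)
      then have "?H (s - 1) a = - ?H s a" for a
        using \<open>odd l\<close> by (simp add: hook_coeff_def algebra_simps)
      then have "(\<lambda>a. (c s + 1) * ?H s a) \<in> word_hops n i (Suc l)"
        using mem[of s] True False by (simp add: d algebra_simps)
      moreover have "c s + 1 \<noteq> 0" by (simp add: c)
      ultimately show ?thesis by (rule scaleD)
    next
      case nd: False
      then have "(\<lambda>a. c s * ?H s a) \<in> word_hops n i (Suc l)" using mem[of s] False by (simp add: d)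
      moreover have "c s \<noteq> 0" by (simp add: c)
      ultimately show ?thesis by (rule scaleD)
    qed
  next
    case True
    have "odd l" using odd True by blast
    have cd: "c s = d s" "c s \<noteq> 0" for s
    proof -
      have "2 * s + 2 * int l = (2 * s + int l - 1) + (int l + 1)" by simp
      then have "2 * int n dvd 2 * s + 2 * int l \<longleftrightarrow> 2 * int n dvd 2 * s + int l - 1"
        using True by (metis dvd_add_left_iff)
      then show "c s = d s" using True by (simp add: c d)
    qed (simp add: c)
    have diff: "(\<lambda>a. ?H s a - ?H (s - 1) a) \<in> word_hops n i (Suc l)" for s
      using word_hops_scale[OF mem[of s], of "inverse (c s)"] cd[of s]
      by (simp add: distrib_left right_diff_distrib flip: mult.assoc)
    \<comment> \<open>The hops from 0 and 1 are mirror images with opposite sign, so their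
      difference is twice a single coefficient; it anchors the induction over s in both
      directions.\<close>
    have H1: "?H 1 \<in> word_hops n i (Suc l)"
    proof -
      have "- int l - 0 - 1 = - (int l + 1)" "- int l - 1 - 0 = - (int l + 1)" by simp_all
      then have "delta_mod n (- int l - 0) = delta_mod n 1" "delta_mod n (- int l - 1) = delta_mod n 0"
        using True by (auto intro!: delta_mod_cong simp only: dvd_minus_iff)
      then have "?H 0 a = - ?H 1 a" for a using \<open>odd l\<close> by (simp add: hook_coeff_def)
      then have "(\<lambda>a. 2 * ?H 1 a) \<in> word_hops n i (Suc l)" using diff[of 1] by simp
      then show ?thesis by (rule scaleD) simp
    qed
    show ?thesis
    proof (induction s rule: int_induct[where k = 1])
      case base
      show ?case by (rule H1)
    next
      case (step1 s)
      from word_hops_add[OF step1(2) diff[of "s + 1"]] show ?case by simp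
    next
      case (step2 s)
      have "(\<lambda>a. ?H s a + - 1 * (?H s a - ?H (s - 1) a)) \<in> word_hops n i (Suc l)"
        by (intro word_hops_add word_hops_scale step2 diff)
      then show ?case by simp
    qed
  qed
qed

subsection \<open>Hook vectors\<close>

text \<open>The innermost hook acts first, so that induction peels off the outermost hop.\<close>

primrec hook_vec :: "nat \<Rightarrow> nat \<Rightarrow> (int \<times> int) list \<Rightarrow> fock" where
  "hook_vec n i [] = vacuum i"
| "hook_vec n i (h # hs) = hop (snd h - fst h) (hook_coeff n (nat (snd h - fst h)) (fst h)) (hook_vec n i hs)"

definition hook_set :: "nat \<Rightarrow> (int \<times> int) list \<Rightarrow> int set" where
  "hook_set i hs = ({..int i} - fst ` set hs) \<union> snd ` set hs"

definition holes :: "nat \<Rightarrow> int set \<Rightarrow> int set" where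
  "holes i S = {a. a \<notin> S \<and> a \<le> int i}"

definition particles :: "nat \<Rightarrow> int set \<Rightarrow> int set" where
  "particles i S = {p. p \<in> S \<and> int i < p}"

lemma hook_vec_word_space:
  assumes "good_list n i hs" "n \<ge> 1"
  shows "hook_vec n i hs \<in> word_space n i (hooks_size hs)"
  using assms(1)
proof (induction hs)
  case Nil
  show ?case using word_space_word[of "[]" 0 n i] by simp
next
  case (Cons h hs)
  obtain a p where h: "h = (a, p)" by (cases h)
  have g: "good_list n i hs" "a < p" using Cons.prems by (auto simp: h good_list_Cons)
  have "hook_coeff n (nat (p - a)) a \<in> word_hops n i (nat (p - a))"
    using g assms(2) by (intro hook_coeff_word_hops) auto
  then have "hop (int (nat (p - a))) (hook_coeff n (nat (p - a)) a) (hook_vec n i hs) \<in> word_space n i (hooks_size hs + nat (p - a))"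
    using Cons.IH g by (simp add: word_hops_def)
  moreover have "hooks_size (h # hs) = hooks_size hs + nat (p - a)"
    using hooks_size_Cons[of n i a p hs] Cons.prems h by simp
  ultimately show ?case using g h by simp
qed

lemma finite_holes: "maya S \<Longrightarrow> finite (holes i S)"
  unfolding holes_def by (rule maya_finite_below)

lemma finite_particles: "maya S \<Longrightarrow> finite (particles i S)"
  unfolding particles_def using maya_finite_above[of S "int i"] by simp

text \<open>One hop creates at most one hole. The number of holes is therefore the first criterion
  of the triangular order.\<close>

lemma card_holes_hook_vec:
  assumes "good_list n i hs" "hook_vec n i hs S \<noteq> 0"
  shows "card (holes i S) \<le> length hs"
  using assms
proof (induction hs arbitrary: S)
  case Nil
  then have "holes i S = {}" by (auto simp: vacuum_def holes_def vacuum_set_def split: if_splits)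
  then show ?case by simp
next
  case (Cons h hs)
  obtain a p where h: "h = (a, p)" by (cases h)
  have g: "good_list n i hs" "a < p" using Cons.prems by (auto simp: h good_list_Cons)
  obtain b where b: "maya S" "b \<notin> S" "b + (p - a) \<in> S" "hook_vec n i hs (insert b (S - {b + (p - a)})) \<noteq> 0"
    using Cons.prems(2) g(2) by (auto simp: h elim: hop_nonzeroE)
  have "card (holes i S) \<le> card (insert b (holes i (insert b (S - {b + (p - a)}))))"
  proof (rule card_mono)
    show "finite (insert b (holes i (insert b (S - {b + (p - a)}))))" using b(1) by (simp add: finite_holes)
  qed (auto simp: holes_def)
  also have "\<dots> \<le> Suc (card (holes i (insert b (S - {b + (p - a)}))))"
    using b(1) by (simp add: card_insert_if finite_holes)
  also have "\<dots> \<le> Suc (length hs)" using Cons.IH[OF g(1) b(4)] by simp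
  finally show ?case by simp
qed

lemma good_list_bounds:
  assumes "good_list n i hs"
  shows "fst ` set hs \<subseteq> {..int i}" "snd ` set hs \<subseteq> {int i<..}"
  using assms by (auto simp: good_list_def)

lemma holes_hook_set:
  assumes "good_list n i hs"
  shows "holes i (hook_set i hs) = fst ` set hs"
proof -
  define A where "A = fst ` set hs"
  define P where "P = snd ` set hs"
  have "\<forall>a\<in>A. a \<le> int i" "\<forall>p\<in>P. int i < p" using good_list_bounds[OF assms] by (auto simp: A_def P_def)
  then show ?thesis unfolding hook_set_def holes_def A_def[symmetric] P_def[symmetric] by force
qed

lemma particles_hook_set:
  assumes "good_list n i hs"
  shows "particles i (hook_set i hs) = snd ` set hs"
proof -
  define A where "A = fst ` set hs"
  define P where "P = snd ` set hs"
  have "\<forall>a\<in>A. a \<le> int i" "\<forall>p\<in>P. int i < p" using good_list_bounds[OF assms] by (auto simp: A_def P_def)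
  then show ?thesis unfolding hook_set_def particles_def A_def[symmetric] P_def[symmetric] by auto
qed

lemma good_list_inj:
  assumes "good_list n i hs"
  shows "inj_on fst (set hs)" "inj_on snd (set hs)"
  using assms by (induction hs) (auto simp: good_list_Cons)

lemma card_holes_hook_set:
  assumes "good_list n i hs"
  shows "card (holes i (hook_set i hs)) = length hs" "card (particles i (hook_set i hs)) = length hs"
  using assms good_list_inj[OF assms] good_list_distinct[OF assms]
  by (simp_all add: holes_hook_set particles_hook_set card_image distinct_card)

lemma maya_hook_set: "maya (hook_set i hs)"
proof -
  have "finite A \<Longrightarrow> maya (S - A) \<longleftrightarrow> maya S" for A S
  proof (induction A rule: finite_induct)
    case (insert a A)
    have "S - insert a A = S - A - {a}" by auto
    then show ?case using insert by simp
  qed simp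
  moreover have "finite A \<Longrightarrow> maya (S \<union> A) \<longleftrightarrow> maya S" for A S
    by (induction A rule: finite_induct) auto
  ultimately show ?thesis using maya_vacuum[of i] by (simp add: hook_set_def vacuum_set_def)
qed

lemma hook_set_Cons:
  assumes "good_list n i ((a, p) # hs)"
  shows "insert a (hook_set i ((a, p) # hs) - {p}) = hook_set i hs"
proof -
  have "a \<notin> fst ` set hs" "p \<notin> snd ` set hs" "a \<le> int i" "int i < p"
    using assms by (auto simp: good_list_Cons)
  moreover have "a \<notin> snd ` set hs" using assms by (force simp: good_list_Cons good_list_def)
  ultimately show ?thesis by (auto simp: hook_set_def)
qed

text \<open>The target has one hole too many for the shorter list, so undoing the hop has to remove
  a hole: it fills a hole b by a particle b + l above i, and all of these lie within the outermost
  hook.\<close>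

lemma hop_into_hook_set:
  assumes "good_list n i ((a', p') # t')" "S = hook_set i ((a', p') # t')"
    "b \<notin> S" "b + l \<in> S" "0 < l" "card (holes i (insert b (S - {b + l}))) \<le> length t'"
  shows "a' \<le> b" "b + l \<le> p'"
proof -
  have S: "maya S" "card (holes i S) = Suc (length t')" "holes i S = fst ` set ((a', p') # t')"
    "particles i S = snd ` set ((a', p') # t')"
    using assms(2) maya_hook_set card_holes_hook_set[OF assms(1)] holes_hook_set[OF assms(1)]
      particles_hook_set[OF assms(1)] by auto
  have fin: "finite (holes i S)" using finite_holes[OF S(1)] .
  have *: "b \<in> holes i S \<and> b + l \<in> particles i S"
  proof (rule ccontr)
    assume n: "\<not> (b \<in> holes i S \<and> b + l \<in> particles i S)"
    have "Suc (length t') \<le> card (holes i (insert b (S - {b + l})))"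
    proof (cases "b \<le> int i")
      case True
      then have bl: "b + l \<le> int i" using n assms by (auto simp: holes_def particles_def)
      have "holes i (insert b (S - {b + l})) = insert (b + l) (holes i S - {b})"
        using assms(4,5) bl by (auto simp: holes_def)
      moreover have "b \<in> holes i S" "b + l \<notin> holes i S" using True assms by (auto simp: holes_def)
      ultimately have "card (holes i (insert b (S - {b + l}))) = Suc (card (holes i S) - 1)"
        using fin assms(5) by (simp add: card_Diff_singleton)
      then show ?thesis using S by simp
    next
      case False
      then have "holes i S \<subseteq> holes i (insert b (S - {b + l}))" by (auto simp: holes_def)
      then have "card (holes i S) \<le> card (holes i (insert b (S - {b + l})))"
        using S(1) by (intro card_mono finite_holes) auto
      then show ?thesis using S by simp
    qed
    then show False using assms(6) by simp
  qed
  have "\<forall>x\<in>fst ` set ((a', p') # t'). a' \<le> x" "\<forall>x\<in>snd ` set ((a', p') # t'). x \<le> p'"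
    using assms(1) by (auto simp: good_list_Cons)
  then show "a' \<le> b" "b + l \<le> p'" using * S by blast+
qed

text \<open>Good sums a + p lie in an interval of width 2 n, so distinct starting points of hooks of
  equal length are never congruent modulo 2 n. A mirror congruence forces both sums to the same end,
  1 or 2 n + 1, where the hop is its own mirror image.\<close>

lemma hook_coeff_good:
  assumes "hook_coeff n (nat l) a a' \<noteq> 0" "0 < l" "n \<ge> 1"
    "1 \<le> 2 * a + l" "2 * a + l \<le> 2 * int n + 1" "1 \<le> 2 * a' + l" "2 * a' + l \<le> 2 * int n + 1"
  shows "a' = a"
proof -
  have "2 * int n dvd a' - a \<or> 2 * int n dvd a' - (1 - l - a)"
    using assms(1,2) by (auto simp: hook_coeff_def delta_mod_def split: if_splits)
  then show ?thesis
  proof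
    assume "2 * int n dvd a' - a"
    then show ?thesis using dvd_imp_le_int[of "a' - a" "2 * int n"] assms by (cases "a' - a = 0") auto
  next
    assume "2 * int n dvd a' - (1 - l - a)"
    then obtain t where t: "a' - (1 - l - a) = 2 * int n * t" by (elim dvdE)
    have "0 \<le> 2 * int n * t" "2 * int n * t \<le> 2 * int n * 1" using t assms by linarith+
    then have "0 \<le> t" "t \<le> 1" using assms(3) by (auto simp: zero_le_mult_iff mult_le_cancel_left)
    then have "t = 0 \<or> t = 1" by auto
    then show ?thesis using t assms by auto
  qed
qed

definition hook_lengths :: "(int \<times> int) list \<Rightarrow> int list" where
  "hook_lengths hs = map (\<lambda>(a, p). p - a) hs"

text \<open>The last hop fits inside the outermost hook of the target. Either that hook is longer,
  or the two coincide and the comparison passes to the tails; goodness excludes the mirror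
  position.\<close>

lemma hook_vec_off_diagonal:
  assumes "good_list n i hs" "good_list n i hs'" "length hs' = length hs" "n \<ge> 1"
    "hook_vec n i hs (hook_set i hs') \<noteq> 0"
  shows "hs' = hs \<or> (hook_lengths hs, hook_lengths hs') \<in> lexord {(x, y). x < y}"
  using assms(1,2,3,5)
proof (induction hs arbitrary: hs')
  case (Cons h t)
  obtain a p where h: "h = (a, p)" by (cases h)
  obtain a' p' t' where hs': "hs' = (a', p') # t'" using Cons.prems(3) by (cases hs') auto
  have g: "good_list n i t" "good_list n i t'" "a < p" "a' < p'" "1 \<le> a + p" "a + p \<le> 2 * int n + 1"
    "1 \<le> a' + p'" "a' + p' \<le> 2 * int n + 1"
    using Cons.prems by (auto simp: h hs' good_list_Cons)
  let ?S = "hook_set i hs'" and ?l = "p - a"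
  obtain b where b: "b \<notin> ?S" "b + ?l \<in> ?S" "hook_coeff n (nat ?l) a b \<noteq> 0"
      "hook_vec n i t (insert b (?S - {b + ?l})) \<noteq> 0"
    using Cons.prems(4) g(3) by (auto simp: h elim: hop_nonzeroE)
  have "a' \<le> b" "b + ?l \<le> p'"
    using hop_into_hook_set[of n i a' p' t' ?S b ?l] Cons.prems b g card_holes_hook_vec[OF g(1) b(4)] hs'
    by auto
  then consider "?l < p' - a'" | "b = a'" "?l = p' - a'" by linarith
  then show ?case
  proof cases
    case 1
    then show ?thesis by (simp add: hook_lengths_def h hs')
  next
    case 2
    have "a' = a" using hook_coeff_good[of n ?l a a'] b(3) 2 g assms(4) by auto
    moreover have "insert b (?S - {b + ?l}) = hook_set i t'"
      using hook_set_Cons[of n i a' p' t'] Cons.prems 2 hs' by simp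
    then have "t' = t \<or> (hook_lengths t, hook_lengths t') \<in> lexord {(x, y). x < y}"
      using Cons.IH[OF g(1,2)] b(4) Cons.prems hs' by simp
    ultimately show ?thesis using 2 by (auto simp: hook_lengths_def h hs')
  qed
qed simp

lemma hook_vec_diagonal:
  assumes "good_list n i hs" "n \<ge> 1"
  shows "hook_vec n i hs (hook_set i hs) \<noteq> 0"
  using assms(1)
proof (induction hs)
  case Nil
  show ?case by (simp add: hook_set_def vacuum_def vacuum_set_def)
next
  case (Cons h t)
  obtain a p where h: "h = (a, p)" by (cases h)
  have g: "good_list n i t" "a < p" "a \<le> int i" "int i < p" using Cons.prems by (auto simp: h good_list_Cons)
  let ?S = "hook_set i (h # t)" and ?l = "p - a"
  let ?f = "\<lambda>b. hook_coeff n (nat ?l) a b * cre (b + ?l) (ann b (hook_vec n i t)) ?S"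
  have S: "maya ?S" by (rule maya_hook_set)
  have ap: "a \<notin> ?S" "p \<in> ?S"
    using g Cons.prems holes_hook_set[OF Cons.prems] by (auto simp: h holes_def hook_set_def)
  have "?f b = 0" if "b \<in> {b. b \<notin> ?S \<and> b + ?l \<in> ?S} - {a}" for b
  proof (rule ccontr)
    assume "?f b \<noteq> 0"
    then have "hook_vec n i t (insert b (?S - {b + ?l})) \<noteq> 0"
      using g(2) by (auto simp: cre_ann_apply split: if_splits)
    from card_holes_hook_vec[OF g(1) this] have "a \<le> b" "b + ?l \<le> p"
      using hop_into_hook_set[of n i a p t ?S b ?l] Cons.prems that g h by auto
    then show False using that by auto
  qed
  then have "hook_vec n i (h # t) ?S = (\<Sum>b\<in>{a}. ?f b)"
    unfolding hook_vec.simps hop_def h fst_conv snd_conv using finite_hop[OF S, of ?l] ap h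
    by (intro sum.mono_neutral_right) auto
  moreover have "hook_coeff n (nat ?l) a a \<noteq> 0"
  proof (cases "2 * int n dvd a - (1 - ?l - a)")
    \<comment> \<open>If the hop is its own mirror image modulo 2 n, its length is odd and the two
      deltas add up to 2 instead of cancelling.\<close>
    case True
    then obtain k where "a - (1 - ?l - a) = 2 * int n * k" by (elim dvdE)
    then have "?l = 2 * (int n * k - a) + 1" by (simp add: algebra_simps)
    moreover have "odd (2 * (int n * k - a) + 1)" by simp
    ultimately have "odd ?l" by (simp only: not_False_eq_True)
    then have "odd (nat ?l)" using g by (simp add: even_nat_iff)
    then show ?thesis using True g by (simp add: hook_coeff_def delta_mod_def)
  qed (use g in \<open>simp add: hook_coeff_def delta_mod_def\<close>)
  moreover have "cre (a + ?l) (ann a (hook_vec n i t)) ?S \<noteq> 0"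
    using S ap g Cons hook_set_Cons[of n i a p t] by (auto simp: cre_ann_apply h)
  ultimately show ?case by simp
qed

text \<open>Back substitution along a partial order: at a maximal index only the diagonal entry of
  its equation survives.\<close>

lemma triangular_system:
  fixes M :: "'a \<Rightarrow> 'a \<Rightarrow> complex"
  assumes "finite I" "transp r" "irreflp r" "\<And>x. x \<in> I \<Longrightarrow> M x x \<noteq> 0"
    "\<And>x y. x \<in> I \<Longrightarrow> y \<in> I \<Longrightarrow> M x y \<noteq> 0 \<Longrightarrow> y = x \<or> r y x"
  shows "\<exists>t. \<forall>y\<in>I. (\<Sum>x\<in>I. t x * M x y) = b y"
    and "(\<And>y. y \<in> I \<Longrightarrow> (\<Sum>x\<in>I. t x * M x y) = 0) \<Longrightarrow> x \<in> I \<Longrightarrow> t x = 0"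
proof -
  have max: "\<exists>m\<in>A. \<forall>x\<in>A. \<not> r m x" if "finite A" "A \<noteq> {}" for A
  proof -
    have "asymp r" using assms(2,3) by (auto intro!: asympI dest: transpD irreflpD)
    then have "asymp_on A r" "transp_on A r"
      using assms(2) by (auto intro: asymp_on_subset transp_on_subset)
    from Finite_Set.bex_max_element[OF that(1) this that(2)] show ?thesis
      using assms(3) by (metis irreflpD)
  qed
  show "\<exists>t. \<forall>y\<in>I. (\<Sum>x\<in>I. t x * M x y) = b y"
    using assms(1,4,5)
  proof (induction "card I" arbitrary: I b)
    case (Suc k)
    then obtain m where m: "m \<in> I" "\<And>x. x \<in> I \<Longrightarrow> \<not> r m x"
      using max[of I] by (metis card.empty nat.distinct(1))
    define c where "c = b m / M m m"
    have "\<exists>t. \<forall>y\<in>I - {m}. (\<Sum>x\<in>I - {m}. t x * M x y) = b y - c * M m y"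
      using Suc.hyps(2) Suc.prems m by (intro Suc.hyps(1)) auto
    then obtain t where t: "\<And>y. y \<in> I - {m} \<Longrightarrow> (\<Sum>x\<in>I - {m}. t x * M x y) = b y - c * M m y" by blast
    have "(\<Sum>x\<in>I. (t(m := c)) x * M x y) = b y" if "y \<in> I" for y
    proof -
      have "(\<Sum>x\<in>I. (t(m := c)) x * M x y) = c * M m y + (\<Sum>x\<in>I - {m}. t x * M x y)"
        using m Suc.prems(1) by (simp add: sum.remove)
      also have "\<dots> = b y"
      proof (cases "y = m")
        case True
        have "M x m = 0" if "x \<in> I - {m}" for x using Suc.prems(3)[of x m] that m by auto
        then show ?thesis using True Suc.prems(2) m by (simp add: c_def)
      qed (use t that in simp)
      finally show ?thesis .
    qed
    then show ?case by blast
  qed simp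
  show "t x = 0" if eq: "\<And>y. y \<in> I \<Longrightarrow> (\<Sum>x\<in>I. t x * M x y) = 0" and x: "x \<in> I" for t x
  proof (rule ccontr)
    assume "t x \<noteq> 0"
    then obtain m where m: "m \<in> I" "t m \<noteq> 0" "\<And>x. x \<in> I \<Longrightarrow> t x \<noteq> 0 \<Longrightarrow> \<not> r m x"
      using max[of "{x\<in>I. t x \<noteq> 0}"] x assms(1) by auto
    have "(\<Sum>x\<in>I. t x * M x m) = t m * M m m + (\<Sum>x\<in>I - {m}. t x * M x m)"
      using m assms(1) by (simp add: sum.remove)
    also have "(\<Sum>x\<in>I - {m}. t x * M x m) = 0"
    proof (intro sum.neutral ballI)
      fix x assume "x \<in> I - {m}"
      then show "t x * M x m = 0" using assms(5)[of x m] m by auto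
    qed
    finally show False using eq[OF m(1)] m assms(4) by simp
  qed
qed

definition good_lists :: "nat \<Rightarrow> nat \<Rightarrow> nat \<Rightarrow> (int \<times> int) list set" where
  "good_lists n i N = {hs. good_list n i hs \<and> hooks_size hs = N}"

lemma finite_good_lists: "finite (good_lists n i N)"
proof (rule finite_subset)
  show "good_lists n i N \<subseteq> good_box n i N N"
    using hook_le_hooks_size[of n i] by (fastforce simp: good_lists_def good_box_def)
qed (rule finite_good_box)

lemma hook_vec_triangular:
  assumes "n \<ge> 1"
  shows "\<exists>t. \<forall>hs'\<in>good_lists n i N. (\<Sum>hs\<in>good_lists n i N. t hs * hook_vec n i hs (hook_set i hs')) = b hs'"
    and "(\<And>hs'. hs' \<in> good_lists n i N \<Longrightarrow>
        (\<Sum>hs\<in>good_lists n i N. t hs * hook_vec n i hs (hook_set i hs')) = 0) \<Longrightarrow>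
      hs \<in> good_lists n i N \<Longrightarrow> t hs = 0"
proof -
  \<comment> \<open>\<open>r hs' hs\<close> means that hs' has fewer hooks, or equally many with
    lexicographically larger lengths.\<close>
  define r :: "(int \<times> int) list \<Rightarrow> (int \<times> int) list \<Rightarrow> bool" where
    "r = (\<lambda>hs' hs. length hs' < length hs \<or>
      length hs' = length hs \<and> (hook_lengths hs, hook_lengths hs') \<in> lexord {(x, y). x < y})"
  have "Relation.trans (lexord {(x :: int, y). x < y})" by (intro lexord_transI) (auto intro: transI)
  then have "transp r" by (intro transpI) (auto simp: r_def dest: transD)
  moreover have "irreflp r" by (intro irreflpI) (auto simp: r_def lexord_irreflexive)
  moreover have "hs' = hs \<or> r hs' hs"
    if "hs \<in> good_lists n i N" "hs' \<in> good_lists n i N" "hook_vec n i hs (hook_set i hs') \<noteq> 0" for hs hs'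
    using that card_holes_hook_vec[of n i hs "hook_set i hs'"] card_holes_hook_set[of n i hs']
      hook_vec_off_diagonal[of n i hs hs'] assms
    by (auto simp: r_def good_lists_def)
  moreover have "hook_vec n i hs (hook_set i hs) \<noteq> 0" if "hs \<in> good_lists n i N" for hs
    using that hook_vec_diagonal assms by (simp add: good_lists_def)
  ultimately show "\<exists>t. \<forall>hs'\<in>good_lists n i N. (\<Sum>hs\<in>good_lists n i N. t hs * hook_vec n i hs (hook_set i hs')) = b hs'"
    "(\<And>hs'. hs' \<in> good_lists n i N \<Longrightarrow>
        (\<Sum>hs\<in>good_lists n i N. t hs * hook_vec n i hs (hook_set i hs')) = 0) \<Longrightarrow>
      hs \<in> good_lists n i N \<Longrightarrow> t hs = 0"
    using triangular_system(1)[OF finite_good_lists[of n i N], of r "\<lambda>hs hs'. hook_vec n i hs (hook_set i hs')" b]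
      triangular_system(2)[OF finite_good_lists[of n i N], of r "\<lambda>hs hs'. hook_vec n i hs (hook_set i hs')" t hs]
    by auto
qed

subsection \<open>The commuting raising operator\<close>

text \<open>The bivector of the invariant symplectic form; r >= 1 selects each pair of sites once.
  Only pairs occupied in S contribute, which makes the sum finite on Maya sets.\<close>

definition raise :: "fock \<Rightarrow> fock" where
  "raise x = (\<lambda>S. \<Sum>r | 1 \<le> r \<and> r \<in> S \<and> 1 - r \<in> S. (- 1) ^ nat r * cre r (cre (1 - r) x) S)"

lemma raise_window:
  assumes "window M S" "M \<le> R"
  shows "raise x S = (\<Sum>r=1..R. (- 1) ^ nat r * cre r (cre (1 - r) x) S)"
  unfolding raise_def
proof (rule sum.mono_neutral_left)
  show "{r. 1 \<le> r \<and> r \<in> S \<and> 1 - r \<in> S} \<subseteq> {1..R}" using window_in[OF assms(1)] assms(2) by force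
qed (auto simp: cre_def)

lemma raise_add: "raise (x + y) = raise x + raise y"
  and raise_fscale: "raise (fscale c x) = fscale c (raise x)"
proof -
  have "cre r (cre s (x + y)) S = cre r (cre s x) S + cre r (cre s y) S"
    and scale: "cre r (cre s (fscale c x)) S = c * cre r (cre s x) S" for r s S
    by (auto simp: cre_def fscale_def algebra_simps plus_fun_apply)
  then show "raise (x + y) = raise x + raise y"
    by (auto simp: raise_def fun_simps algebra_simps sum.distrib)
  show "raise (fscale c x) = fscale c (raise x)"
    unfolding raise_def scale by (auto simp: fscale_def fun_simps algebra_simps sum_distrib_left)
qed

text \<open>The partner 1 - r is at most 0, hence already occupied in the vacuum.\<close>

lemma raise_vacuum: "raise (vacuum i) = 0"
proof
  fix S
  have "cre r (cre (1 - r) (vacuum i)) S = 0" if "1 \<le> r" for r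
  proof -
    have "1 - r \<in> vacuum_set i" using that by (simp add: vacuum_set_def)
    then have "S - {r} - {1 - r} \<noteq> vacuum_set i" by blast
    then show ?thesis by (simp add: cre_def vacuum_def)
  qed
  then show "raise (vacuum i) S = 0 S" by (simp add: raise_def zero_fun_apply)
qed

lemma raise_not_maya: "\<not> maya S \<Longrightarrow> raise x S = 0"
  by (simp add: raise_def cre_def)

text \<open>A particle pair at r + 1 and 1 - r arises from the pair r with coefficient g r, by
  moving its upper member, and from the pair r + 1 with coefficient g (-r), by moving its lower
  member. The alternating signs and the evenness of g cancel the two.\<close>

lemma raise_hop:
  assumes "supp_maya x" "\<And>a. g (- a) = g a"
  shows "raise (hop 1 g x) = hop 1 g (raise x)"
proof
  fix S
  show "raise (hop 1 g x) S = hop 1 g (raise x) S"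
  proof (cases "maya S")
    case True
    then obtain M where M: "window M S" by (auto simp: maya_def)
    define R where "R = max (M + 2) 1"
    let ?A = "{-R..R}"
    let ?e = "\<lambda>r::int. (- 1) ^ nat r :: complex"
    have 1: "cre p (ann a (cre r (cre s x))) =
        (if a = r then cre p (cre s x) else 0) + (if a = s then cre r (cre p x) else 0) + cre r (cre s (cre p (ann a x)))"
      for p a r s
    proof -
      have c: "cre p (ann a (cre r y)) = (if a = r then cre p y else 0) + cre r (cre p (ann a y))" if "supp_maya y" for r y
        using that by (simp add: ann_cre cre_diff cre_cre[of p r])
      have "cre p (ann a (cre r (cre s x))) = (if a = r then cre p (cre s x) else 0) + cre r (cre p (ann a (cre s x)))"
        by (rule c) simp
      also have "cre p (ann a (cre s x)) = (if a = s then cre p x else 0) + cre s (cre p (ann a x))"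
        by (rule c) (rule assms(1))
      finally show ?thesis by (simp add: cre_add)
    qed
    have "hop 1 g (raise x) S = hop_on ?A 1 g (raise x) S"
      using M by (intro hop_eq_hop_on) (auto simp: R_def)
    also have "\<dots> = hop_on ?A 1 g (\<lambda>S. \<Sum>r=1..R. ?e r * cre r (cre (1 - r) x) S) S"
      by (rule hop_on_cong[OF M]) (auto intro!: raise_window simp: R_def)
    also have "\<dots> = (\<Sum>a\<in>?A. \<Sum>r=1..R. g a * ?e r * cre (a + 1) (ann a (cre r (cre (1 - r) x))) S)"
      by (simp add: hop_on_def ann_sum cre_sum sum_distrib_left mult_ac)
    also have "\<dots> = (\<Sum>a\<in>?A. \<Sum>r=1..R. if a = r then g a * ?e r * cre (a + 1) (cre (1 - r) x) S else 0)
       + (\<Sum>a\<in>?A. \<Sum>r=1..R. if a = 1 - r then g a * ?e r * cre r (cre (a + 1) x) S else 0)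
       + (\<Sum>a\<in>?A. \<Sum>r=1..R. g a * ?e r * cre r (cre (1 - r) (cre (a + 1) (ann a x))) S)"
      unfolding 1 sum.distrib[symmetric]
      by (intro sum.cong HOL.refl) (auto simp: fun_simps algebra_simps)
    also have "(\<Sum>a\<in>?A. \<Sum>r=1..R. g a * ?e r * cre r (cre (1 - r) (cre (a + 1) (ann a x))) S) = raise (hop 1 g x) S"
    proof -
      have "raise (hop 1 g x) S = (\<Sum>r=1..R. ?e r * cre r (cre (1 - r) (hop 1 g x)) S)"
        using M by (intro raise_window) (auto simp: R_def)
      also have "\<dots> = (\<Sum>r=1..R. ?e r * cre r (cre (1 - r) (hop_on ?A 1 g x)) S)"
      proof (intro sum.cong HOL.refl)
        fix r assume r: "r \<in> {1..R}"
        show "?e r * cre r (cre (1 - r) (hop 1 g x)) S = ?e r * cre r (cre (1 - r) (hop_on ?A 1 g x)) S"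
        proof (cases "r \<in> S \<and> 1 - r \<in> S - {r}")
          case True
          then have "r \<le> M" using window_in[OF M] by auto
          have "window (M + 1) (S - {r} - {1 - r})"
            using M True r \<open>r \<le> M\<close> by (intro window_remove[of "M + 1" _ "1 - r"] window_remove[of M S r]) auto
          then have "hop 1 g x (S - {r} - {1 - r}) = hop_on ?A 1 g x (S - {r} - {1 - r})"
            by (intro hop_eq_hop_on) (auto simp: R_def)
          then show ?thesis by (simp add: cre_def)
        qed (auto simp: cre_def)
      qed
      also have "\<dots> = (\<Sum>r=1..R. \<Sum>a\<in>?A. g a * ?e r * cre r (cre (1 - r) (cre (a + 1) (ann a x))) S)"
        by (simp add: hop_on_def cre_sum sum_distrib_left mult_ac)
      finally show ?thesis by (simp only: sum.swap[of _ "{1..R}" ?A])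
    qed
    also have "(\<Sum>a\<in>?A. \<Sum>r=1..R. if a = r then g a * ?e r * cre (a + 1) (cre (1 - r) x) S else 0)
       = (\<Sum>r=1..R. ?e r * g r * cre (r + 1) (cre (1 - r) x) S)"
      by (subst sum.swap) (auto simp: sum.delta mult_ac intro!: sum.cong)
    also have "(\<Sum>a\<in>?A. \<Sum>r=1..R. if a = 1 - r then g a * ?e r * cre r (cre (a + 1) x) S else 0)
       = (\<Sum>r=1..R. ?e r * g (1 - r) * cre r (cre (2 - r) x) S)"
      by (subst sum.swap) (auto simp: sum.delta mult_ac intro!: sum.cong)
    also have "(\<Sum>r=1..R. ?e r * g (1 - r) * cre r (cre (2 - r) x) S)
       = (\<Sum>r=0..R-1. - (?e r * g r * cre (r + 1) (cre (1 - r) x) S))"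
    proof (rule sum.reindex_bij_witness[of _ "\<lambda>r. r + 1" "\<lambda>r. r - 1"])
      fix r assume "r \<in> {1..R}"
      then have "nat r = Suc (nat (r - 1))" by auto
      moreover have "g (r - 1) = g (1 - r)" using assms(2)[of "r - 1"] by simp
      ultimately show "- (?e (r - 1) * g (r - 1) * cre (r - 1 + 1) (cre (1 - (r - 1)) x) S) = ?e r * g (1 - r) * cre r (cre (2 - r) x) S"
        by simp
    qed auto
    \<comment> \<open>The two ranges differ in r = R, whose upper site lies beyond the window, and
      in r = 0, which would create two particles at site 1.\<close>
    also have "(\<Sum>r=1..R. ?e r * g r * cre (r + 1) (cre (1 - r) x) S)
        + (\<Sum>r=0..R-1. - (?e r * g r * cre (r + 1) (cre (1 - r) x) S)) = 0"
    proof -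
      let ?c = "\<lambda>r. ?e r * g r * cre (r + 1) (cre (1 - r) x) S"
      have R: "1 \<le> R" by (simp add: R_def)
      have "?c R = 0" using window_in[OF M, of "R + 1"] by (auto simp: cre_def R_def)
      moreover have "{1..R} = insert R {1..R-1}" using R by auto
      ultimately have "(\<Sum>r=1..R. ?c r) = (\<Sum>r=1..R-1. ?c r)" by simp
      moreover have "?c 0 = 0" by (simp add: cre_def)
      moreover have "{0..R-1} = insert 0 {1..R-1}" using R by auto
      ultimately show ?thesis by (simp add: sum_negf)
    qed
    finally show ?thesis by simp
  qed (simp add: raise_not_maya hop_not_maya)
qed

lemma raise_word_space:
  assumes "x \<in> word_space n i N"
  shows "raise x = 0"
  using assms
proof (induction rule: word_space_induct)
  case zero
  show ?case using raise_fscale[of 0 0] by simp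
next
  case (add c w y)
  have "raise (fock_word n i w) = 0"
  proof (induction w)
    case (Cons k w)
    have "raise (fock_f n k (fock_word n i w)) = fock_f n k (raise (fock_word n i w))"
      unfolding fock_f_def
      by (rule raise_hop) (simp_all add: residue_minus homogeneous_supp_maya[OF homogeneous_fock_word])
    then show ?case using Cons by (simp add: fock_f_def hop_0)
  qed (simp add: raise_vacuum)
  then show ?case using add by (simp add: raise_add raise_fscale)
qed

subsection \<open>Straightening\<close>

text \<open>Modelled on the Garnir relations of Specht modules. The given relations are summed over
  all Q = U \<union> C with C of size k + 1 in N. Deletions from U vanish by induction on U, and
  deletions from C reach every k-subset of N equally often, namely card N - k > 0 times.\<close>

lemma garnir:
  fixes y :: "'a set \<Rightarrow> complex"
  assumes "finite Y" "N \<subseteq> Y" "s < card N"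
    and rel: "\<And>Q. Q \<subseteq> Y \<Longrightarrow> card Q = Suc s \<Longrightarrow> (\<Sum>b\<in>Q. y (Q - {b})) = 0"
    and "U \<subseteq> Y - N" "card U \<le> s"
  shows "(\<Sum>C | C \<subseteq> N \<and> card C = s - card U. y (U \<union> C)) = 0"
  using assms(5,6)
proof (induction "card U" arbitrary: U rule: less_induct)
  case less
  define k where "k = s - card U"
  define \<C> where "\<C> j = {C. C \<subseteq> N \<and> card C = j}" for j
  have "N \<subseteq> Y" "U \<subseteq> Y" using assms(2) less.prems(1) by auto
  then have fin: "finite N" "finite U" using finite_subset[OF _ assms(1)] by blast+
  note finN = finite_subset[OF _ fin(1)]
  have finC: "finite (\<C> j)" for j unfolding \<C>_def by (rule finite_subset[of _ "Pow N"]) (use fin in auto)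
  have split: "(\<Sum>b\<in>U \<union> C. y (U \<union> C - {b})) = (\<Sum>b\<in>U. y (U - {b} \<union> C)) + (\<Sum>b\<in>C. y (U \<union> (C - {b})))"
    if "C \<in> \<C> (Suc k)" for C
  proof -
    have C: "C \<subseteq> N" using that by (simp add: \<C>_def)
    then have "finite C" "U \<inter> C = {}" using less.prems(1) by (auto intro: finN)
    then have "(\<Sum>b\<in>U \<union> C. y (U \<union> C - {b})) = (\<Sum>b\<in>U. y (U \<union> C - {b})) + (\<Sum>b\<in>C. y (U \<union> C - {b}))"
      using fin by (intro sum.union_disjoint) auto
    also have "(\<Sum>b\<in>U. y (U \<union> C - {b})) = (\<Sum>b\<in>U. y (U - {b} \<union> C))"
      using \<open>U \<inter> C = {}\<close> by (intro sum.cong HOL.refl arg_cong[of _ _ y]) auto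
    also have "(\<Sum>b\<in>C. y (U \<union> C - {b})) = (\<Sum>b\<in>C. y (U \<union> (C - {b})))"
      using \<open>U \<inter> C = {}\<close> by (intro sum.cong HOL.refl arg_cong[of _ _ y]) auto
    finally show ?thesis .
  qed
  have zero: "(\<Sum>b\<in>U \<union> C. y (U \<union> C - {b})) = 0" if "C \<in> \<C> (Suc k)" for C
  proof (rule rel)
    have C: "C \<subseteq> N" "card C = Suc k" using that by (simp_all add: \<C>_def)
    then show "U \<union> C \<subseteq> Y" using less.prems assms(2) by auto
    have "card (U \<union> C) = card U + card C"
      using C fin less.prems by (intro card_Un_disjoint) (auto intro: finN)
    then show "card (U \<union> C) = Suc s" using C less.prems by (simp add: k_def)
  qed
  have "0 = (\<Sum>C\<in>\<C> (Suc k). \<Sum>b\<in>U \<union> C. y (U \<union> C - {b}))" using zero by simp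
  also have "\<dots> = (\<Sum>C\<in>\<C> (Suc k). \<Sum>b\<in>U. y (U - {b} \<union> C)) + (\<Sum>C\<in>\<C> (Suc k). \<Sum>b\<in>C. y (U \<union> (C - {b})))"
    using split by (simp add: sum.distrib)
  also have "(\<Sum>C\<in>\<C> (Suc k). \<Sum>b\<in>U. y (U - {b} \<union> C)) = (\<Sum>b\<in>U. \<Sum>C\<in>\<C> (Suc k). y (U - {b} \<union> C))"
    by (rule sum.swap)
  also have "\<dots> = 0"
  proof (rule sum.neutral, rule ballI)
    fix b assume b: "b \<in> U"
    have card: "card (U - {b}) < card U" "s - card (U - {b}) = Suc k"
    proof -
      have "card U = Suc (card (U - {b}))" using card_Suc_Diff1[OF fin(2) b] by simp
      then show "card (U - {b}) < card U" "s - card (U - {b}) = Suc k" using less.prems(2) by (simp_all add: k_def)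
    qed
    have "(\<Sum>C | C \<subseteq> N \<and> card C = s - card (U - {b}). y (U - {b} \<union> C)) = 0"
      using less.prems card(1) by (intro less.hyps) auto
    then show "(\<Sum>C\<in>\<C> (Suc k). y (U - {b} \<union> C)) = 0" unfolding card(2) \<C>_def .
  qed
  also have "(\<Sum>C\<in>\<C> (Suc k). \<Sum>b\<in>C. y (U \<union> (C - {b}))) = (\<Sum>(C, b)\<in>Sigma (\<C> (Suc k)) (\<lambda>C. C). y (U \<union> (C - {b})))"
    using fin by (intro sum.Sigma finC ballI) (auto simp: \<C>_def intro: finN)
  also have "\<dots> = (\<Sum>(C, b)\<in>Sigma (\<C> k) (\<lambda>C. N - C). y (U \<union> C))"
  proof (rule sum.reindex_bij_witness[of _ "\<lambda>(C, b). (insert b C, b)" "\<lambda>(C, b). (C - {b}, b)"])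
    fix Cb assume "Cb \<in> Sigma (\<C> k) (\<lambda>C. N - C)"
    then obtain C b where "Cb = (C, b)" "C \<subseteq> N" "card C = k" "b \<in> N" "b \<notin> C" "finite C"
      by (auto simp: \<C>_def intro: finN)
    then show "(case case Cb of (C, b) \<Rightarrow> (insert b C, b) of (C, b) \<Rightarrow> (C - {b}, b)) = Cb"
      "(case Cb of (C, b) \<Rightarrow> (insert b C, b)) \<in> Sigma (\<C> (Suc k)) (\<lambda>C. C)" by (auto simp: \<C>_def)
  next
    fix Cb assume "Cb \<in> Sigma (\<C> (Suc k)) (\<lambda>C. C)"
    then obtain C b where "Cb = (C, b)" "C \<subseteq> N" "card C = Suc k" "b \<in> C" "finite C"
      by (auto simp: \<C>_def intro: finN)
    then show "(case case Cb of (C, b) \<Rightarrow> (C - {b}, b) of (C, b) \<Rightarrow> (insert b C, b)) = Cb"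
      "(case Cb of (C, b) \<Rightarrow> (C - {b}, b)) \<in> Sigma (\<C> k) (\<lambda>C. N - C)"
      "(case case Cb of (C, b) \<Rightarrow> (C - {b}, b) of (C, b) \<Rightarrow> y (U \<union> C)) = (case Cb of (C, b) \<Rightarrow> y (U \<union> (C - {b})))"
      by (auto simp: \<C>_def insert_absorb)
  qed
  also have "\<dots> = (\<Sum>C\<in>\<C> k. \<Sum>b\<in>N - C. y (U \<union> C))"
    using fin by (intro sum.Sigma[symmetric] finC ballI) auto
  also have "\<dots> = (\<Sum>C\<in>\<C> k. of_nat (card N - k) * y (U \<union> C))"
  proof (intro sum.cong HOL.refl)
    fix C assume "C \<in> \<C> k"
    then have "card (N - C) = card N - k" by (auto simp: \<C>_def card_Diff_subset finN)
    then show "(\<Sum>b\<in>N - C. y (U \<union> C)) = of_nat (card N - k) * y (U \<union> C)" by simp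
  qed
  also have "\<dots> = of_nat (card N - k) * (\<Sum>C\<in>\<C> k. y (U \<union> C))" by (simp add: sum_distrib_left)
  finally have "of_nat (card N - k) * (\<Sum>C\<in>\<C> k. y (U \<union> C)) = 0" by simp
  moreover have "card N - k \<noteq> 0" using assms(3) by (simp add: k_def)
  ultimately show ?case by (simp add: \<C>_def k_def)
qed

text \<open>Chosen for two properties: filling an empty pair r, 1 - r with r > i changes it by -2 n
  r, so that low energy means full pairs far out, and it is invariant under particle-hole
  duality.\<close>

definition energy :: "nat \<Rightarrow> nat \<Rightarrow> int set \<Rightarrow> int" where
  "energy n i S = (\<Sum>p\<in>particles i S. p * (p - int n)) + (\<Sum>a\<in>holes i S. (1 - a) * (int n + 1 - a))"

lemma minus_one_power_square: "(- 1 :: complex) ^ k * (- 1) ^ k = 1"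
  by (rule minus_one_mult_self)

text \<open>The particles above r enter both signs and cancel; what remains is the parity of the
  particles strictly between the two sites.\<close>

lemma cre_cre_pair:
  assumes "maya S" "1 \<le> r" "r \<in> S" "1 - r \<in> S"
  shows "cre r (cre (1 - r) x) S = (- 1) ^ card (S \<inter> {1 - r<..<r}) * x (S - {r} - {1 - r})"
proof -
  let ?A = "{b \<in> S. r < b}"
  have eq: "{b \<in> S - {r}. 1 - r < b} = (S \<inter> {1 - r<..<r}) \<union> ?A"
  proof (rule set_eqI)
    fix b
    have "1 - r < b \<and> b \<noteq> r \<longleftrightarrow> (1 - r < b \<and> b < r) \<or> r < b" using assms(2) by linarith
    then show "b \<in> {b \<in> S - {r}. 1 - r < b} \<longleftrightarrow> b \<in> (S \<inter> {1 - r<..<r}) \<union> ?A" by auto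
  qed
  have "finite (S \<inter> {1 - r<..<r})" "finite ?A" using maya_finite_above[OF assms(1), of r] by auto
  then have "card {b \<in> S - {r}. 1 - r < b} = card (S \<inter> {1 - r<..<r}) + card ?A"
    unfolding eq by (rule card_Un_disjoint) auto
  then have "fermion_sign S r * fermion_sign (S - {r}) (1 - r) = (- 1) ^ card ?A * ((- 1) ^ card (S \<inter> {1 - r<..<r}) * (- 1) ^ card ?A)"
    by (simp only: fermion_sign_def power_add)
  also have "\<dots> = (- 1) ^ card (S \<inter> {1 - r<..<r}) * ((- 1) ^ card ?A * (- 1) ^ card ?A)"
    by (rule mult.left_commute)
  finally have "fermion_sign S r * fermion_sign (S - {r}) (1 - r) = (- 1) ^ card (S \<inter> {1 - r<..<r})"
    by (simp only: minus_one_power_square mult_1_right)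
  moreover have "1 - r \<in> S - {r}" using assms by auto
  then have "cre r (cre (1 - r) x) S = fermion_sign S r * (fermion_sign (S - {r}) (1 - r) * x (S - {r} - {1 - r}))"
    using assms(1,3) by (simp add: cre_def)
  ultimately show ?thesis by (simp only: mult.assoc[symmetric])
qed

lemma sum_exchange_less:
  fixes W C :: "int set"
  assumes "finite C" "finite W" "card C = card W" "C \<noteq> W" "\<And>c. c \<in> C - W \<Longrightarrow> \<theta> \<le> c" "\<And>w. w \<in> W \<Longrightarrow> w < \<theta>"
  shows "\<Sum>W < \<Sum>C"
proof -
  have card: "card (C - W) = card (W - C)"
    using assms(1-3) by (simp add: card_Diff_subset_Int Int_commute)
  have ne: "W - C \<noteq> {}"
  proof
    assume "W - C = {}"
    then have "W \<subseteq> C" by auto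
    then show False using assms card_subset_eq by metis
  qed
  have "\<Sum>(W - C) < (\<Sum>w\<in>W - C. \<theta>)" using assms ne by (intro sum_strict_mono) auto
  also have "\<dots> = (\<Sum>c\<in>C - W. \<theta>)" using card by simp
  also have "\<dots> \<le> \<Sum>(C - W)" using assms by (intro sum_mono) auto
  finally have "\<Sum>(W - C) < \<Sum>(C - W)" .
  moreover have "\<Sum>W = \<Sum>(W - C) + \<Sum>(W \<inter> C)" "\<Sum>C = \<Sum>(C - W) + \<Sum>(W \<inter> C)"
    using sum.Int_Diff[OF assms(2), of "\<lambda>r. r" C] sum.Int_Diff[OF assms(1), of "\<lambda>r. r" W]
    by (simp_all add: Int_commute)
  ultimately show ?thesis by simp
qed

text \<open>If the inequality fails, there are more empty than full pairs beyond \<theta>, which is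
  the room that \<open>garnir\<close> needs. Every term of its relation other than S0 moves full
  pairs outwards, has smaller energy and vanishes by minimality; hence x S0 = 0.\<close>

lemma straightening:
  assumes "raise x = 0" "n \<ge> 1"
    and max: "\<And>S. x S \<noteq> 0 \<Longrightarrow> card (holes i S) \<le> card (holes i S0)"
    and S0: "maya S0" "x S0 \<noteq> 0"
    and min: "\<And>S. x S \<noteq> 0 \<Longrightarrow> card (holes i S) = card (holes i S0) \<Longrightarrow> energy n i S0 \<le> energy n i S"
    and \<theta>: "int i < \<theta>"
  shows "card {a \<in> holes i S0. a \<le> 1 - \<theta>} \<le> card {p \<in> particles i S0. \<theta> \<le> p}"
proof (rule ccontr)
  assume bad: "\<not> ?thesis"
  \<comment> \<open>The pairs r, 1 - r with r > i that are completely full or completely empty in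
    S0. \<open>T Q\<close> makes those in Q full and the others of Y empty, leaving all remaining
    sites alone.\<close>
  define Y where "Y = {r. int i < r \<and> (r \<in> S0 \<longleftrightarrow> 1 - r \<in> S0)}"
  define Q0 where "Q0 = Y \<inter> S0"
  define m where "m Q = (\<lambda>r. 1 - r) ` Q" for Q :: "int set"
  define B where "B = S0 - Y - m Y"
  define T where "T Q = B \<union> Q \<union> m Q" for Q
  have minj: "inj (\<lambda>r::int. 1 - r)" by (auto intro: injI)
  have m_iff: "a \<in> m Q \<longleftrightarrow> 1 - a \<in> Q" for a Q by (force simp: m_def)
  have Ypos: "int i < r" if "r \<in> Y" for r using that by (simp add: Y_def)
  have Yneg: "1 - r \<notin> Y" if "r \<in> Y" for r using Ypos[of r] Ypos[of "1 - r"] that by auto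
  have Ym: "Y \<inter> m Y = {}" using Yneg by (auto simp: m_iff)
  obtain M where M: "window M S0" using S0(1) by (auto simp: maya_def)
  have finY: "finite Y"
  proof (rule finite_subset)
    show "Y \<subseteq> {int i..M + 1}"
    proof
      fix r assume r: "r \<in> Y"
      then have "r \<in> S0 \<or> 1 - r \<notin> S0" by (auto simp: Y_def)
      then show "r \<in> {int i..M + 1}" using window_in[OF M, of r] window_notin[OF M, of "1 - r"] Ypos[OF r] by auto
    qed
  qed simp
  have memB: "a \<in> B \<longleftrightarrow> a \<in> S0 \<and> a \<notin> Y \<and> 1 - a \<notin> Y" for a by (auto simp: B_def m_iff)
  have T_Q0: "T Q0 = S0"
  proof -
    have "a \<in> T Q0 \<longleftrightarrow> a \<in> S0" for a
    proof -
      have "a \<in> Y \<Longrightarrow> a \<in> S0 \<longleftrightarrow> 1 - a \<in> S0" by (simp add: Y_def)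
      moreover have "1 - a \<in> Y \<Longrightarrow> 1 - a \<in> S0 \<longleftrightarrow> a \<in> S0" by (simp add: Y_def)
      ultimately show ?thesis by (auto simp: T_def memB m_iff Q0_def)
    qed
    then show ?thesis by auto
  qed
  have mayaT: "maya (T Q)" if "Q \<subseteq> Y" for Q
  proof -
    have fin: "finite A \<Longrightarrow> maya (S - A) \<longleftrightarrow> maya S" for A S
    proof (induction A rule: finite_induct)
      case (insert a A)
      have "S - insert a A = S - A - {a}" by auto
      then show ?case using insert by simp
    qed simp
    have fin': "finite A \<Longrightarrow> maya (S \<union> A) \<longleftrightarrow> maya S" for A S
      by (induction A rule: finite_induct) auto
    have "finite (m Y)" "finite Q" "finite (m Q)" 
      using finY finite_subset[OF that finY] by (simp_all add: m_def)
    then show ?thesis using S0(1) finY by (simp add: T_def B_def fin fin')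
  qed
  have holesT: "holes i (T Q) = (holes i S0 - m Y) \<union> m (Y - Q)" if "Q \<subseteq> Y" for Q
  proof -
    have "a \<in> holes i (T Q) \<longleftrightarrow> a \<in> (holes i S0 - m Y) \<union> m (Y - Q)" for a
    proof -
      have "a \<le> int i \<Longrightarrow> a \<notin> Y" using Ypos[of a] by auto
      moreover have "1 - a \<in> Y \<Longrightarrow> a \<le> int i" using Ypos[of "1 - a"] by simp
      ultimately show ?thesis using that by (auto simp: holes_def T_def memB m_iff)
    qed
    then show ?thesis by auto
  qed
  have particlesT: "particles i (T Q) = (particles i S0 - Y) \<union> Q" if "Q \<subseteq> Y" for Q
  proof -
    have "a \<in> particles i (T Q) \<longleftrightarrow> a \<in> (particles i S0 - Y) \<union> Q" for a
    proof -
      have "int i < a \<Longrightarrow> 1 - a \<notin> Y" using Ypos[of "1 - a"] by auto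
      moreover have "a \<in> Y \<Longrightarrow> int i < a" using Ypos by simp
      ultimately show ?thesis using that by (auto simp: particles_def T_def memB m_iff)
    qed
    then show ?thesis by auto
  qed
  let ?H = "holes i S0 - m Y"
  have finH: "finite ?H" using finite_holes[OF S0(1)] by simp
  have cardT: "card (holes i (T Q)) + card Q = card ?H + card Y" if "Q \<subseteq> Y" for Q
  proof -
    have "card (holes i (T Q)) = card ?H + card (m (Y - Q))"
      unfolding holesT[OF that] using finH finY by (intro card_Un_disjoint) (auto simp: m_def)
    also have "card (m (Y - Q)) = card Y - card Q"
    proof -
      have "card (m (Y - Q)) = card (Y - Q)"
        unfolding m_def by (rule card_image) (rule inj_on_subset[OF minj subset_UNIV])
      then show ?thesis using card_Diff_subset[OF finite_subset[OF that finY] that] by simp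
    qed
    finally show ?thesis using card_mono[OF finY that] by simp
  qed
  define s where "s = card Q0"
  have Q0: "Q0 \<subseteq> Y" by (auto simp: Q0_def)
  define k where "k = card (holes i S0)"
  have ks: "k + s = card ?H + card Y" using cardT[OF Q0] by (simp add: T_Q0 k_def s_def)
  define e where "e Q = energy n i (T Q)" for Q
  have energyT: "e Q + 2 * int n * \<Sum>Q = e {}" if "Q \<subseteq> Y" for Q
  proof -
    have eq: "e Q = (\<Sum>p\<in>particles i S0 - Y. p * (p - int n)) + (\<Sum>r\<in>Q. r * (r - int n))
        + (\<Sum>a\<in>?H. (1 - a) * (int n + 1 - a)) + (\<Sum>r\<in>Y - Q. r * (int n + r))" if "Q \<subseteq> Y" for Q
    proof -
      have "(\<Sum>p\<in>particles i (T Q). p * (p - int n)) = (\<Sum>p\<in>particles i S0 - Y. p * (p - int n)) + (\<Sum>r\<in>Q. r * (r - int n))"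
        unfolding particlesT[OF that] using finite_particles[OF S0(1)] finY that
        by (intro sum.union_disjoint) (auto intro: finite_subset[OF _ finY])
      moreover have "(\<Sum>a\<in>holes i (T Q). (1 - a) * (int n + 1 - a)) = (\<Sum>a\<in>?H. (1 - a) * (int n + 1 - a)) + (\<Sum>a\<in>m (Y - Q). (1 - a) * (int n + 1 - a))"
        unfolding holesT[OF that] using finH finY by (intro sum.union_disjoint) (auto simp: m_def)
      moreover have "(\<Sum>a\<in>m (Y - Q). (1 - a) * (int n + 1 - a)) = (\<Sum>r\<in>Y - Q. r * (int n + r))"
        unfolding m_def by (subst sum.reindex) (auto intro: inj_on_subset[OF minj])
      ultimately show ?thesis by (simp add: e_def energy_def)
    qed
    have "(\<Sum>r\<in>Y. r * (int n + r)) = (\<Sum>r\<in>Y - Q. r * (int n + r)) + (\<Sum>r\<in>Q. r * (int n + r))"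
      using finY that by (simp add: sum.subset_diff)
    moreover have "(\<Sum>r\<in>Q. r * (r - int n)) + 2 * int n * \<Sum>Q = (\<Sum>r\<in>Q. r * (int n + r))"
      by (simp add: sum_distrib_left algebra_simps flip: sum.distrib)
    ultimately show ?thesis using eq[OF that] eq[of "{}"] by simp
  qed
  \<comment> \<open>Absorbs the signs of \<open>raise\<close>. It depends on r and B alone, because
    full pairs contribute an even number of particles between 1 - r and r.\<close>
  define \<sigma> :: "int \<Rightarrow> complex" where "\<sigma> r = (- 1) ^ nat r * (- 1) ^ card (B \<inter> {1 - r<..<r})" for r
  have \<sigma>2: "\<sigma> r * \<sigma> r = 1" for r
  proof -
    have "\<sigma> r * \<sigma> r = ((- 1) ^ nat r * (- 1) ^ nat r) * ((- 1) ^ card (B \<inter> {1 - r<..<r}) * (- 1) ^ card (B \<inter> {1 - r<..<r}))"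
      by (simp only: \<sigma>_def mult_ac)
    then show ?thesis by (simp only: minus_one_power_square mult_1)
  qed
  define y where "y Q = (\<Prod>r\<in>Q. \<sigma> r) * x (T Q)" for Q
  have rel: "(\<Sum>b\<in>Q. y (Q - {b})) = 0" if Q: "Q \<subseteq> Y" "card Q = Suc s" for Q
  proof -
    have finQ: "finite Q" using finite_subset[OF Q(1) finY] .
    have inT: "r \<in> T Q \<longleftrightarrow> r \<in> Q" "1 - r \<in> T Q \<longleftrightarrow> r \<in> Q" if "r \<in> Y" for r
      using that Q(1) Yneg[OF that] by (auto simp: T_def memB m_iff)
    have pair_term: "cre r (cre (1 - r) x) (T Q) = (- 1) ^ card (B \<inter> {1 - r<..<r}) * x (T (Q - {r}))" if "r \<in> Q" for r
    proof -
      have r: "r \<in> Y" "1 \<le> r" using that Q(1) Ypos[of r] by auto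
      have "T Q - {r} - {1 - r} = T (Q - {r})"
      proof -
        have "1 - r \<notin> Q" "r \<notin> m Q" "1 - r \<notin> B" "r \<notin> B"
          using r Q(1) Yneg[OF r(1)] by (auto simp: memB m_iff)
        then show ?thesis by (auto simp: T_def m_iff)
      qed
      moreover have "(- 1 :: complex) ^ card (T Q \<inter> {1 - r<..<r}) = (- 1) ^ card (B \<inter> {1 - r<..<r})"
      proof -
        let ?I = "{1 - r<..<r}"
        have "T Q \<inter> ?I = (B \<inter> ?I) \<union> ((Q \<inter> ?I) \<union> m (Q \<inter> ?I))"
          by (auto simp: T_def m_iff)
        moreover have "card ((B \<inter> ?I) \<union> ((Q \<inter> ?I) \<union> m (Q \<inter> ?I))) = card (B \<inter> ?I) + card ((Q \<inter> ?I) \<union> m (Q \<inter> ?I))"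
          using finQ Q(1) by (intro card_Un_disjoint) (auto simp: m_def memB)
        moreover have "card ((Q \<inter> ?I) \<union> m (Q \<inter> ?I)) = card (Q \<inter> ?I) + card (m (Q \<inter> ?I))"
          using finQ Q(1) Ym by (intro card_Un_disjoint) (auto simp: m_def)
        moreover have "card (m (Q \<inter> ?I)) = card (Q \<inter> ?I)"
          unfolding m_def by (rule card_image) (rule inj_on_subset[OF minj subset_UNIV])
        ultimately show ?thesis by (simp only: power_add minus_one_power_square mult_1_right)
      qed
      ultimately show ?thesis
        using cre_cre_pair[OF mayaT[OF Q(1)] r(2), of x] inT[OF r(1)] that by simp
    qed
    have "0 = raise x (T Q)" using assms(1) by (simp add: zero_fun_apply)
    also have "\<dots> = (\<Sum>r\<in>Q. (- 1) ^ nat r * cre r (cre (1 - r) x) (T Q))"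
      unfolding raise_def
    proof (rule sum.mono_neutral_right)
      obtain M' where M': "window M' (T Q)" using mayaT[OF Q(1)] by (auto simp: maya_def)
      have "{r. 1 \<le> r \<and> r \<in> T Q \<and> 1 - r \<in> T Q} \<subseteq> {1..M'}" using window_in[OF M'] by auto
      then show "finite {r. 1 \<le> r \<and> r \<in> T Q \<and> 1 - r \<in> T Q}" by (rule finite_subset) simp
      show "Q \<subseteq> {r. 1 \<le> r \<and> r \<in> T Q \<and> 1 - r \<in> T Q}" 
      proof
        fix r assume "r \<in> Q"
        then show "r \<in> {r. 1 \<le> r \<and> r \<in> T Q \<and> 1 - r \<in> T Q}" using inT[of r] Q(1) Ypos[of r] by auto
      qed
      show "\<forall>r\<in>{r. 1 \<le> r \<and> r \<in> T Q \<and> 1 - r \<in> T Q} - Q. (- 1) ^ nat r * cre r (cre (1 - r) x) (T Q) = 0"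
      proof
        fix r assume r: "r \<in> {r. 1 \<le> r \<and> r \<in> T Q \<and> 1 - r \<in> T Q} - Q"
        have "r \<notin> Y" using inT[of r] r by auto
        have "r \<le> int i"
        proof (rule ccontr)
          assume "\<not> r \<le> int i"
          then have "1 - r \<notin> Y" using Ypos[of "1 - r"] by auto
          then have "r \<in> S0" "1 - r \<in> S0" using r \<open>r \<notin> Y\<close> Q(1) by (auto simp: T_def memB m_iff)
          then show False using \<open>r \<notin> Y\<close> \<open>\<not> r \<le> int i\<close> by (auto simp: Y_def)
        qed
        \<comment> \<open>For r <= i both sites lie at or below i. \<open>T Q\<close> has k - 1
          holes, so emptying them would exceed the maximal number k.\<close>
        have "holes i (T Q - {r} - {1 - r}) = insert r (insert (1 - r) (holes i (T Q)))"
          using r \<open>r \<le> int i\<close> by (auto simp: holes_def)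
        moreover have "r \<notin> insert (1 - r) (holes i (T Q))" "1 - r \<notin> holes i (T Q)"
          using r by (auto simp: holes_def)
        ultimately have "card (holes i (T Q - {r} - {1 - r})) = card (holes i (T Q)) + 2"
          using finite_holes[OF mayaT[OF Q(1)]] by simp
        then have "card (holes i (T Q - {r} - {1 - r})) > k"
          using cardT[OF Q(1)] ks Q(2) by simp
        then have "x (T Q - {r} - {1 - r}) = 0" using max unfolding k_def by (meson not_le)
        then show "(- 1) ^ nat r * cre r (cre (1 - r) x) (T Q) = 0" by (simp add: cre_def)
      qed
    qed
    also have "\<dots> = (\<Sum>r\<in>Q. \<sigma> r * x (T (Q - {r})))"
      using pair_term by (intro sum.cong) (auto simp: \<sigma>_def)
    finally have "(\<Sum>r\<in>Q. \<sigma> r * x (T (Q - {r}))) = 0" by simp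
    moreover have "y (Q - {r}) = (\<Prod>r\<in>Q. \<sigma> r) * (\<sigma> r * x (T (Q - {r})))" if "r \<in> Q" for r
    proof -
      have "(\<Prod>r\<in>Q. \<sigma> r) * \<sigma> r = \<sigma> r * \<sigma> r * (\<Prod>r\<in>Q - {r}. \<sigma> r)"
        using finQ that by (simp add: prod.remove mult_ac)
      then show ?thesis by (simp add: y_def \<sigma>2 flip: mult.assoc)
    qed
    ultimately show ?thesis by (simp flip: sum_distrib_left)
  qed
  \<comment> \<open>U and W are the full pairs from \<theta> on and before \<theta>, D the empty
    ones from \<theta> on. Sites of Z, occupied without their partner, count on both sides of the
    inequality and cancel.\<close>
  define U where "U = {r \<in> Q0. \<theta> \<le> r}"
  define W where "W = {r \<in> Q0. r < \<theta>}"
  define D where "D = {r \<in> Y. \<theta> \<le> r \<and> r \<notin> S0}"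
  define Z where "Z = {r. \<theta> \<le> r \<and> r \<in> S0 \<and> 1 - r \<notin> S0}"
  have "U \<subseteq> Y" "W \<subseteq> Y" "D \<subseteq> Y" "Q0 \<subseteq> Y" by (auto simp: U_def W_def D_def Q0_def)
  then have fin: "finite U" "finite W" "finite D" "finite Q0" using finite_subset[OF _ finY] by blast+
  have finZ: "finite Z"
    using window_in[OF M] by (intro finite_subset[of Z "{\<theta>..M}"]) (auto simp: Z_def)
  have "{p \<in> particles i S0. \<theta> \<le> p} = U \<union> Z"
    using \<theta> by (auto simp: particles_def U_def Z_def Q0_def Y_def)
  moreover have "card (U \<union> Z) = card U + card Z"
    using fin finZ by (intro card_Un_disjoint) (auto simp: U_def Z_def Q0_def Y_def)
  moreover have "{a \<in> holes i S0. a \<le> 1 - \<theta>} = m (D \<union> Z)"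
  proof -
    have "a \<in> holes i S0 \<and> a \<le> 1 - \<theta> \<longleftrightarrow> 1 - a \<in> D \<union> Z" for a
      using \<theta> by (auto simp: holes_def D_def Z_def Y_def)
    then show ?thesis by (intro set_eqI) (simp only: m_iff mem_Collect_eq)
  qed
  moreover have "card (m (D \<union> Z)) = card D + card Z"
  proof -
    have "card (m (D \<union> Z)) = card (D \<union> Z)"
      unfolding m_def by (rule card_image) (rule inj_on_subset[OF minj subset_UNIV])
    also have "\<dots> = card D + card Z"
      using fin finZ by (intro card_Un_disjoint) (auto simp: D_def Z_def)
    finally show ?thesis .
  qed
  ultimately have DU: "card U < card D" using bad by simp
  have UW: "U \<union> W = Q0" "U \<inter> W = {}" by (auto simp: U_def W_def)
  then have s: "s = card U + card W" unfolding s_def using fin by (metis card_Un_disjoint)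
  have DW: "D \<inter> W = {}" by (auto simp: D_def W_def)
  have "(\<Sum>C | C \<subseteq> D \<union> W \<and> card C = s - card U. y (U \<union> C)) = 0"
  proof (rule garnir[OF finY])
    show "D \<union> W \<subseteq> Y" "U \<subseteq> Y - (D \<union> W)" by (auto simp: D_def W_def U_def Q0_def)
    show "s < card (D \<union> W)" using card_Un_disjoint[OF fin(3,2) DW] DU s by simp
    show "card U \<le> s" using s by simp
  qed (rule rel)
  moreover have vanish: "y (U \<union> C) = 0" if C: "C \<subseteq> D \<union> W" "card C = s - card U" "C \<noteq> W" for C
  proof (rule ccontr)
    assume "y (U \<union> C) \<noteq> 0"
    then have nz: "x (T (U \<union> C)) \<noteq> 0" by (auto simp: y_def)
    have finC: "finite C" using finite_subset[OF C(1)] fin by simp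
    have disj: "U \<inter> C = {}" using C by (auto simp: U_def D_def W_def Q0_def)
    have sub: "U \<union> C \<subseteq> Y" using C by (auto simp: D_def W_def U_def Q0_def)
    have card: "card (U \<union> C) = s" using card_Un_disjoint[OF fin(1) finC disj] C s by simp
    have "card (holes i (T (U \<union> C))) = card (holes i S0)"
      using cardT[OF sub] ks card by (simp add: k_def)
    then have "e Q0 \<le> e (U \<union> C)" using min[OF nz] by (simp add: e_def T_Q0)
    then have "2 * int n * \<Sum>(U \<union> C) \<le> 2 * int n * \<Sum>Q0" using energyT[OF sub] energyT[OF Q0] by linarith
    then have "\<Sum>(U \<union> C) \<le> \<Sum>Q0" using assms(2) by simp
    moreover have "\<Sum>(U \<union> C) = \<Sum>U + \<Sum>C" using fin finC disj by (intro sum.union_disjoint) auto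
    moreover have "\<Sum>Q0 = \<Sum>U + \<Sum>W" using sum.union_disjoint[OF fin(1,2) UW(2), of "\<lambda>r. r"] UW(1) by simp
    moreover have "\<Sum>W < \<Sum>C"
      using C s fin finC by (intro sum_exchange_less[of C W \<theta>]) (auto simp: D_def W_def)
    ultimately show False by simp
  qed
  moreover have "(\<Sum>C | C \<subseteq> D \<union> W \<and> card C = s - card U. y (U \<union> C)) = (\<Sum>C\<in>{W}. y (U \<union> C))"
  proof (rule sum.mono_neutral_right)
    show "finite {C. C \<subseteq> D \<union> W \<and> card C = s - card U}"
      by (rule finite_subset[of _ "Pow (D \<union> W)"]) (use fin in auto)
    show "{W} \<subseteq> {C. C \<subseteq> D \<union> W \<and> card C = s - card U}" using s by auto
    show "\<forall>C\<in>{C. C \<subseteq> D \<union> W \<and> card C = s - card U} - {W}. y (U \<union> C) = 0" using vanish by blast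
  qed
  ultimately have "y (U \<union> W) = 0" by simp
  then have "x S0 = 0 \<or> (\<Prod>r\<in>Q0. \<sigma> r) = 0" by (auto simp: y_def UW T_Q0)
  moreover have "\<sigma> r \<noteq> 0" for r using \<sigma>2[of r] by auto
  ultimately show False using S0 fin by simp
qed

subsection \<open>Particle-hole duality\<close>

text \<open>Complement and reflection b to n + 1 - b. It realises the diagram symmetry j to n - j,
  exchanges the vacua of charge i and n - i, and turns pairs with sum 1 into pairs with sum 2 n +
  1.\<close>

definition dual_set :: "nat \<Rightarrow> int set \<Rightarrow> int set" where
  "dual_set n S = {b. int n + 1 - b \<notin> S}"

lemma dual_set_dual_set [simp]: "dual_set n (dual_set n S) = S"
  by (auto simp: dual_set_def)

lemma maya_dual_set_aux: "maya S \<Longrightarrow> maya (dual_set n S)"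
proof -
  assume "maya S"
  then obtain M where M: "window M S" by (auto simp: maya_def)
  have "window (M + int n + 2) (dual_set n S)"
    unfolding window_def dual_set_def
  proof (intro conjI allI ballI impI)
    fix b
    show "- (M + int n + 2) < b" if "b \<notin> {b. int n + 1 - b \<notin> S}"
      using window_in[OF M, of "int n + 1 - b"] that by auto
    show "b \<le> M + int n + 2" if "b \<in> {b. int n + 1 - b \<notin> S}"
      using window_notin[OF M, of "int n + 1 - b"] that by auto
  qed
  then show ?thesis by (auto simp: maya_def)
qed

lemma maya_dual_set [simp]: "maya (dual_set n S) \<longleftrightarrow> maya S"
  using maya_dual_set_aux[of S n] maya_dual_set_aux[of "dual_set n S" n] by auto

lemma holes_dual_set: "i \<le> n \<Longrightarrow> holes (n - i) (dual_set n S) = (\<lambda>p. int n + 1 - p) ` particles i S"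
proof -
  assume "i \<le> n"
  then have "a \<in> holes (n - i) (dual_set n S) \<longleftrightarrow> int n + 1 - a \<in> particles i S" for a
    by (auto simp: holes_def particles_def dual_set_def)
  moreover have "a \<in> (\<lambda>p. int n + 1 - p) ` particles i S \<longleftrightarrow> int n + 1 - a \<in> particles i S" for a
    by (force simp: image_iff)
  ultimately show ?thesis by (intro set_eqI) simp
qed

lemma particles_dual_set: "i \<le> n \<Longrightarrow> particles (n - i) (dual_set n S) = (\<lambda>a. int n + 1 - a) ` holes i S"
proof -
  assume "i \<le> n"
  then have "a \<in> particles (n - i) (dual_set n S) \<longleftrightarrow> int n + 1 - a \<in> holes i S" for a
    by (auto simp: holes_def particles_def dual_set_def)
  moreover have "a \<in> (\<lambda>p. int n + 1 - p) ` holes i S \<longleftrightarrow> int n + 1 - a \<in> holes i S" for a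
    by (force simp: image_iff)
  ultimately show ?thesis by (intro set_eqI) simp
qed

lemma energy_dual_set: "i \<le> n \<Longrightarrow> energy n (n - i) (dual_set n S) = energy n i S"
proof -
  assume i: "i \<le> n"
  have inj: "inj_on (\<lambda>a::int. int n + 1 - a) A" for A by (auto intro: inj_onI)
  show ?thesis
    unfolding energy_def holes_dual_set[OF i] particles_dual_set[OF i] sum.reindex[OF inj] o_def
    by (simp add: algebra_simps)
qed

lemma vacuum_dual_set: "i \<le> n \<Longrightarrow> vacuum i (dual_set n S) = vacuum (n - i) S"
proof -
  assume i: "i \<le> n"
  have "dual_set n (vacuum_set i) = vacuum_set (n - i)"
    using i by (auto simp: dual_set_def vacuum_set_def)
  then have "dual_set n S = vacuum_set i \<longleftrightarrow> S = vacuum_set (n - i)" by (metis dual_set_dual_set)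
  then show ?thesis by (simp add: vacuum_def)
qed

lemma residue_dual: "j \<le> n \<Longrightarrow> residue n j (int n - b) = residue n (n - j) b"
proof -
  assume j: "j \<le> n"
  have 1: "2 * int n dvd int n - b - int j \<longleftrightarrow> 2 * int n dvd b - int (n - j)"
    using dvd_minus_iff[of "2 * int n" "b - int (n - j)"] j by (simp add: algebra_simps)
  have "int n - b + int j = 2 * int n - (b + int (n - j))" using j by simp
  then have 2: "2 * int n dvd int n - b + int j \<longleftrightarrow> 2 * int n dvd b + int (n - j)"
    by (metis dvd_diff_right_iff dvd_refl)
  show ?thesis unfolding residue_def 1 2 ..
qed

text \<open>Complementation reverses hops and reflection restores their direction, so the hop from a
  becomes the one from n - a. Unit hops carry no signs that would have to be tracked.\<close>

lemma fock_f_dual: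
  assumes "j \<le> n"
  shows "fock_f n j x (dual_set n S) = fock_f n (n - j) (\<lambda>S. x (dual_set n S)) S"
proof (cases "maya S")
  case True
  have "fock_f n j x (dual_set n S) = (\<Sum>a | a \<notin> dual_set n S \<and> a + 1 \<in> dual_set n S.
      of_int (residue n j a) * x (insert a (dual_set n S - {a + 1})))"
    using True by (intro fock_f_apply) simp
  also have "\<dots> = (\<Sum>b | b \<notin> S \<and> b + 1 \<in> S. of_int (residue n (n - j) b) * x (dual_set n (insert b (S - {b + 1}))))"
  proof (rule sum.reindex_bij_witness[of _ "\<lambda>b. int n - b" "\<lambda>a. int n - a"])
    fix a assume a: "a \<in> {a. a \<notin> dual_set n S \<and> a + 1 \<in> dual_set n S}"
    then show "int n - a \<in> {b. b \<notin> S \<and> b + 1 \<in> S}" by (simp add: dual_set_def algebra_simps)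
    have "dual_set n (insert (int n - a) (S - {int n - a + 1})) = insert a (dual_set n S - {a + 1})"
      using a by (auto simp: dual_set_def algebra_simps)
    then show "of_int (residue n (n - j) (int n - a)) * x (dual_set n (insert (int n - a) (S - {int n - a + 1})))
       = of_int (residue n j a) * x (insert a (dual_set n S - {a + 1}))"
      using residue_dual[OF assms, of "int n - a"] by simp
  qed (auto simp: dual_set_def algebra_simps)
  also have "\<dots> = fock_f n (n - j) (\<lambda>S. x (dual_set n S)) S" using True by (simp add: fock_f_apply)
  finally show ?thesis .
qed (simp add: fock_f_def hop_not_maya)

lemma word_space_dual:
  assumes "x \<in> word_space n i N" "i \<le> n"
  shows "(\<lambda>S. x (dual_set n S)) \<in> word_space n (n - i) N"
  using assms(1)
proof (induction rule: word_space_induct)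
  case zero
  have "(\<lambda>S. (0 :: fock) (dual_set n S)) = 0" by (simp add: fun_eq_iff zero_fun_apply)
  then show ?case by simp
next
  case (add c w y)
  have "(\<lambda>S. fock_word n i w (dual_set n S)) = fock_word n (n - i) (map (\<lambda>j. n - j) w)"
    using add(2)
  proof (induction w)
    case Nil
    then show ?case using assms(2) by (simp add: vacuum_dual_set fun_eq_iff)
  next
    case (Cons k w)
    then have "k \<le> n" by simp
    then show ?case using Cons by (simp add: fock_f_dual)
  qed
  moreover have "fock_word n (n - i) (map (\<lambda>j. n - j) w) \<in> word_space n (n - i) N"
    using add by (intro word_space_word) auto
  ultimately have w: "(\<lambda>S. fock_word n i w (dual_set n S)) \<in> word_space n (n - i) N" by simp
  have "(\<lambda>S. (fscale c (fock_word n i w) + y) (dual_set n S)) =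
      fscale c (\<lambda>S. fock_word n i w (dual_set n S)) + (\<lambda>S. y (dual_set n S))"
    by (simp add: fun_eq_iff fscale_def plus_fun_apply)
  then show ?case using w add by (simp add: word_space_add word_space_scale)
qed

subsection \<open>Vanishing on good configurations\<close>

text \<open>The smallest hole is paired with the largest particle, and so on inwards. If the pair at
  position j violates a bound, j + 1 holes (or particles) face at most j partners beyond the
  threshold. The hypotheses speak of violating pairs only, as \<open>straightening\<close> applies
  just to the thresholds that these produce.\<close>

lemma sorted_pairing:
  fixes H P :: "int set"
  assumes "finite H" "finite P" "card H = card P"
    and low: "\<And>a p. a \<in> H \<Longrightarrow> p \<in> P \<Longrightarrow> a + p < 1 \<Longrightarrow>
        card {a' \<in> H. a' \<le> a} \<le> card {p' \<in> P. 1 - a \<le> p'}"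
    and high: "\<And>a p. a \<in> H \<Longrightarrow> p \<in> P \<Longrightarrow> a + p > c \<Longrightarrow>
        card {p' \<in> P. p \<le> p'} \<le> card {a' \<in> H. a' \<le> c - p}"
  obtains hs where "sorted_wrt (\<lambda>(a, p) (a', p'). a < a' \<and> p' < p) hs" "fst ` set hs = H" "snd ` set hs = P"
    "\<forall>(a, p)\<in>set hs. 1 \<le> a + p \<and> a + p \<le> c" "(\<Sum>(a, p)\<leftarrow>hs. p - a) = \<Sum>P - \<Sum>H"
proof -
  define as where "as = sorted_list_of_set H"
  define ps where "ps = rev (sorted_list_of_set P)"
  have len: "length as = card H" "length ps = card H" using assms(3) by (simp_all add: as_def ps_def)
  have set: "set as = H" "set ps = P" using assms by (simp_all add: as_def ps_def)
  have dist: "distinct as" "distinct ps" by (simp_all add: as_def ps_def)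
  have as: "as ! j < as ! k" if "j < k" "k < card H" for j k
    using that len strict_sorted_list_of_set[of H] unfolding as_def by (simp add: sorted_wrt_iff_nth_less)
  have ps: "ps ! k < ps ! j" if "j < k" "k < card H" for j k
  proof -
    have "sorted_wrt (\<lambda>x y. y < x) ps" unfolding ps_def sorted_wrt_rev by simp
    then show ?thesis using that len by (simp add: sorted_wrt_iff_nth_less)
  qed
  define hs where "hs = zip as ps"
  have hs: "length hs = card H" "\<And>j. j < card H \<Longrightarrow> hs ! j = (as ! j, ps ! j)" by (simp_all add: hs_def len)
  have mapf: "map fst hs = as" "map snd hs = ps" by (simp_all add: hs_def len)
  have "1 \<le> as ! j + ps ! j \<and> as ! j + ps ! j \<le> c" if j: "j < card H" for j
  proof (rule ccontr)
    assume "\<not> (1 \<le> as ! j + ps ! j \<and> as ! j + ps ! j \<le> c)"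
    then consider "as ! j + ps ! j < 1" | "as ! j + ps ! j > c" by linarith
    then show False
    proof cases
      case 1
      have "(\<lambda>k. as ! k) ` {..j} \<subseteq> {a' \<in> H. a' \<le> as ! j}"
      proof -
        have "as ! k \<le> as ! j" if "k \<le> j" for k using as[of k j] j that by (cases "k = j") auto
        moreover have "as ! k \<in> H" if "k \<le> j" for k using set(1) len j that nth_mem[of k as] by simp
        ultimately show ?thesis by auto
      qed
      then have "card ((\<lambda>k. as ! k) ` {..j}) \<le> card {a' \<in> H. a' \<le> as ! j}"
        using assms(1) by (intro card_mono) auto
      moreover have "card ((\<lambda>k. as ! k) ` {..j}) = Suc j"
        using dist j len by (subst card_image) (auto simp: inj_on_def nth_eq_iff_index_eq)
      moreover have "{p' \<in> P. 1 - as ! j \<le> p'} \<subseteq> (\<lambda>k. ps ! k) ` {..<j}"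
      proof
        fix p' assume p': "p' \<in> {p' \<in> P. 1 - as ! j \<le> p'}"
        then obtain k where k: "k < card H" "p' = ps ! k" using set len by (auto simp: in_set_conv_nth)
        have "ps ! j < ps ! k" using p' k 1 by auto
        then have "k < j" using ps[of j k] k by (metis less_asym linorder_neqE_nat)
        then show "p' \<in> (\<lambda>k. ps ! k) ` {..<j}" using k by blast
      qed
      then have "card {p' \<in> P. 1 - as ! j \<le> p'} \<le> j"
        by (metis card_lessThan finite_lessThan surj_card_le)
      moreover have "card {a' \<in> H. a' \<le> as ! j} \<le> card {p' \<in> P. 1 - as ! j \<le> p'}"
        using set len j 1 by (intro low[of _ "ps ! j"]) auto
      ultimately show False by simp
    next
      case 2
      have "(\<lambda>k. ps ! k) ` {..j} \<subseteq> {p' \<in> P. ps ! j \<le> p'}"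
      proof -
        have "ps ! j \<le> ps ! k" if "k \<le> j" for k using ps[of k j] j that by (cases "k = j") auto
        moreover have "ps ! k \<in> P" if "k \<le> j" for k using set(2) len j that nth_mem[of k ps] by simp
        ultimately show ?thesis by auto
      qed
      then have "card ((\<lambda>k. ps ! k) ` {..j}) \<le> card {p' \<in> P. ps ! j \<le> p'}"
        using assms(2) by (intro card_mono) auto
      moreover have "card ((\<lambda>k. ps ! k) ` {..j}) = Suc j"
        using dist j len by (subst card_image) (auto simp: inj_on_def nth_eq_iff_index_eq)
      moreover have "{a' \<in> H. a' \<le> c - ps ! j} \<subseteq> (\<lambda>k. as ! k) ` {..<j}"
      proof
        fix a' assume a': "a' \<in> {a' \<in> H. a' \<le> c - ps ! j}"
        then obtain k where k: "k < card H" "a' = as ! k" using set len by (auto simp: in_set_conv_nth)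
        have "as ! k < as ! j" using a' k 2 by auto
        then have "k < j" using as[of j k] k by (metis less_asym linorder_neqE_nat)
        then show "a' \<in> (\<lambda>k. as ! k) ` {..<j}" using k by blast
      qed
      then have "card {a' \<in> H. a' \<le> c - ps ! j} \<le> j"
        by (metis card_lessThan finite_lessThan surj_card_le)
      moreover have "card {p' \<in> P. ps ! j \<le> p'} \<le> card {a' \<in> H. a' \<le> c - ps ! j}"
        using set len j 2 by (intro high[of "as ! j"]) auto
      ultimately show False by simp
    qed
  qed
  then have "\<forall>(a, p)\<in>set hs. 1 \<le> a + p \<and> a + p \<le> c"
    using hs by (auto simp: in_set_conv_nth)
  moreover have "sorted_wrt (\<lambda>(a, p) (a', p'). a < a' \<and> p' < p) hs"
    using hs as ps by (auto simp: sorted_wrt_iff_nth_less)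
  moreover have "fst ` set hs = H" "snd ` set hs = P"
    using set mapf by (metis set_map)+
  moreover have "(\<Sum>(a, p)\<leftarrow>hs. p - a) = \<Sum>P - \<Sum>H"
  proof -
    have "(\<Sum>(a, p)\<leftarrow>hs. p - a) = sum_list (map snd hs) - sum_list (map fst hs)" by (induction hs) auto
    also have "\<dots> = \<Sum>P - \<Sum>H" unfolding mapf using dist set by (metis sum_list_distinct_conv_sum_set sum.cong list.map_ident)
    finally show ?thesis .
  qed
  ultimately show thesis using that by blast
qed

text \<open>A nonzero vector is tested at an extremal configuration of its support. Hole count and
  energy are preserved by duality there, so the configuration is extremal for the dual vector as
  well, and the two families of inequalities force it to be good.\<close>

lemma word_space_eq_0:
  assumes x: "x \<in> word_space n i N" and "i \<le> n" "n \<ge> 1"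
    and good: "\<And>hs. hs \<in> good_lists n i N \<Longrightarrow> x (hook_set i hs) = 0"
  shows "x = 0"
proof (rule ccontr)
  assume "x \<noteq> 0"
  have conf: "S \<in> conf i N" if "x S \<noteq> 0" for S
    using homogeneous_word_space[OF x] that by (auto simp: homogeneous_def)
  define A where "A = {S. x S \<noteq> 0}"
  have A: "finite A" "A \<noteq> {}"
  proof -
    show "finite A" using conf by (intro finite_subset[OF _ finite_conf[of i N]]) (auto simp: A_def)
    show "A \<noteq> {}" using \<open>x \<noteq> 0\<close> by (auto simp: A_def fun_eq_iff zero_fun_apply)
  qed
  define k where "k = Max ((\<lambda>S. card (holes i S)) ` A)"
  define A' where "A' = {S \<in> A. card (holes i S) = k}"
  have "k \<in> (\<lambda>S. card (holes i S)) ` A" unfolding k_def using A by (intro Max_in) auto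
  then have A': "finite A'" "A' \<noteq> {}" using A by (auto simp: A'_def)
  have le: "card (holes i S) \<le> k" if "x S \<noteq> 0" for S
    unfolding k_def using A that by (intro Max_ge) (auto simp: A_def)
  obtain S0 where S0: "S0 \<in> A'" "\<And>S. S \<in> A' \<Longrightarrow> energy n i S0 \<le> energy n i S"
    using arg_min_if_finite[OF A', of "energy n i"] by (metis linorder_not_less)
  have xS0: "x S0 \<noteq> 0" "card (holes i S0) = k" using S0 by (auto simp: A'_def A_def)
  have maya: "maya S0" using conf[OF xS0(1)] conf_maya by blast
  \<comment> \<open>At charge 0 particles and holes are equally many, so duality preserves the
    number of holes.\<close>
  have pk: "card (particles i S) = card (holes i S)" if "x S \<noteq> 0" for S
    using conf_card[OF conf[OF that]] by (simp add: particles_def holes_def)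
  have E: "card {a \<in> holes i S0. a \<le> 1 - \<theta>} \<le> card {p \<in> particles i S0. \<theta> \<le> p}" if "int i < \<theta>" for \<theta>
    using that S0 xS0 maya le raise_word_space[OF x] assms(3)
    by (intro straightening[of x n]) (auto simp: A'_def A_def)
  define x' where "x' = (\<lambda>S. x (dual_set n S))"
  define S1 where "S1 = dual_set n S0"
  have x': "x' \<in> word_space n (n - i) N" unfolding x'_def by (rule word_space_dual) (use x assms in auto)
  have card': "card (holes (n - i) S) = card (holes i (dual_set n S))" if "x' S \<noteq> 0" for S
  proof -
    have "card (holes (n - i) (dual_set n (dual_set n S))) = card (particles i (dual_set n S))"
      unfolding holes_dual_set[OF assms(2)] by (rule card_image) (auto intro: inj_onI)
    then show ?thesis using pk[of "dual_set n S"] that by (simp add: x'_def)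
  qed
  have energy': "energy n (n - i) S = energy n i (dual_set n S)" for S
    using energy_dual_set[OF assms(2), of "dual_set n S"] by simp
  have xS1: "x' S1 \<noteq> 0" using xS0 by (simp add: x'_def S1_def)
  have F': "card {a \<in> holes (n - i) S1. a \<le> 1 - \<theta>} \<le> card {p \<in> particles (n - i) S1. \<theta> \<le> p}" if "int (n - i) < \<theta>" for \<theta>
  proof (rule straightening[of x' n])
    fix S assume S: "x' S \<noteq> 0"
    then have xS: "x (dual_set n S) \<noteq> 0" by (simp add: x'_def)
    show "card (holes (n - i) S) \<le> card (holes (n - i) S1)"
      using card'[OF S] card'[OF xS1] le[OF xS] xS0 by (simp add: S1_def)
    assume "card (holes (n - i) S) = card (holes (n - i) S1)"
    then have "dual_set n S \<in> A'" using card'[OF S] card'[OF xS1] xS xS0 by (simp add: S1_def A'_def A_def)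
    then show "energy n (n - i) S1 \<le> energy n (n - i) S" using S0(2) by (simp add: energy' S1_def)
  qed (use raise_word_space[OF x'] assms maya xS1 that in \<open>auto simp: S1_def\<close>)
  \<comment> \<open>The dual inequality at the threshold p - n, read in terms of S0.\<close>
  have F: "card {p' \<in> particles i S0. p \<le> p'} \<le> card {a' \<in> holes i S0. a' \<le> 2 * int n + 1 - p}" if "int (n - i) < p - int n" for p
  proof -
    have inj: "inj_on (\<lambda>a::int. int n + 1 - a) A" for A by (auto intro: inj_onI)
    have "{a \<in> holes (n - i) S1. a \<le> 1 - (p - int n)} = (\<lambda>a. int n + 1 - a) ` {p' \<in> particles i S0. p \<le> p'}"
      unfolding S1_def holes_dual_set[OF assms(2)] by auto
    moreover have "{a \<in> particles (n - i) S1. p - int n \<le> a} = (\<lambda>a. int n + 1 - a) ` {a' \<in> holes i S0. a' \<le> 2 * int n + 1 - p}"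
      unfolding S1_def particles_dual_set[OF assms(2)] by auto
    ultimately show ?thesis using F'[OF that] by (simp add: card_image[OF inj])
  qed
  have Hle: "a \<le> int i" if "a \<in> holes i S0" for a using that by (simp add: holes_def)
  have Pge: "int i < p" if "p \<in> particles i S0" for p using that by (simp add: particles_def)
  obtain hs where hs: "sorted_wrt (\<lambda>(a, p) (a', p'). a < a' \<and> p' < p) hs" "fst ` set hs = holes i S0"
    "snd ` set hs = particles i S0" "\<forall>(a, p)\<in>set hs. 1 \<le> a + p \<and> a + p \<le> 2 * int n + 1"
    "(\<Sum>(a, p)\<leftarrow>hs. p - a) = \<Sum>(particles i S0) - \<Sum>(holes i S0)"
  proof (rule sorted_pairing[of "holes i S0" "particles i S0" "2 * int n + 1"])
    fix a p assume ap: "a \<in> holes i S0" "p \<in> particles i S0"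
    show "card {a' \<in> holes i S0. a' \<le> a} \<le> card {p' \<in> particles i S0. 1 - a \<le> p'}" if "a + p < 1"
      using E[of "1 - a"] that Pge[OF ap(2)] by simp
    show "card {p' \<in> particles i S0. p \<le> p'} \<le> card {a' \<in> holes i S0. a' \<le> 2 * int n + 1 - p}" if "a + p > 2 * int n + 1"
      using F[of p] that Hle[OF ap(1)] assms(2) by simp
  qed (use maya pk[OF xS0(1)] in \<open>auto simp: finite_holes finite_particles\<close>)
  have "good_list n i hs"
    unfolding good_list_def using hs(1,4) Hle Pge unfolding hs(2,3)[symmetric] by force
  moreover have "hooks_size hs = N"
    using conf[OF xS0(1)] hs(5) unfolding hooks_size_def conf_def msum_def holes_def particles_def by simp
  ultimately have "hs \<in> good_lists n i N" by (simp add: good_lists_def)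
  moreover have "hook_set i hs = S0"
    unfolding hook_set_def hs(2,3) by (auto simp: holes_def particles_def)
  ultimately show False using good xS0 by auto
qed

text \<open>Evaluation at good configurations is injective on the whole space by
  \<open>word_space_eq_0\<close> and bijective on combinations of hook vectors by
  triangularity.\<close>

theorem word_space_basis:
  assumes "i \<le> n" "n \<ge> 1"
  shows "hs \<in> good_lists n i N \<Longrightarrow> hook_vec n i hs \<in> word_space n i N"
    and "(\<Sum>hs\<in>good_lists n i N. fscale (t hs) (hook_vec n i hs)) = 0 \<Longrightarrow> hs \<in> good_lists n i N \<Longrightarrow> t hs = 0"
    and "x \<in> word_space n i N \<Longrightarrow> \<exists>t. x = (\<Sum>hs\<in>good_lists n i N. fscale (t hs) (hook_vec n i hs))"
proof -
  have apply_sum: "(\<Sum>hs\<in>A. fscale (t hs) (hook_vec n i hs)) S = (\<Sum>hs\<in>A. t hs * hook_vec n i hs S)" for A t S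
    by (induction A rule: infinite_finite_induct) (simp_all add: fun_simps fscale_def)
  show mem: "hook_vec n i hs \<in> word_space n i N" if "hs \<in> good_lists n i N" for hs
    using that hook_vec_word_space[of n i hs] assms by (auto simp: good_lists_def)
  show "t hs = 0" if "(\<Sum>hs\<in>good_lists n i N. fscale (t hs) (hook_vec n i hs)) = 0" "hs \<in> good_lists n i N" for t hs
  proof (rule hook_vec_triangular(2)[OF assms(2) _ that(2)])
    fix hs' show "(\<Sum>hs\<in>good_lists n i N. t hs * hook_vec n i hs (hook_set i hs')) = 0"
      using fun_cong[OF that(1), of "hook_set i hs'"] by (simp add: apply_sum zero_fun_apply)
  qed
  show "\<exists>t. x = (\<Sum>hs\<in>good_lists n i N. fscale (t hs) (hook_vec n i hs))" if x: "x \<in> word_space n i N"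
  proof -
    obtain t where t: "\<And>hs'. hs' \<in> good_lists n i N \<Longrightarrow>
        (\<Sum>hs\<in>good_lists n i N. t hs * hook_vec n i hs (hook_set i hs')) = x (hook_set i hs')"
      using hook_vec_triangular(1)[OF assms(2), of i N "\<lambda>hs. x (hook_set i hs)"] by blast
    let ?s = "\<Sum>hs\<in>good_lists n i N. fscale (t hs) (hook_vec n i hs)"
    have "?s \<in> word_space n i N"
      using mem unfolding word_space_def by (intro fock.span_sum fock.span_scale) auto
    then have "x - ?s = 0"
      using x t assms by (intro word_space_eq_0[of _ n i N] word_space_diff) (auto simp: minus_apply apply_sum)
    then show ?thesis by auto
  qed
qed

section \<open>Highest weight modules\<close>

lemma lie_class_eqI: "lie_eq n x y \<Longrightarrow> lie_class n x = lie_class n y"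
  unfolding lie_class_def using lie_eq.sym lie_eq.trans by blast

definition word_content :: "nat list \<Rightarrow> nat \<Rightarrow> nat" where
  "word_content w j = count_list w j"

context C1_module
begin

abbreviation "op_e j \<equiv> act (lie_class n (Gen_e j))"
abbreviation "op_f j \<equiv> act (lie_class n (Gen_f j))"
abbreviation "op_h j \<equiv> act (lie_class n (Gen_h j))"
abbreviation "op_d \<equiv> act (lie_class n Gen_d)"

lemma V_add: "u \<in> V \<Longrightarrow> v \<in> V \<Longrightarrow> u + v \<in> V"
  and V_scale: "v \<in> V \<Longrightarrow> scale c v \<in> V"
  and V_zero: "0 \<in> V"
  using subspace_V by (auto intro: subspace_add subspace_scale subspace_0)

lemma act_0 [simp]: "act (lie_class n x) 0 = 0"
  using act_vec_scale[OF V_zero, of x 0] by simp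

lemma act_Zero: "v \<in> V \<Longrightarrow> act (lie_class n Zero) v = 0"
  using act_add[of v Zero Zero] lie_class_eqI[OF lie_eq.add_zero, of n Zero] by simp

lemma act_eq: "lie_eq n x y \<Longrightarrow> act (lie_class n x) v = act (lie_class n y) v"
  by (simp add: lie_class_eqI)

lemma op_e_f:
  assumes "v \<in> V" "j \<le> n" "k \<le> n"
  shows "op_e j (op_f k v) = op_f k (op_e j v) + (if j = k then op_h j v else 0)"
  using act_bracket[OF assms(1), of "Gen_e j" "Gen_f k"] act_eq[OF lie_eq.e_f[OF assms(2,3)], of v] act_Zero[OF assms(1)]
  by (auto simp: algebra_simps split: if_splits)

lemma op_h_f:
  assumes "v \<in> V" "j \<le> n" "k \<le> n"
  shows "op_h j (op_f k v) = op_f k (op_h j v) + scale (- of_int (cartan n j k)) (op_f k v)"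
  using act_bracket[OF assms(1), of "Gen_h j" "Gen_f k"] act_eq[OF lie_eq.h_f[OF assms(2,3)], of v] act_scale[OF assms(1)]
  by (auto simp: algebra_simps)

lemma op_d_f:
  assumes "v \<in> V" "k \<le> n"
  shows "op_d (op_f k v) = op_f k (op_d v) + scale (- of_bool (k = 0)) (op_f k v)"
  using act_bracket[OF assms(1), of Gen_d "Gen_f k"] act_eq[OF lie_eq.d_f[OF assms(2)], of v] act_scale[OF assms(1)]
  by (auto simp: algebra_simps)

lemma op_e_h:
  assumes "v \<in> V" "j \<le> n" "k \<le> n"
  shows "op_e k (op_h j v) = op_h j (op_e k v) - scale (of_int (cartan n j k)) (op_e k v)"
  using act_bracket[OF assms(1), of "Gen_h j" "Gen_e k"] act_eq[OF lie_eq.h_e[OF assms(2,3)], of v] act_scale[OF assms(1)]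
  by (auto simp: algebra_simps)

lemma op_e_d:
  assumes "v \<in> V" "k \<le> n"
  shows "op_e k (op_d v) = op_d (op_e k v) - scale (of_bool (k = 0)) (op_e k v)"
  using act_bracket[OF assms(1), of Gen_d "Gen_e k"] act_eq[OF lie_eq.d_e[OF assms(2)], of v] act_scale[OF assms(1)]
  by (auto simp: algebra_simps)

text \<open>Closure under the generators suffices, by induction on Lie expressions; generators of
  index above n act as 0.\<close>

lemma submoduleI:
  assumes "subspace W" "W \<subseteq> V"
    and closed: "\<And>j v. j \<le> n \<Longrightarrow> v \<in> W \<Longrightarrow> op_e j v \<in> W \<and> op_f j v \<in> W \<and> op_h j v \<in> W"
      "\<And>v. v \<in> W \<Longrightarrow> op_d v \<in> W"
  shows "submodule W"
proof -
  have "act (lie_class n x) v \<in> W" if "v \<in> W" for x v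
    using that
  proof (induction x arbitrary: v)
    case (Gen_e j)
    then show ?case using closed(1)[of j v] act_eq[OF lie_eq.no_e, of j v] act_Zero assms subspace_0
      by (cases "j \<le> n") auto
  next
    case (Gen_f j)
    then show ?case using closed(1)[of j v] act_eq[OF lie_eq.no_f, of j v] act_Zero assms subspace_0
      by (cases "j \<le> n") auto
  next
    case (Gen_h j)
    then show ?case using closed(1)[of j v] act_eq[OF lie_eq.no_h, of j v] act_Zero assms subspace_0
      by (cases "j \<le> n") auto
  next
    case Gen_d
    then show ?case using closed(2) by simp
  next
    case Zero
    then have "v \<in> V" using assms(2) by blast
    then show ?case using assms(1) by (simp add: act_Zero subspace_0)
  next
    case (Add x y)
    then have "v \<in> V" using assms(2) by blast
    then show ?case using Add assms(1) by (simp add: act_add subspace_add)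
  next
    case (Scale c x)
    then have "v \<in> V" using assms(2) by blast
    then show ?case using Scale assms(1) by (simp add: act_scale subspace_scale)
  next
    case (Bracket x y)
    then have "v \<in> V" using assms(2) by blast
    then show ?case using Bracket assms(1) by (simp add: act_bracket subspace_diff)
  qed
  then show ?thesis using assms by (simp add: submodule_def)
qed

definition op_word :: "nat list \<Rightarrow> 'v \<Rightarrow> 'v" where
  "op_word w v = foldr op_f w v"

lemma op_word_simps [simp]: "op_word [] v = v" "op_word (k # w) v = op_f k (op_word w v)"
  by (simp_all add: op_word_def)

lemma op_word_V [simp]: "v \<in> V \<Longrightarrow> op_word w v \<in> V"
  by (induction w) (auto intro: act_closed)

lemma act_span:
  assumes "S \<subseteq> V" "x \<in> span S" "\<And>s. s \<in> S \<Longrightarrow> act (lie_class n g) s \<in> span T"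
  shows "act (lie_class n g) x \<in> span T"
proof -
  have "span S \<subseteq> V" using assms(1) subspace_V span_minimal by blast
  have "act (lie_class n g) x \<in> span T \<and> x \<in> span S" using assms(2)
  proof (induction rule: span_induct_alt)
    case base
    show ?case by (simp add: span_zero)
  next
    case (step c s y)
    then have "act (lie_class n g) (scale c s + y) = scale c (act (lie_class n g) s) + act (lie_class n g) y"
      using \<open>span S \<subseteq> V\<close> assms(1) V_scale by (subst act_vec_add) (auto simp: act_vec_scale)
    then show ?case using step assms(3) by (auto intro: span_add span_scale span_base)
  qed
  then show ?thesis ..
qed

text \<open>Moving e_j, h_j and d through a word down to Y stays in the span. With Y spanned by the
  highest weight vector this gives V; with Y consisting of singular vectors of positive degree it
  leads to a contradiction.\<close>

lemma singular_submodule: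
  assumes "Y \<subseteq> V" "subspace Y"
    and "\<And>j y. j \<le> n \<Longrightarrow> y \<in> Y \<Longrightarrow> op_e j y = 0 \<and> op_h j y \<in> Y"
    and "\<And>y. y \<in> Y \<Longrightarrow> op_d y \<in> Y"
  shows "submodule (span {op_word w y | w y. set w \<subseteq> {..n} \<and> y \<in> Y})"
proof -
  let ?S = "{op_word w y | w y. set w \<subseteq> {..n} \<and> y \<in> Y}"
  have SV: "?S \<subseteq> V" using assms(1) by auto
  have base: "op_word w y \<in> span ?S" if "set w \<subseteq> {..n}" "y \<in> Y" for w y
    using that by (intro span_base) blast
  have f: "op_f k x \<in> span ?S" if "x \<in> span ?S" "k \<le> n" for k x
  proof (rule act_span[OF SV that(1)])
    fix s assume "s \<in> ?S"
    then obtain w y where "s = op_word w y" "set w \<subseteq> {..n}" "y \<in> Y" by blast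
    then have "op_f k s = op_word (k # w) y \<and> set (k # w) \<subseteq> {..n}" using that by simp
    then show "op_f k s \<in> span ?S" using \<open>y \<in> Y\<close> by (intro span_base) blast
  qed
  have h: "op_h j (op_word w y) \<in> span ?S" if "set w \<subseteq> {..n}" "y \<in> Y" "j \<le> n" for j w y
    using that(1)
  proof (induction w)
    case Nil
    show ?case using assms(3)[OF that(3,2)] base[of "[]" "op_h j y"] by simp
  next
    case (Cons k w)
    have V: "op_word w y \<in> V" using that assms(1) by auto
    have w: "op_word w y \<in> span ?S" using Cons.prems that by (intro base) auto
    then show ?case using Cons that op_h_f[OF V that(3)] f by (auto intro!: span_add span_diff span_scale)
  qed
  have d: "op_d (op_word w y) \<in> span ?S" if "set w \<subseteq> {..n}" "y \<in> Y" for w y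
    using that(1)
  proof (induction w)
    case Nil
    show ?case using assms(4)[OF that(2)] base[of "[]" "op_d y"] by simp
  next
    case (Cons k w)
    have V: "op_word w y \<in> V" using that assms(1) by auto
    have w: "op_word w y \<in> span ?S" using Cons.prems that by (intro base) auto
    then show ?case using Cons that op_d_f[OF V] f by (auto intro!: span_add span_diff span_scale)
  qed
  have e: "op_e j (op_word w y) \<in> span ?S" if "set w \<subseteq> {..n}" "y \<in> Y" "j \<le> n" for j w y
    using that(1)
  proof (induction w)
    case Nil
    then show ?case using assms(3)[OF that(3,2)] by (simp add: span_zero)
  next
    case (Cons k w)
    have V: "op_word w y \<in> V" using that assms(1) by auto
    show ?case using Cons that op_e_f[OF V that(3)] f h by (auto intro!: span_add)
  qed
  show ?thesis
  proof (rule submoduleI)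
    show "span ?S \<subseteq> V" using SV subspace_V span_minimal by blast
  next
    fix j v assume jv: "j \<le> n" "v \<in> span ?S"
    have "op_e j v \<in> span ?S" by (rule act_span[OF SV jv(2)]) (use e jv in blast)
    moreover have "op_h j v \<in> span ?S" by (rule act_span[OF SV jv(2)]) (use h jv in blast)
    ultimately show "op_e j v \<in> span ?S \<and> op_f j v \<in> span ?S \<and> op_h j v \<in> span ?S"
      using f jv by blast
  next
    fix v assume "v \<in> span ?S"
    then show "op_d v \<in> span ?S" by (rule act_span[OF SV]) (use d in blast)
  qed simp
qed

lemma weight_space_subspace: "subspace (weight_space \<mu>)"
  unfolding weight_space_def
  by (intro subspaceI) (auto simp: V_zero V_add V_scale act_vec_add act_vec_scale algebra_simps)

lemma weight_space_V: "weight_space \<mu> \<subseteq> V"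
  by (auto simp: weight_space_def)

text \<open>Distinctness refers to the coordinates up to n and to d, as these alone determine
  \<open>weight_space\<close>.\<close>

lemma weight_spaces_independent:
  assumes "finite A"
    and distinct: "\<And>a b. a \<in> A \<Longrightarrow> b \<in> A \<Longrightarrow> a \<noteq> b \<Longrightarrow>
      (\<exists>k\<le>n. fst (\<mu> a) k \<noteq> fst (\<mu> b) k) \<or> snd (\<mu> a) \<noteq> snd (\<mu> b)"
    and "\<And>a. a \<in> A \<Longrightarrow> y a \<in> weight_space (\<mu> a)" "(\<Sum>a\<in>A. y a) = 0" "a \<in> A"
  shows "y a = 0"
  using assms
proof (induction "card A" arbitrary: A y a)
  case (Suc N)
  have other: "y b = 0" if b: "b \<in> A" "b \<noteq> a" for b
  proof -
    \<comment> \<open>An element of the Cartan subalgebra separating a from b; acting with it and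
      subtracting its eigenvalue at a removes the summand y a.\<close>
    obtain g c where g: "\<And>a' v. v \<in> weight_space (\<mu> a') \<Longrightarrow> act (lie_class n g) v = scale (c a') v" "c b \<noteq> c a"
    proof (cases "snd (\<mu> b) = snd (\<mu> a)")
      case True
      then obtain k where "k \<le> n" "fst (\<mu> b) k \<noteq> fst (\<mu> a) k" using Suc.prems(2)[OF b(1) Suc.prems(5) b(2)] by blast
      then show ?thesis by (intro that[of "Gen_h k" "\<lambda>a. fst (\<mu> a) k"]) (auto simp: weight_space_def)
    next
      case False
      then show ?thesis by (intro that[of Gen_d "\<lambda>a. snd (\<mu> a)"]) (auto simp: weight_space_def)
    qed
    have sumV: "(\<Sum>a\<in>B. y a) \<in> V \<and> act (lie_class n g) (\<Sum>a\<in>B. y a) = (\<Sum>a\<in>B. scale (c a) (y a))" if "B \<subseteq> A" for B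
      using finite_subset[OF that Suc.prems(1)] that
    proof (induction B rule: finite_induct)
      case (insert x B)
      then have "y x \<in> weight_space (\<mu> x)" "y x \<in> V" using Suc.prems(3) weight_space_V by blast+
      with insert show ?case by (auto simp: V_add act_vec_add g)
    qed (simp add: V_zero)
    have "(\<Sum>a'\<in>A. scale (c a' - c a) (y a')) = 0"
      using sumV[of A] Suc.prems(4) by (simp add: scale_left_diff_distrib sum_subtractf flip: scale_sum_right)
    then have "(\<Sum>a'\<in>A - {a}. scale (c a' - c a) (y a')) = 0"
      using Suc.prems(1,5) by (simp add: sum.remove)
    then have "scale (c b - c a) (y b) = 0"
      using Suc.hyps(1)[of "A - {a}" "\<lambda>a'. scale (c a' - c a) (y a')" b] Suc.hyps(2) Suc.prems b
        subspace_scale[OF weight_space_subspace]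
      by auto
    then show ?thesis using g(2) by simp
  qed
  have "y a = (\<Sum>a\<in>A. y a)" using Suc.prems(1,5) other by (subst sum.remove[of _ a]) auto
  then show ?case using Suc.prems(4) by simp
qed auto

end

lemma fst_root_combination:
  "fst (root_combination n m) k = (\<Sum>j\<le>n. of_nat (m j) * fst (simple_root n j) k)"
proof -
  have "(\<Sum>j\<in>A. f j) k = (\<Sum>j\<in>A. f j k)" for f :: "nat \<Rightarrow> nat \<Rightarrow> complex" and A
    by (induction A rule: infinite_finite_induct) (simp_all add: fun_simps)
  then show ?thesis by (simp add: root_combination_def fst_sum)
qed

lemma snd_root_combination:
  "snd (root_combination n m) = of_nat (m 0)"
proof -
  have "snd (root_combination n m) = (\<Sum>j\<le>n. if j = 0 then of_nat (m j) else 0)"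
    unfolding root_combination_def snd_sum by (intro sum.cong) (auto simp: simple_root_def)
  also have "\<dots> = of_nat (m 0)" by simp
  finally show ?thesis .
qed

lemma root_combination_content:
  assumes "set w \<subseteq> {..n}"
  shows "k \<le> n \<Longrightarrow> fst (root_combination n (word_content w)) k = (\<Sum>l\<leftarrow>w. of_int (cartan n k l))"
    and "snd (root_combination n (word_content w)) = (\<Sum>l\<leftarrow>w. of_bool (l = 0))"
proof -
  show "fst (root_combination n (word_content w)) k = (\<Sum>l\<leftarrow>w. of_int (cartan n k l))" if "k \<le> n"
    using assms
  proof (induction w)
    case Nil
    show ?case by (simp add: fst_root_combination word_content_def)
  next
    case (Cons l w)
    have "fst (root_combination n (word_content (l # w))) k =
      (\<Sum>j\<le>n. of_nat (word_content w j) * fst (simple_root n j) k + (if j = l then fst (simple_root n j) k else 0))"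
      unfolding fst_root_combination by (intro sum.cong) (auto simp: word_content_def algebra_simps)
    also have "\<dots> = fst (root_combination n (word_content w)) k + fst (simple_root n l) k"
      using Cons.prems by (simp add: sum.distrib fst_root_combination)
    finally show ?case using Cons that by (simp add: simple_root_def add.commute)
  qed
  show "snd (root_combination n (word_content w)) = (\<Sum>l\<leftarrow>w. of_bool (l = 0))"
    unfolding snd_root_combination by (induction w) (auto simp: word_content_def)
qed

definition contents :: "nat \<Rightarrow> (nat \<Rightarrow> nat) set" where
  "contents n = {m. \<forall>j>n. m j = 0}"

text \<open>The affine Cartan matrix is singular. The value on d supplies m 0, and row l of the
  tridiagonal matrix then determines m (l + 1), its entry in that column being nonzero.\<close>

lemma root_combination_inj:
  assumes "m \<in> contents n" "m' \<in> contents n" "n \<ge> 1"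
    and fst: "\<And>k. k \<le> n \<Longrightarrow> fst (root_combination n m) k = fst (root_combination n m') k"
    and snd: "snd (root_combination n m) = snd (root_combination n m')"
  shows "m = m'"
proof -
  have eq: "m k = m' k" if "k \<le> n" for k
    using that
  proof (induction k rule: less_induct)
    case (less k)
    show ?case
    proof (cases k)
      case 0
      then show ?thesis using snd by (simp add: snd_root_combination)
    next
      case (Suc l)
      let ?a = "\<lambda>j. complex_of_int (cartan n l j)"
      have l: "l \<le> n" using less.prems Suc by simp
      have "(\<Sum>j\<le>n. (of_nat (m j) - of_nat (m' j)) * ?a j) = 0"
        using fst[OF l] l by (simp add: fst_root_combination simple_root_def left_diff_distrib sum_subtractf)
      moreover have "(\<Sum>j\<le>n. (of_nat (m j) - of_nat (m' j)) * ?a j) = (\<Sum>j\<in>{k}. (of_nat (m j) - of_nat (m' j)) * ?a j)"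
      proof (rule sum.mono_neutral_right)
        show "\<forall>j\<in>{..n} - {k}. (of_nat (m j) - of_nat (m' j)) * ?a j = 0"
        proof
          fix j assume j: "j \<in> {..n} - {k}"
          then consider "j < k" | "k < j" by force
          then show "(of_nat (m j) - of_nat (m' j)) * ?a j = 0"
          proof cases
            case 1
            then show ?thesis using less.IH[of j] j by simp
          next
            case 2
            then show ?thesis using Suc by (simp add: cartan_def)
          qed
        qed
      qed (use less.prems in auto)
      ultimately have "(of_nat (m k) - of_nat (m' k)) * ?a k = 0" by simp
      moreover have "?a k \<noteq> 0" using Suc by (auto simp: cartan_def)
      ultimately have "complex_of_nat (m k) = of_nat (m' k)" by simp
      then show ?thesis by (simp only: of_nat_eq_iff)
    qed
  qed
  show ?thesis
  proof
    fix j show "m j = m' j" using eq[of j] assms(1,2) by (cases "j \<le> n") (auto simp: contents_def)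
  qed
qed

section \<open>Irreducible modules with a chosen highest weight vector\<close>

locale highest_weight_vector = irreducible_highest_weight_module +
  fixes v
  assumes v_weight: "v \<in> weight_space \<Lambda>" and v_nonzero: "v \<noteq> 0"
    and v_singular: "j \<le> n \<Longrightarrow> op_e j v = 0"
    and v_generates: "submodule W \<Longrightarrow> v \<in> W \<Longrightarrow> W = V"
    and n_pos: "n \<ge> 1"
begin

lemma v_V: "v \<in> V"
  using v_weight weight_space_V by blast

definition weight_of :: "(nat \<Rightarrow> nat) \<Rightarrow> weight" where
  "weight_of m = \<Lambda> - root_combination n m"

lemma op_h_word:
  assumes "set w \<subseteq> {..n}" "k \<le> n"
  shows "op_h k (op_word w v) = scale (fst \<Lambda> k - (\<Sum>l\<leftarrow>w. of_int (cartan n k l))) (op_word w v)"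
  using assms(1)
proof (induction w)
  case Nil
  show ?case using v_weight assms(2) by (simp add: weight_space_def)
next
  case (Cons l w)
  let ?c = "fst \<Lambda> k - (\<Sum>l\<leftarrow>w. of_int (cartan n k l))" and ?x = "op_f l (op_word w v)"
  have "op_h k ?x = op_f l (scale ?c (op_word w v)) + scale (- of_int (cartan n k l)) ?x"
    using op_h_f[of "op_word w v" k l] v_V assms(2) Cons by (simp del: scale_minus_left)
  also have "\<dots> = scale (?c + - of_int (cartan n k l)) ?x"
    using v_V by (simp only: act_vec_scale op_word_V scale_left_distrib)
  also have "?c + - of_int (cartan n k l) = fst \<Lambda> k - (\<Sum>l\<leftarrow>l # w. of_int (cartan n k l))" by simp
  finally show ?case by simp
qed

lemma op_d_word:
  assumes "set w \<subseteq> {..n}"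
  shows "op_d (op_word w v) = scale (snd \<Lambda> - (\<Sum>l\<leftarrow>w. of_bool (l = 0))) (op_word w v)"
  using assms(1)
proof (induction w)
  case Nil
  show ?case using v_weight by (simp add: weight_space_def)
next
  case (Cons l w)
  let ?c = "snd \<Lambda> - (\<Sum>l\<leftarrow>w. of_bool (l = 0))" and ?x = "op_f l (op_word w v)"
  have "op_d ?x = op_f l (scale ?c (op_word w v)) + scale (- of_bool (l = 0)) ?x"
    using op_d_f[of "op_word w v" l] v_V Cons by (simp del: scale_minus_left)
  also have "\<dots> = scale (?c + - of_bool (l = 0)) ?x"
    using v_V by (simp only: act_vec_scale op_word_V scale_left_distrib)
  also have "?c + - of_bool (l = 0) = snd \<Lambda> - (\<Sum>l\<leftarrow>l # w. of_bool (l = 0))" by simp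
  finally show ?case by simp
qed

lemma op_word_weight:
  assumes "set w \<subseteq> {..n}"
  shows "op_word w v \<in> weight_space (weight_of (word_content w))"
  using assms v_V
  by (simp add: weight_space_def weight_of_def op_h_word op_d_word root_combination_content minus_apply)

lemma op_e_word:
  assumes "set w \<subseteq> {..n}" "j \<le> n" "k \<le> n"
  shows "op_e j (op_f k (op_word w v)) = op_f k (op_e j (op_word w v)) +
    (if j = k then scale (fst \<Lambda> j - (\<Sum>l\<leftarrow>w. of_int (cartan n j l))) (op_word w v) else 0)"
  using op_e_f[of "op_word w v" j k] op_h_word[OF assms(1)] assms v_V by simp

definition word_span :: "nat \<Rightarrow> 'a set" where
  "word_span N = span ((\<lambda>w. op_word w v) ` {w. length w = N \<and> set w \<subseteq> {..n}})"

lemma word_span_V: "word_span N \<subseteq> V"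
  unfolding word_span_def using v_V subspace_V by (intro span_minimal) auto

lemma V_eq_span: "V = span ((\<lambda>w. op_word w v) ` {w. set w \<subseteq> {..n}})"
proof -
  have eig: "op_h j v = scale (fst \<Lambda> j) v" if "j \<le> n" for j using v_weight that by (simp add: weight_space_def)
  have d: "op_d v = scale (snd \<Lambda>) v" using v_weight by (simp add: weight_space_def)
  let ?Y = "span {v}"
  let ?S = "{op_word w y | w y. set w \<subseteq> {..n} \<and> y \<in> ?Y}"
  have Y: "y \<in> ?Y \<longleftrightarrow> (\<exists>c. y = scale c v)" for y by (auto simp: span_singleton)
  have "submodule (span ?S)"
  proof (rule singular_submodule)
    show "?Y \<subseteq> V" using v_V subspace_V by (intro span_minimal) auto
    show "op_e j y = 0 \<and> op_h j y \<in> ?Y" if "j \<le> n" "y \<in> ?Y" for j y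
      using that v_singular eig v_V by (auto simp: Y act_vec_scale)
    show "op_d y \<in> ?Y" if "y \<in> ?Y" for y
      using that d v_V by (auto simp: Y act_vec_scale)
  qed simp
  moreover have "v \<in> span ?S"
  proof -
    have "op_word [] v \<in> ?S" 
      by (intro CollectI exI[of _ "[]"] exI[of _ v]) (auto simp: span_base)
    then show ?thesis using span_base[of "op_word [] v" ?S] by simp
  qed
  ultimately have "V = span ?S" using v_generates by blast
  also have "\<dots> \<subseteq> span ((\<lambda>w. op_word w v) ` {w. set w \<subseteq> {..n}})"
  proof (rule span_minimal)
    show "?S \<subseteq> span ((\<lambda>w. op_word w v) ` {w. set w \<subseteq> {..n}})"
    proof
      fix s assume "s \<in> ?S"
      then obtain w c where s: "set w \<subseteq> {..n}" "s = op_word w (scale c v)" by (auto simp: Y)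
      have "op_word w (scale c v) = scale c (op_word w v)"
        by (induction w) (use v_V in \<open>auto simp: act_vec_scale\<close>)
      moreover have "op_word w v \<in> span ((\<lambda>w. op_word w v) ` {w. set w \<subseteq> {..n}})"
        using s by (intro span_base) auto
      ultimately show "s \<in> span ((\<lambda>w. op_word w v) ` {w. set w \<subseteq> {..n}})"
        using s by (simp add: span_scale)
    qed
  qed simp
  finally show ?thesis using v_V subspace_V by (intro antisym span_minimal) auto
qed

lemma distinct_weights:
  assumes "m \<in> contents n" "m' \<in> contents n" "m \<noteq> m'"
  shows "(\<exists>k\<le>n. fst (weight_of m) k \<noteq> fst (weight_of m') k) \<or> snd (weight_of m) \<noteq> snd (weight_of m')"
  using root_combination_inj[OF assms(1,2) n_pos] assms(3)
  by (auto simp: weight_of_def minus_apply)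

lemma word_content_contents: "set w \<subseteq> {..n} \<Longrightarrow> word_content w \<in> contents n"
  by (auto simp: contents_def word_content_def count_list_0_iff)

lemma weight_decomposition:
  assumes "x \<in> span ((\<lambda>w. op_word w v) ` T)" "\<And>w. w \<in> T \<Longrightarrow> set w \<subseteq> {..n}"
  obtains A y where "finite A" "A \<subseteq> word_content ` T" "x = (\<Sum>m\<in>A. y m)"
    "\<And>m. m \<in> A \<Longrightarrow> y m \<in> span ((\<lambda>w. op_word w v) ` {w \<in> T. word_content w = m})"
    "\<And>m. m \<in> A \<Longrightarrow> y m \<in> weight_space (weight_of m)"
proof -
  let ?s = "\<lambda>m. span ((\<lambda>w. op_word w v) ` {w \<in> T. word_content w = m})"
  have "\<exists>A y. finite A \<and> A \<subseteq> word_content ` T \<and> x = (\<Sum>m\<in>A. y m) \<and> (\<forall>m\<in>A. y m \<in> ?s m)"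
    using assms(1)
  proof (induction rule: span_induct_alt)
    case base
    show ?case by (rule exI[of _ "{}"]) auto
  next
    case (step c z x)
    then obtain A y w where A: "finite A" "A \<subseteq> word_content ` T" "x = (\<Sum>m\<in>A. y m)" "\<forall>m\<in>A. y m \<in> ?s m"
      and w: "w \<in> T" "z = op_word w v" by blast
    define m0 where "m0 = word_content w"
    define y' where "y' m = (if m \<in> A then y m else 0) + (if m = m0 then scale c z else 0)" for m
    have z: "z \<in> ?s m0" using w by (intro span_base) (auto simp: m0_def)
    have "(\<Sum>m\<in>insert m0 A. y' m) = (\<Sum>m\<in>insert m0 A. if m \<in> A then y m else 0) + scale c z"
      using A(1) by (simp add: y'_def sum.distrib)
    also have "(\<Sum>m\<in>insert m0 A. if m \<in> A then y m else 0) = (\<Sum>m\<in>A. y m)"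
      using A(1) by (intro sum.mono_neutral_cong_right) auto
    finally have "scale c z + x = (\<Sum>m\<in>insert m0 A. y' m)" using A(3) by simp
    moreover have "\<forall>m\<in>insert m0 A. y' m \<in> ?s m"
      using A(4) z by (auto simp: y'_def intro!: span_add span_scale span_zero)
    moreover have "finite (insert m0 A)" "insert m0 A \<subseteq> word_content ` T" using A w by (auto simp: m0_def)
    ultimately show ?case by blast
  qed
  then obtain A y where A: "finite A" "A \<subseteq> word_content ` T" "x = (\<Sum>m\<in>A. y m)" "\<And>m. m \<in> A \<Longrightarrow> y m \<in> ?s m"
    by blast
  have "?s m \<subseteq> weight_space (weight_of m)" for m
    using op_word_weight assms(2) by (intro span_minimal weight_space_subspace) auto
  then show thesis using A that by blast
qed

text \<open>By independence of weight spaces, as only the empty word has content 0.\<close>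

lemma v_not_in_span:
  assumes "\<And>w. w \<in> T \<Longrightarrow> set w \<subseteq> {..n} \<and> w \<noteq> []"
  shows "v \<notin> span ((\<lambda>w. op_word w v) ` T)"
proof
  assume "v \<in> span ((\<lambda>w. op_word w v) ` T)"
  then obtain A y where A: "finite A" "A \<subseteq> word_content ` T" "v = (\<Sum>m\<in>A. y m)"
      "\<And>m. m \<in> A \<Longrightarrow> y m \<in> weight_space (weight_of m)"
    by (rule weight_decomposition) (use assms in auto)
  define m0 where "m0 = word_content []"
  have "m0 \<notin> A"
  proof
    assume "m0 \<in> A"
    then obtain w where "w \<in> T" "word_content w = m0" using A(2) by auto
    then have "count_list w (hd w) = 0" by (simp add: m0_def word_content_def fun_eq_iff)
    then have "w = []" by (cases w) auto
    then show False using assms \<open>w \<in> T\<close> by blast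
  qed
  define y' where "y' m = (if m = m0 then - v else y m)" for m
  have "v \<in> weight_space (weight_of m0)" using op_word_weight[of "[]"] by (simp add: m0_def)
  then have "- v \<in> weight_space (weight_of m0)" using subspace_neg[OF weight_space_subspace] by blast
  then have 1: "y' m \<in> weight_space (weight_of m)" if "m \<in> insert m0 A" for m
    using that A(4) by (auto simp: y'_def)
  have "(\<Sum>m\<in>A. y' m) = (\<Sum>m\<in>A. y m)" using \<open>m0 \<notin> A\<close> by (intro sum.cong) (auto simp: y'_def)
  then have "(\<Sum>m\<in>insert m0 A. y' m) = 0" using A(1,3) \<open>m0 \<notin> A\<close> by (simp add: y'_def)
  moreover have "insert m0 A \<subseteq> contents n"
    using A(2) assms word_content_contents word_content_contents[of "[]"] by (auto simp: m0_def)
  then have "\<And>a b. a \<in> insert m0 A \<Longrightarrow> b \<in> insert m0 A \<Longrightarrow> a \<noteq> b \<Longrightarrow>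
      (\<exists>k\<le>n. fst (weight_of a) k \<noteq> fst (weight_of b) k) \<or> snd (weight_of a) \<noteq> snd (weight_of b)"
    using distinct_weights by blast
  ultimately have "y' m0 = 0"
    using weight_spaces_independent[of "insert m0 A" weight_of y' m0] A(1) 1 by blast
  then show False using v_nonzero by (simp add: y'_def)
qed

lemma word_span_stable:
  assumes "x \<in> word_span N" "j \<le> n"
  shows "op_h j x \<in> word_span N" "op_d x \<in> word_span N" "op_f j x \<in> word_span (Suc N)"
proof -
  let ?S = "(\<lambda>w. op_word w v) ` {w. length w = N \<and> set w \<subseteq> {..n}}"
  have S: "?S \<subseteq> V" "x \<in> span ?S" using v_V assms(1) by (auto simp: word_span_def)
  show "op_h j x \<in> word_span N"
    unfolding word_span_def
  proof (rule act_span[OF S])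
    fix s assume s: "s \<in> ?S"
    then obtain w where "set w \<subseteq> {..n}" "s = op_word w v" by blast
    then show "op_h j s \<in> span ?S" using s assms(2) by (simp add: op_h_word span_scale span_base)
  qed
  show "op_d x \<in> word_span N"
    unfolding word_span_def
  proof (rule act_span[OF S])
    fix s assume s: "s \<in> ?S"
    then obtain w where "set w \<subseteq> {..n}" "s = op_word w v" by blast
    then show "op_d s \<in> span ?S" using s by (simp add: op_d_word span_scale span_base)
  qed
  show "op_f j x \<in> word_span (Suc N)"
    unfolding word_span_def
  proof (rule act_span[OF S])
    fix s assume "s \<in> ?S"
    then obtain w where "length w = N" "set w \<subseteq> {..n}" "s = op_word w v" by blast
    then have "op_f j s = op_word (j # w) v" "j # w \<in> {w. length w = Suc N \<and> set w \<subseteq> {..n}}" using assms(2) by auto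
    then show "op_f j s \<in> span ((\<lambda>w. op_word w v) ` {w. length w = Suc N \<and> set w \<subseteq> {..n}})"
      by (intro span_base) blast
  qed
qed

text \<open>Singular vectors of positive degree generate a submodule inside the span of nonempty
  words, which misses v; irreducibility then leaves only 0.\<close>

lemma no_singular_vector:
  assumes "x \<in> word_span (Suc N)" "\<And>j. j \<le> n \<Longrightarrow> op_e j x = 0"
  shows "x = 0"
proof (rule ccontr)
  assume "x \<noteq> 0"
  define Y where "Y = {y \<in> word_span (Suc N). \<forall>j\<le>n. op_e j y = 0}"
  let ?S = "{op_word w y | w y. set w \<subseteq> {..n} \<and> y \<in> Y}"
  have YV: "Y \<subseteq> V" using word_span_V by (auto simp: Y_def)
  have sub: "subspace Y"
  proof (rule subspaceI)
    show "0 \<in> Y" by (simp add: Y_def word_span_def span_zero)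
    show "x + y \<in> Y" if xy: "x \<in> Y" "y \<in> Y" for x y
    proof -
      have "x \<in> V" "y \<in> V" using YV xy by blast+
      then show ?thesis using xy by (simp add: Y_def word_span_def span_add act_vec_add)
    qed
    show "scale c x \<in> Y" if x: "x \<in> Y" for c x
    proof -
      have "x \<in> V" using YV x by blast
      then show ?thesis using x by (simp add: Y_def word_span_def span_scale act_vec_scale)
    qed
  qed
  have "submodule (span ?S)"
  proof (rule singular_submodule[OF YV sub])
    fix j y assume jy: "j \<le> n" "y \<in> Y"
    then have "y \<in> V" using YV by blast
    then show "op_e j y = 0 \<and> op_h j y \<in> Y"
      using jy word_span_stable(1)[of y "Suc N" j] by (simp add: Y_def op_e_h)
  next
    fix y assume y: "y \<in> Y"
    then have "y \<in> V" using YV by blast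
    then show "op_d y \<in> Y"
      using y word_span_stable(2)[of y "Suc N" 0] by (simp add: Y_def op_e_d)
  qed
  moreover have "x \<in> span ?S"
  proof -
    have "op_word [] x \<in> ?S" using assms by (intro CollectI exI[of _ "[]"] exI[of _ x]) (auto simp: Y_def)
    then show ?thesis using span_base[of "op_word [] x" ?S] by simp
  qed
  ultimately have "span ?S = V" using irreducible \<open>x \<noteq> 0\<close> unfolding irreducible_module_def by blast
  then have "v \<in> span ?S" using v_V by simp
  also have "span ?S \<subseteq> span ((\<lambda>w. op_word w v) ` {w. set w \<subseteq> {..n} \<and> w \<noteq> []})"
  proof (rule span_minimal)
    have "op_word w y \<in> word_span (Suc (N + length w))" if "set w \<subseteq> {..n}" "y \<in> word_span (Suc N)" for w y
      using that(1) by (induction w) (auto simp: that(2) word_span_stable(3))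
    moreover have "word_span (Suc M) \<subseteq> span ((\<lambda>w. op_word w v) ` {w. set w \<subseteq> {..n} \<and> w \<noteq> []})" for M
      unfolding word_span_def by (rule span_mono) auto
    ultimately show "?S \<subseteq> span ((\<lambda>w. op_word w v) ` {w. set w \<subseteq> {..n} \<and> w \<noteq> []})"
      unfolding Y_def by blast
  qed simp
  finally show False using v_not_in_span[of "{w. set w \<subseteq> {..n} \<and> w \<noteq> []}"] by blast
qed

end

text \<open>Words of positive length are orthogonal to y, since their first letter moves to the
  other side as e_j. As y is itself a combination of such words, its norm is 0.\<close>

lemma fock_no_singular_vector:
  assumes "y \<in> word_space n i (Suc N)" "\<And>j. j \<le> n \<Longrightarrow> fock_e n j y = 0"
  shows "y = 0"
proof -
  have zero: "(\<Sum>S\<in>conf i (Suc N). z S * cnj (y S)) = 0" if "z \<in> word_space n i (Suc N)" for z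
    using that
  proof (induction rule: word_space_induct)
    case zero
    show ?case by (simp add: zero_fun_apply)
  next
    case (add c w z)
    then obtain k w' where w: "w = k # w'" "k \<le> n" by (cases w) auto
    have "(\<Sum>S\<in>conf i (Suc N). fock_word n i w S * cnj (y S)) = 0"
      using assms(2)[OF w(2)] by (simp add: w(1) fock_adjoint zero_fun_apply)
    then have "(\<Sum>S\<in>conf i (Suc N). c * (fock_word n i w S * cnj (y S))) = 0"
      by (simp flip: sum_distrib_left)
    then show ?case using add by (simp add: fscale_def plus_fun_apply distrib_right sum.distrib mult.assoc)
  qed
  have "(\<Sum>S\<in>conf i (Suc N). complex_of_real ((cmod (y S))\<^sup>2)) = 0"
    using zero[OF assms(1)] by (simp only: complex_norm_square)
  then have "complex_of_real (\<Sum>S\<in>conf i (Suc N). (cmod (y S))\<^sup>2) = 0" by simp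
  then have "(\<Sum>S\<in>conf i (Suc N). (cmod (y S))\<^sup>2) = 0" by (simp only: of_real_eq_0_iff)
  then have "y S = 0" if "S \<in> conf i (Suc N)" for S
    using that finite_conf[of i "Suc N"] by (simp add: sum_nonneg_eq_0_iff)
  moreover have "y S = 0" if "S \<notin> conf i (Suc N)" for S
    using that homogeneous_word_space[OF assms(1)] by (auto simp: homogeneous_def)
  ultimately show ?thesis by (auto simp: fun_eq_iff zero_fun_apply)
qed

section \<open>Comparison of the module with the Fock space\<close>

locale fundamental_module = highest_weight_vector scale n V act "fund_weight i" v
  for scale :: "complex \<Rightarrow> 'v::ab_group_add \<Rightarrow> 'v" and n V act i v +
  assumes i_le: "i \<le> n"
begin

text \<open>The graph of the intended isomorphism, pairing equal combinations of words. It is a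
  relation because well-definedness is only established by \<open>rel_zero_iff\<close>.\<close>

inductive word_rel :: "nat \<Rightarrow> 'v \<Rightarrow> fock \<Rightarrow> bool" for N where
  rel_zero: "word_rel N 0 0"
| rel_step: "length w = N \<Longrightarrow> set w \<subseteq> {..n} \<Longrightarrow> word_rel N x y \<Longrightarrow>
    word_rel N (scale c (op_word w v) + x) (fscale c (fock_word n i w) + y)"

lemma rel_word: "length w = N \<Longrightarrow> set w \<subseteq> {..n} \<Longrightarrow> word_rel N (op_word w v) (fock_word n i w)"
  using word_rel.rel_step[OF _ _ word_rel.rel_zero, of w N 1] by simp

lemma rel_add: "word_rel N x y \<Longrightarrow> word_rel N x' y' \<Longrightarrow> word_rel N (x + x') (y + y')"
proof (induction rule: word_rel.induct)
  case (rel_step w x y c)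
  then show ?case using word_rel.rel_step[OF rel_step.hyps(1,2), of "x + x'" "y + y'" c] by (simp add: add.assoc)
qed simp

lemma rel_scale: "word_rel N x y \<Longrightarrow> word_rel N (scale c x) (fscale c y)"
proof (induction rule: word_rel.induct)
  case (rel_step w x y d)
  then show ?case
    using word_rel.rel_step[OF rel_step.hyps(1,2) rel_step.IH, of "c * d"]
    by (simp add: scale_right_distrib fock.scale_right_distrib)
qed (simp add: word_rel.rel_zero)

lemma rel_sum:
  "finite I \<Longrightarrow> (\<And>a. a \<in> I \<Longrightarrow> word_rel N (b a) (h a)) \<Longrightarrow>
    word_rel N (\<Sum>a\<in>I. scale (t a) (b a)) (\<Sum>a\<in>I. fscale (t a) (h a))"
  by (induction I rule: finite_induct) (auto simp: word_rel.rel_zero intro!: rel_add rel_scale)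

lemma rel_mem:
  assumes "word_rel N x y"
  shows "x \<in> word_span N" "y \<in> word_space n i N"
proof -
  have "x \<in> word_span N \<and> y \<in> word_space n i N" using assms
  proof (induction rule: word_rel.induct)
    case rel_zero
    show ?case by (simp add: word_span_def span_zero)
  next
    case (rel_step w x y c)
    have "op_word w v \<in> word_span N" unfolding word_span_def using rel_step by (intro span_base) auto
    then show ?case
      using rel_step word_space_word[of w N n i]
      by (auto simp: word_span_def intro!: span_add span_scale word_space_add word_space_scale)
  qed
  then show "x \<in> word_span N" "y \<in> word_space n i N" by auto
qed

lemma rel_ex_right: "x \<in> word_span N \<Longrightarrow> \<exists>y. word_rel N x y"
  unfolding word_span_def
proof (induction rule: span_induct_alt)
  case base
  show ?case using word_rel.rel_zero by blast
next
  case (step c z x)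
  then obtain y w where "word_rel N x y" "length w = N" "set w \<subseteq> {..n}" "z = op_word w v" by blast
  then show ?case using word_rel.rel_step by blast
qed

lemma rel_ex_left: "y \<in> word_space n i N \<Longrightarrow> \<exists>x. word_rel N x y"
proof (induction rule: word_space_induct)
  case zero
  show ?case using word_rel.rel_zero by blast
next
  case (add c w y)
  then show ?case using word_rel.rel_step by blast
qed

lemma rel_f: "word_rel N x y \<Longrightarrow> k \<le> n \<Longrightarrow> word_rel (Suc N) (op_f k x) (fock_f n k y)"
proof (induction rule: word_rel.induct)
  case rel_zero
  show ?case by (simp add: fock_f_def hop_0 word_rel.rel_zero)
next
  case (rel_step w x y c)
  have "x \<in> V" using rel_mem(1)[OF rel_step.hyps(3)] word_span_V by blast
  then have "op_f k (scale c (op_word w v) + x) = scale c (op_word (k # w) v) + op_f k x"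
    using v_V by (simp add: act_vec_add act_vec_scale V_scale)
  moreover have "fock_f n k (fscale c (fock_word n i w) + y) = fscale c (fock_word n i (k # w)) + fock_f n k y"
    by (simp add: fock_f_def hop_add hop_fscale)
  ultimately show ?case using word_rel.rel_step[of "k # w" "Suc N"] rel_step by auto
qed

text \<open>On both sides e_j is commuted through the word by the same recursion with equal
  scalars.\<close>

lemma rel_e_word:
  "length w = Suc M \<Longrightarrow> set w \<subseteq> {..n} \<Longrightarrow> j \<le> n \<Longrightarrow>
    word_rel M (op_e j (op_word w v)) (fock_e n j (fock_word n i w))"
proof (induction w arbitrary: M)
  case (Cons k w)
  then have k: "k \<le> n" "set w \<subseteq> {..n}" "length w = M" by auto
  have 1: "word_rel M (op_f k (op_e j (op_word w v))) (fock_f n k (fock_e n j (fock_word n i w)))"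
  proof (cases M)
    case 0
    then show ?thesis
      using k v_singular Cons.prems by (simp add: fock_e_vacuum fock_f_def hop_0 word_rel.rel_zero)
  next
    case (Suc M')
    then show ?thesis using Cons.IH[of M'] k Cons.prems rel_f by auto
  qed
  have c: "fst (fund_weight i) j = of_bool (j = i)" by (simp add: fund_weight_def)
  have 2: "word_rel M (if j = k then scale (of_bool (j = i) - (\<Sum>l\<leftarrow>w. of_int (cartan n j l))) (op_word w v) else 0)
     (if j = k then fscale (of_bool (j = i) - (\<Sum>l\<leftarrow>w. of_int (cartan n j l))) (fock_word n i w) else 0)"
    using rel_scale[OF rel_word[OF k(3,2)]] word_rel.rel_zero by auto
  show ?case
    using rel_add[OF 1 2] op_e_word[OF k(2) Cons.prems(3) k(1)] fock_e_word[OF k(2) Cons.prems(3) k(1) i_le n_pos]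
    unfolding c by simp
qed simp

lemma rel_e: "word_rel (Suc M) x y \<Longrightarrow> j \<le> n \<Longrightarrow> word_rel M (op_e j x) (fock_e n j y)"
proof (induction rule: word_rel.induct)
  case rel_zero
  show ?case by (simp add: fock_e_def hop_0 word_rel.rel_zero)
next
  case (rel_step w x y c)
  have "x \<in> V" using rel_mem(1)[OF rel_step.hyps(3)] word_span_V by blast
  then have "op_e j (scale c (op_word w v) + x) = scale c (op_e j (op_word w v)) + op_e j x"
    using v_V by (simp add: act_vec_add act_vec_scale V_scale)
  moreover have "fock_e n j (fscale c (fock_word n i w) + y) = fscale c (fock_e n j (fock_word n i w)) + fock_e n j y"
    by (simp add: fock_e_def hop_add hop_fscale)
  ultimately show ?case
    using rel_add[OF rel_scale[OF rel_e_word[OF rel_step.hyps(1,2) rel_step.prems]] rel_step.IH[OF rel_step.prems]]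
    by simp
qed

lemma rel_0: "word_rel 0 x y \<Longrightarrow> \<exists>c. x = scale c v \<and> y = fscale c (vacuum i)"
proof (induction rule: word_rel.induct)
  case rel_zero
  show ?case by (rule exI[of _ 0]) simp
next
  case (rel_step w x y c)
  then obtain d where "x = scale d v" "y = fscale d (vacuum i)" by blast
  then show ?case using rel_step by (intro exI[of _ "c + d"]) (simp add: scale_left_distrib fock.scale_left_distrib)
qed

text \<open>On either side a vector of positive degree vanishes iff all its images under the e_j do,
  and these images are related in lower degree.\<close>

lemma rel_zero_iff: "word_rel N x y \<Longrightarrow> x = 0 \<longleftrightarrow> y = 0"
proof (induction N arbitrary: x y)
  case 0
  then obtain c where c: "x = scale c v" "y = fscale c (vacuum i)" using rel_0 by blast
  have "vacuum i \<noteq> 0" by (auto simp: fun_eq_iff zero_fun_apply vacuum_def)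
  then show ?case using c v_nonzero by simp
next
  case (Suc N)
  have "op_e j x = 0 \<longleftrightarrow> fock_e n j y = 0" if "j \<le> n" for j
    using Suc.IH[OF rel_e[OF Suc.prems that]] .
  then show ?case
    using no_singular_vector[OF rel_mem(1)[OF Suc.prems]] fock_no_singular_vector[OF rel_mem(2)[OF Suc.prems]]
    by (auto simp: fock_e_def hop_0)
qed

text \<open>The relation transports the basis of hook vectors to the module. The finite spanning set
  is recorded because it later bounds the bases of the weight spaces.\<close>

lemma dim_word_span: "dim (word_span N) = card (good_lists n i N)" "\<exists>B. finite B \<and> word_span N \<subseteq> span B"
proof -
  let ?G = "good_lists n i N"
  note basis = word_space_basis[OF i_le n_pos, where N = N]
  obtain b where b: "\<And>hs. hs \<in> ?G \<Longrightarrow> word_rel N (b hs) (hook_vec n i hs)"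
    using bchoice[of ?G "\<lambda>hs x. word_rel N x (hook_vec n i hs)"] rel_ex_left[OF basis(1)] by blast
  have ind: "t hs = 0" if "(\<Sum>hs\<in>?G. scale (t hs) (b hs)) = 0" "hs \<in> ?G" for t hs
  proof -
    have "word_rel N (\<Sum>hs\<in>?G. scale (t hs) (b hs)) (\<Sum>hs\<in>?G. fscale (t hs) (hook_vec n i hs))"
      using finite_good_lists b by (intro rel_sum)
    from rel_zero_iff[OF this] show ?thesis using that basis(2) by blast
  qed
  have inj: "inj_on b ?G"
  proof (rule inj_onI, rule ccontr)
    fix g h assume gh: "g \<in> ?G" "h \<in> ?G" "b g = b h" "g \<noteq> h"
    let ?t = "\<lambda>x. if x = g then 1 else if x = h then - 1 else 0 :: complex"
    have "(\<Sum>x\<in>?G. scale (?t x) (b x)) = (\<Sum>x\<in>{g, h}. scale (?t x) (b x))"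
      using gh finite_good_lists by (intro sum.mono_neutral_right) auto
    also have "\<dots> = 0" using gh by simp
    finally show False using ind[of ?t g] gh(1) by simp
  qed
  have "independent (b ` ?G)"
  proof (rule independent_if_scalars_zero)
    fix f x assume f: "(\<Sum>x\<in>b ` ?G. scale (f x) x) = 0" and x: "x \<in> b ` ?G"
    then obtain hs where hs: "hs \<in> ?G" "x = b hs" by blast
    have "(\<Sum>hs\<in>?G. scale (f (b hs)) (b hs)) = 0" using f by (simp add: sum.reindex[OF inj])
    then show "f x = 0" using ind[of "\<lambda>hs. f (b hs)"] hs by blast
  qed (simp add: finite_good_lists)
  moreover have "word_span N \<subseteq> span (b ` ?G)"
  proof
    fix x assume "x \<in> word_span N"
    then obtain y where y: "word_rel N x y" using rel_ex_right by blast
    obtain t where t: "y = (\<Sum>hs\<in>?G. fscale (t hs) (hook_vec n i hs))" using basis(3)[OF rel_mem(2)[OF y]] by blast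
    let ?x = "\<Sum>hs\<in>?G. scale (t hs) (b hs)"
    have "word_rel N ?x y" unfolding t using finite_good_lists b by (intro rel_sum)
    then have "word_rel N (x + scale (- 1) ?x) (y + fscale (- 1) y)" by (intro rel_add[OF y] rel_scale)
    from rel_zero_iff[OF this] have "x = ?x" by simp
    moreover have "(\<Sum>hs\<in>?G. scale (t hs) (b hs)) \<in> span (b ` ?G)"
      by (rule span_sum, rule span_scale, rule span_base) blast
    ultimately show "x \<in> span (b ` ?G)" by simp
  qed
  moreover have "b ` ?G \<subseteq> word_span N" using b rel_mem(1) by blast
  moreover have "subspace (word_span N)" by (simp add: word_span_def)
  ultimately have "dim (word_span N) = card (b ` ?G)"
    by (intro dim_unique) auto
  then show "dim (word_span N) = card ?G" by (simp add: card_image[OF inj])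
  show "\<exists>B. finite B \<and> word_span N \<subseteq> span B" 
    using \<open>word_span N \<subseteq> span (b ` ?G)\<close> finite_imageI[OF finite_good_lists[of n i N], of b]
    by (intro exI[of _ "b ` ?G"] conjI)
qed

end

section \<open>Weight spaces within a degree\<close>

lemma finite_contents: "finite {m \<in> contents n. (\<Sum>j\<le>n. m j) = N}"
proof (rule finite_subset)
  let ?F = "{m. \<forall>j. (j \<in> {..n} \<longrightarrow> m j \<in> {..N}) \<and> (j \<notin> {..n} \<longrightarrow> m j = 0)}"
  show "{m \<in> contents n. (\<Sum>j\<le>n. m j) = N} \<subseteq> ?F"
    using member_le_sum[of _ "{..n}"] by (force simp: contents_def)
  show "finite ?F" by (rule finite_set_of_finite_funs) auto
qed

lemma length_word_content: "set w \<subseteq> {..n} \<Longrightarrow> (\<Sum>j\<le>n. word_content w j) = length w"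
  unfolding word_content_def by (rule sum_count_set) auto

context fundamental_module
begin

lemma weight_space_word_span:
  assumes "m \<in> contents n" "(\<Sum>j\<le>n. m j) = N"
  shows "weight_space (weight_of m) \<subseteq> word_span N"
proof
  fix x assume x: "x \<in> weight_space (weight_of m)"
  then have "x \<in> span ((\<lambda>w. op_word w v) ` {w. set w \<subseteq> {..n}})" using weight_space_V V_eq_span by blast
  then obtain A y where A: "finite A" "A \<subseteq> word_content ` {w. set w \<subseteq> {..n}}" "x = (\<Sum>m\<in>A. y m)"
      "\<And>m. m \<in> A \<Longrightarrow> y m \<in> span ((\<lambda>w. op_word w v) ` {w \<in> {w. set w \<subseteq> {..n}}. word_content w = m})"
      "\<And>m. m \<in> A \<Longrightarrow> y m \<in> weight_space (weight_of m)"
    by (rule weight_decomposition) auto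
  \<comment> \<open>Subtracting x at its own weight gives a vanishing sum, so independence
    identifies x with its component of weight m.\<close>
  define y' where "y' k = (if k \<in> A then y k else 0) - (if k = m then x else 0)" for k
  have "(\<Sum>k\<in>insert m A. y' k) = (\<Sum>k\<in>insert m A. if k \<in> A then y k else 0) - (\<Sum>k\<in>insert m A. if k = m then x else 0)"
    by (simp add: y'_def sum_subtractf)
  also have "(\<Sum>k\<in>insert m A. if k \<in> A then y k else 0) = (\<Sum>k\<in>A. y k)"
    using A(1) by (intro sum.mono_neutral_cong_right) auto
  also have "(\<Sum>k\<in>insert m A. if k = m then x else 0) = x" using A(1) by simp
  finally have sum0: "(\<Sum>k\<in>insert m A. y' k) = 0" using A(3) by simp
  have mem: "y' k \<in> weight_space (weight_of k)" if "k \<in> insert m A" for k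
    using that A(5) x subspace_0[OF weight_space_subspace] subspace_diff[OF weight_space_subspace]
    by (auto simp: y'_def subspace_neg[OF weight_space_subspace])
  have "insert m A \<subseteq> contents n" using A(2) assms(1) word_content_contents by auto
  then have "y' m = 0"
    using weight_spaces_independent[of "insert m A" weight_of y' m] A(1) mem sum0 distinct_weights by blast
  then have xm: "x = (if m \<in> A then y m else 0)" by (simp add: y'_def)
  show "x \<in> word_span N"
  proof (cases "m \<in> A")
    case True
    have "span ((\<lambda>w. op_word w v) ` {w \<in> {w. set w \<subseteq> {..n}}. word_content w = m}) \<subseteq> word_span N"
      unfolding word_span_def using assms(2) length_word_content by (intro span_mono image_mono) auto
    then show ?thesis using A(4)[OF True] xm True by auto
  qed (use xm in \<open>simp add: word_span_def span_zero\<close>)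
qed

text \<open>The span of the words of length N is the direct sum of its weight spaces, so their bases
  unite to a basis.\<close>

lemma sum_dim_weight_space:
  "(\<Sum>m\<in>{m \<in> contents n. (\<Sum>j\<le>n. m j) = N}. dim (weight_space (weight_of m))) = card (good_lists n i N)"
proof -
  let ?M = "{m \<in> contents n. (\<Sum>j\<le>n. m j) = N}"
  let ?W = "\<lambda>m. weight_space (weight_of m)"
  obtain B where B: "\<And>m. B m \<subseteq> ?W m" "\<And>m. independent (B m)" "\<And>m. ?W m \<subseteq> span (B m)" "\<And>m. card (B m) = dim (?W m)"
  proof -
    have "\<exists>B. B \<subseteq> ?W m \<and> independent B \<and> ?W m \<subseteq> span B \<and> card B = dim (?W m)" for m
      by (rule basis_exists[of "?W m"]) blast
    then show thesis using that by metis
  qed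
  obtain F where F: "finite F" "word_span N \<subseteq> span F" using dim_word_span(2) by blast
  have finB: "finite (B m)" if "m \<in> ?M" for m
  proof -
    have "B m \<subseteq> span F" using B(1) weight_space_word_span[of m N] that F(2) by blast
    then show ?thesis using independent_span_bound[OF F(1) B(2)] by blast
  qed
  have ind: "y m = 0" if "\<And>m. m \<in> ?M \<Longrightarrow> y m \<in> ?W m" "(\<Sum>m\<in>?M. y m) = 0" "m \<in> ?M" for y m
    using weight_spaces_independent[of ?M weight_of y m] finite_contents distinct_weights that by blast
  have disj: "B m \<inter> B m' = {}" if "m \<in> ?M" "m' \<in> ?M" "m \<noteq> m'" for m m'
  proof (rule ccontr)
    assume "B m \<inter> B m' \<noteq> {}"
    then obtain b where b: "b \<in> B m" "b \<in> B m'" by blast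
    let ?y = "\<lambda>k. if k = m then b else if k = m' then - b else 0"
    have bW: "b \<in> ?W m" "b \<in> ?W m'" using B(1) b by blast+
    have "(\<Sum>k\<in>?M. ?y k) = (\<Sum>k\<in>{m, m'}. ?y k)"
      using that finite_contents by (intro sum.mono_neutral_right) auto
    also have "\<dots> = 0" using that by simp
    finally have "(\<Sum>k\<in>?M. ?y k) = 0" .
    moreover have "?y k \<in> ?W k" for k
      using bW subspace_0[OF weight_space_subspace] subspace_neg[OF weight_space_subspace] by simp
    ultimately have "b = 0" using ind[of ?y m] that(1) by simp
    then show False using b(1) B(2)[of m] dependent_zero by blast
  qed
  let ?B = "\<Union>m\<in>?M. B m"
  have finU: "finite ?B" using finite_contents finB by auto
  have "independent ?B"
  proof (rule independent_if_scalars_zero[OF finU])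
    fix f x assume f: "(\<Sum>x\<in>?B. scale (f x) x) = 0" and x: "x \<in> ?B"
    then obtain m where m: "m \<in> ?M" "x \<in> B m" by blast
    have "(\<Sum>x\<in>?B. scale (f x) x) = (\<Sum>m\<in>?M. \<Sum>x\<in>B m. scale (f x) x)"
      using finite_contents finB disj by (intro sum.UNION_disjoint) auto
    moreover have "(\<Sum>x\<in>B k. scale (f x) x) \<in> ?W k" for k
      using B(1) by (intro subspace_sum[OF weight_space_subspace] subspace_scale[OF weight_space_subspace]) auto
    ultimately have "(\<Sum>x\<in>B m. scale (f x) x) = 0"
      using f m(1) ind[of "\<lambda>k. \<Sum>x\<in>B k. scale (f x) x" m] by simp
    then show "f x = 0" using independentD[OF B(2)[of m] finB[OF m(1)] order_refl _ m(2)] by blast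
  qed
  moreover have "word_span N \<subseteq> span ?B"
    unfolding word_span_def
  proof (rule span_minimal)
    show "(\<lambda>w. op_word w v) ` {w. length w = N \<and> set w \<subseteq> {..n}} \<subseteq> span ?B"
    proof
      fix z assume "z \<in> (\<lambda>w. op_word w v) ` {w. length w = N \<and> set w \<subseteq> {..n}}"
      then obtain w where w: "length w = N" "set w \<subseteq> {..n}" "z = op_word w v" by blast
      have m: "word_content w \<in> ?M" using w length_word_content word_content_contents by simp
      have "z \<in> span (B (word_content w))" using op_word_weight[OF w(2)] B(3) w(3) by blast
      also have "\<dots> \<subseteq> span ?B" using m by (intro span_mono) blast
      finally show "z \<in> span ?B" .
    qed
  qed simp
  moreover have "?B \<subseteq> word_span N" using B(1) weight_space_word_span by blast
  ultimately have "dim (word_span N) = card ?B" by (intro dim_unique) auto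
  also have "card ?B = (\<Sum>m\<in>?M. card (B m))"
    using finite_contents finB disj by (intro card_UN_disjoint) auto
  finally show ?thesis using dim_word_span(1) B(4) by simp
qed

end

section \<open>Path partitions\<close>

lemma is_path_lipschitz:
  assumes "is_path n k p" "j \<le> j'" "j' \<le> 2 * n"
  shows "\<bar>fst (p ! j') - fst (p ! j)\<bar> \<le> int j' - int j"
  using assms(2,3)
proof (induction j' rule: dec_induct)
  case (step j')
  then have "fst (p ! (j' + 1)) = fst (p ! j') + 1 \<or> fst (p ! (j' + 1)) = fst (p ! j') - 1"
    using assms(1) by (simp add: is_path_def)
  then show ?case using step by auto
qed simp

text \<open>The minimum of the upward cones over two parts is the height function of a path through both.\<close>

lemma path_through:
  assumes u: "(l, d) \<in> parts_from n (- 1)" "(l', d') \<in> parts_from n (- 1)" "\<bar>l - l'\<bar> \<le> \<bar>int d - int d'\<bar>"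
  obtains p where "is_path n (- 1) p" "p ! d = (l, d)" "p ! d' = (l', d')"
proof -
  define h where "h j = min (l + \<bar>int j - int d\<bar>) (l' + \<bar>int j - int d'\<bar>)" for j
  define p where "p = map (\<lambda>j. (h j, j)) [0..<2 * n + 1]"
  have p: "length p = 2 * n + 1" "\<And>j. j \<le> 2 * n \<Longrightarrow> p ! j = (h j, j)"
    by (simp_all add: p_def del: upt_Suc)
  have ud: "d \<le> 2 * n" "d' \<le> 2 * n" "- 1 \<le> l" "- 1 \<le> l'" "(l - int d) mod 2 = 1" "(l' - int d') mod 2 = 1"
    using u by (auto simp: parts_from_def)
  have par: "(h j - int j) mod 2 = 1" for j
  proof -
    have "(l + \<bar>int j - int d\<bar> - int j) mod 2 = 1" using ud(5) by presburger
    moreover have "(l' + \<bar>int j - int d'\<bar> - int j) mod 2 = 1" using ud(6) by presburger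
    ultimately show ?thesis by (simp add: h_def min_def)
  qed
  have lip: "\<bar>h (j + 1) - h j\<bar> \<le> 1" for j
  proof -
    have step: "\<bar>int (j + 1) - x\<bar> \<le> \<bar>int j - x\<bar> + 1" "\<bar>int j - x\<bar> \<le> \<bar>int (j + 1) - x\<bar> + 1" for x by arith+
    have min1: "\<bar>min x y - min z w\<bar> \<le> 1" if "x \<le> z + 1" "z \<le> x + 1" "y \<le> w + 1" "w \<le> y + 1" for x y z w :: int
      using that by linarith
    show ?thesis unfolding h_def by (rule min1) (use step in simp_all)
  qed
  have "h (j + 1) = h j + 1 \<or> h (j + 1) = h j - 1" for j
  proof -
    have "h (j + 1) \<noteq> h j"
    proof
      assume "h (j + 1) = h j"
      then show False using par[of j] par[of "j + 1"] by simp presburger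
    qed
    then show ?thesis using lip[of j] by linarith
  qed
  moreover have "- 1 \<le> h j" for j unfolding h_def using ud(3,4) by linarith
  ultimately have "is_path n (- 1) p"
    unfolding is_path_def using p par by (auto simp: parts_from_def in_set_conv_nth)
  moreover have "h d = l" "h d' = l'" using u(3) by (auto simp: h_def)
  ultimately show thesis using that p ud by metis
qed

text \<open>The path condition in pairwise form. The last clause is the same inequality against the
  fictitious part of size -1 and subscript 2 n - 2 i, which corresponds to the degenerate hook with
  a = i + 1 and p = i, nested inside all others.\<close>

definition chain_partition :: "nat \<Rightarrow> nat \<Rightarrow> part multiset \<Rightarrow> bool" where
  "chain_partition n i \<pi> \<longleftrightarrow> set_mset \<pi> \<subseteq> parts_from n 1 \<and> (\<forall>u. count \<pi> u \<le> 1) \<and>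
     (\<forall>l d l' d'. (l, d) \<in># \<pi> \<longrightarrow> (l', d') \<in># \<pi> \<longrightarrow> (l, d) \<noteq> (l', d') \<longrightarrow> \<bar>int d - int d'\<bar> < \<bar>l - l'\<bar>) \<and>
     (\<forall>l d. (l, d) \<in># \<pi> \<longrightarrow> \<bar>int d - (2 * int n - 2 * int i)\<bar> < l + 1)"

lemma chain_partition_imp_path_partition:
  assumes "i \<le> n" "chain_partition n i \<pi>"
  shows "\<pi> \<in> path_partitions n (- 1, 2 * n - 2 * i)"
proof -
  let ?u = "(- 1 :: int, 2 * n - 2 * i)"
  have c: "set_mset \<pi> \<subseteq> parts_from n 1" "\<And>u. count \<pi> u \<le> 1"
    "\<And>l d l' d'. (l, d) \<in># \<pi> \<Longrightarrow> (l', d') \<in># \<pi> \<Longrightarrow> (l, d) \<noteq> (l', d') \<Longrightarrow> \<bar>int d - int d'\<bar> < \<bar>l - l'\<bar>"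
    "\<And>l d. (l, d) \<in># \<pi> \<Longrightarrow> \<bar>int d - (2 * int n - 2 * int i)\<bar> < l + 1"
    using assms(2) unfolding chain_partition_def by meson+
  have "(\<Sum>j\<le>2 * n. freq n ?u \<pi> (p ! j)) \<le> 1" if p: "is_path n (- 1) p" for p
  proof -
    let ?f = "\<lambda>j. freq n ?u \<pi> (p ! j)"
    have f1: "?f j \<le> 1" for j using c(2) by (simp add: freq_def)
    have nz: "p ! j \<in># \<pi> \<or> p ! j = ?u" if "?f j \<noteq> 0" for j
      using that by (auto simp: freq_def split: if_splits)
    have uniq: "j = j'" if j: "j \<le> 2 * n" "j' \<le> 2 * n" "?f j \<noteq> 0" "?f j' \<noteq> 0" for j j'
    proof (rule ccontr)
      assume "j \<noteq> j'"
      have snd: "snd (p ! j) = j" "snd (p ! j') = j'" using p j by (auto simp: is_path_def)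
      obtain l l' where l: "p ! j = (l, j)" "p ! j' = (l', j')" using snd by (metis surjective_pairing)
      have lip: "\<bar>l - l'\<bar> \<le> \<bar>int j - int j'\<bar>"
        using is_path_lipschitz[OF p, of j j'] is_path_lipschitz[OF p, of j' j] j l by (cases "j \<le> j'") auto
      have d0: "int (2 * n - 2 * i) = 2 * int n - 2 * int i" using assms(1) by simp
      from nz[OF j(3)] nz[OF j(4)] show False
      proof (elim disjE)
        assume "p ! j \<in># \<pi>" "p ! j' \<in># \<pi>"
        then show False using c(3)[of l j l' j'] l lip \<open>j \<noteq> j'\<close> by auto
      next
        assume "p ! j \<in># \<pi>" "p ! j' = ?u"
        then show False using c(4)[of l j] l lip d0 by auto
      next
        assume "p ! j = ?u" "p ! j' \<in># \<pi>"
        then show False using c(4)[of l' j'] l lip d0 by auto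
      next
        assume "p ! j = ?u" "p ! j' = ?u"
        then show False using l \<open>j \<noteq> j'\<close> by auto
      qed
    qed
    show ?thesis
    proof (cases "\<exists>j\<le>2 * n. ?f j \<noteq> 0")
      case True
      then obtain j where j: "j \<le> 2 * n" "?f j \<noteq> 0" by blast
      have "(\<Sum>j\<le>2 * n. ?f j) = (\<Sum>j\<in>{j}. ?f j)"
        using uniq j by (intro sum.mono_neutral_right) auto
      then show ?thesis using f1[of j] by simp
    qed simp
  qed
  then show ?thesis using c(1) by (simp add: path_partitions_def)
qed

lemma path_partition_imp_chain_partition:
  assumes "i \<le> n" "\<pi> \<in> path_partitions n (- 1, 2 * n - 2 * i)"
  shows "chain_partition n i \<pi>"
proof -
  let ?u = "(- 1 :: int, 2 * n - 2 * i)"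
  have c: "set_mset \<pi> \<subseteq> parts_from n 1"
    "\<And>p. is_path n (- 1) p \<Longrightarrow> (\<Sum>j\<le>2 * n. freq n ?u \<pi> (p ! j)) \<le> 1"
    using assms(2) by (auto simp: path_partitions_def)
  have mono: "u \<in> parts_from n (- 1)" if "u \<in># \<pi>" for u
    using that c(1) by (force simp: parts_from_def)
  have dle: "d \<le> 2 * n" if "(l, d) \<in> parts_from n (- 1)" for l d using that by (simp add: parts_from_def)
  have u0: "?u \<in> parts_from n (- 1)" using assms(1) by (auto simp: parts_from_def of_nat_diff) presburger
  have fq: "freq n ?u \<pi> u = count \<pi> u" if "u \<in># \<pi>" for u
    using that c(1) by (auto simp: freq_def)
  \<comment> \<open>The fictitious part counts once in every path through it, as its size puts it
    outside the genuine parts.\<close>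
  have fq0: "freq n ?u \<pi> ?u = 1" by (simp add: freq_def parts_from_def)
  have pair: "freq n ?u \<pi> (l, d) + freq n ?u \<pi> (l', d') \<le> 1"
    if ld: "(l, d) \<in> parts_from n (- 1)" "(l', d') \<in> parts_from n (- 1)" "(l, d) \<noteq> (l', d')" "\<bar>l - l'\<bar> \<le> \<bar>int d - int d'\<bar>" for l d l' d'
  proof -
    obtain p where p: "is_path n (- 1) p" "p ! d = (l, d)" "p ! d' = (l', d')"
      using path_through[OF ld(1,2,4)] .
    have "d \<noteq> d'" using ld by auto
    then have "freq n ?u \<pi> (l, d) + freq n ?u \<pi> (l', d') = (\<Sum>j\<in>{d, d'}. freq n ?u \<pi> (p ! j))" using p by simp
    also have "\<dots> \<le> (\<Sum>j\<le>2 * n. freq n ?u \<pi> (p ! j))"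
      using dle[OF ld(1)] dle[OF ld(2)] by (intro sum_mono2) auto
    finally show ?thesis using c(2)[OF p(1)] by simp
  qed
  have c1: "count \<pi> u \<le> 1" for u
  proof (cases u)
    case (Pair l d)
    show ?thesis
      unfolding Pair
    proof (cases "(l, d) \<in># \<pi>")
      case True
      obtain p where p: "is_path n (- 1) p" "p ! d = (l, d)"
        using path_through[OF mono[OF True] mono[OF True]] by auto
      have "freq n ?u \<pi> (l, d) = (\<Sum>j\<in>{d}. freq n ?u \<pi> (p ! j))" using p by simp
      also have "\<dots> \<le> (\<Sum>j\<le>2 * n. freq n ?u \<pi> (p ! j))"
        using dle[OF mono[OF True]] by (intro sum_mono2) auto
      finally show "count \<pi> (l, d) \<le> 1" using c(2)[OF p(1)] fq[OF True] by simp
    qed (simp add: not_in_iff)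
  qed
  have c2: "\<bar>int d - int d'\<bar> < \<bar>l - l'\<bar>"
    if u: "(l, d) \<in># \<pi>" "(l', d') \<in># \<pi>" "(l, d) \<noteq> (l', d')" for l d l' d'
  proof -
    from u have "0 < count \<pi> (l, d)" "0 < count \<pi> (l', d')" by (simp_all only: count_greater_zero_iff)
    then show ?thesis
      using pair[OF mono[OF u(1)] mono[OF u(2)] u(3)] fq[OF u(1)] fq[OF u(2)] by linarith
  qed
  have c3: "\<bar>int d - (2 * int n - 2 * int i)\<bar> < l + 1" if u: "(l, d) \<in># \<pi>" for l d
  proof -
    from u have l: "1 \<le> l" using c(1) by (auto simp: parts_from_def)
    have "0 < count \<pi> (l, d)" using u by (simp only: count_greater_zero_iff)
    then have "\<not> \<bar>l - (- 1)\<bar> \<le> \<bar>int d - int (2 * n - 2 * i)\<bar>"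
    proof (intro notI)
      assume le: "\<bar>l - (- 1)\<bar> \<le> \<bar>int d - int (2 * n - 2 * i)\<bar>"
      have "(l, d) \<noteq> ?u" using l by simp
      from pair[OF mono[OF u] u0 this le] show False using fq[OF u] fq0 \<open>0 < count \<pi> (l, d)\<close> by linarith
    qed
    then show ?thesis using l assms(1) by (simp add: of_nat_diff)
  qed
  show ?thesis unfolding chain_partition_def using c(1) c1 c2 c3 by meson
qed

text \<open>Up to a reflection of the subscript these are the rotated coordinates p - a and p + a.
  \<open>nat\<close> is exact on good hooks, whose sum is at most 2 n + 1.\<close>

definition hook_part :: "nat \<Rightarrow> int \<times> int \<Rightarrow> part" where
  "hook_part n = (\<lambda>(a, p). (p - a, nat (2 * int n + 1 - a - p)))"

definition hooks_partition :: "nat \<Rightarrow> (int \<times> int) list \<Rightarrow> part multiset" where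
  "hooks_partition n hs = mset (map (hook_part n) hs)"

text \<open>With x and y the differences of particles and of holes, the comparison of sizes with
  subscripts becomes nestedness.\<close>

lemma nested_iff: "\<bar>x + y\<bar> < \<bar>x - y\<bar> \<longleftrightarrow> 0 < x \<and> y < 0 \<or> x < 0 \<and> 0 < (y :: int)"
  by linarith

lemma hook_part_inj:
  "good_list n i hs \<Longrightarrow> good_list n i hs' \<Longrightarrow> h \<in> set hs \<Longrightarrow> h' \<in> set hs' \<Longrightarrow> hook_part n h = hook_part n h' \<Longrightarrow> h = h'"
  by (fastforce simp: hook_part_def good_list_def)

lemma good_list_nested:
  assumes "good_list n i hs" "(a, p) \<in> set hs" "(a', p') \<in> set hs" "(a, p) \<noteq> (a', p')"
  shows "a < a' \<and> p' < p \<or> a' < a \<and> p < p'"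
  using assms by (induction hs) (auto simp: good_list_Cons)

lemma chain_partition_hooks:
  assumes "i \<le> n" "good_list n i hs"
  shows "chain_partition n i (hooks_partition n hs)"
proof -
  have g: "a \<le> int i" "int i < p" "1 \<le> a + p" "a + p \<le> 2 * int n + 1" if "(a, p) \<in> set hs" for a p
    using assms(2) that by (auto simp: good_list_def)
  have inj: "inj_on (hook_part n) (set hs)"
    using hook_part_inj[OF assms(2,2)] by (intro inj_onI) blast
  have set: "set_mset (hooks_partition n hs) = hook_part n ` set hs" by (simp add: hooks_partition_def)
  show ?thesis
    unfolding chain_partition_def
  proof (intro conjI)
    show "set_mset (hooks_partition n hs) \<subseteq> parts_from n 1"
      unfolding set
    proof (rule image_subsetI)
      fix h assume h: "h \<in> set hs"
      obtain a p where ap_eq: "h = (a, p)" by (cases h)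
      with h have ap: "(a, p) \<in> set hs" by simp
      have "p - a - (2 * int n + 1 - a - p) = 2 * (p - int n - 1) + 1" by simp
      then have "(p - a - (2 * int n + 1 - a - p)) mod 2 = 1" by presburger
      then show "hook_part n h \<in> parts_from n 1" unfolding ap_eq using g[OF ap] by (simp add: hook_part_def parts_from_def)
    qed
    have "distinct (map (hook_part n) hs)" using good_list_distinct[OF assms(2)] inj by (simp add: distinct_map)
    then show "\<forall>u. count (hooks_partition n hs) u \<le> 1"
      unfolding hooks_partition_def distinct_count_atmost_1 by simp
  next
    have "\<bar>int d - int d'\<bar> < \<bar>l - l'\<bar>"
      if h: "h \<in> set hs" "h' \<in> set hs" and ld: "hook_part n h = (l, d)" "hook_part n h' = (l', d')" "(l, d) \<noteq> (l', d')" for h h' l d l' d'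
    proof -
      obtain a p a' p' where ap: "h = (a, p)" "h' = (a', p')" by (metis surj_pair)
      have "(a, p) \<noteq> (a', p')" using ld ap by auto
      with h ap have ne: "a < a' \<and> p' < p \<or> a' < a \<and> p < p'" using good_list_nested[OF assms(2)] by metis
      have "l = p - a" "l' = p' - a'" "int d = 2 * int n + 1 - a - p" "int d' = 2 * int n + 1 - a' - p'"
        using ld(1,2) h g(4)[of a p] g(4)[of a' p'] unfolding ap by (auto simp: hook_part_def)
      with ne show ?thesis by linarith
    qed
    then show "\<forall>l d l' d'. (l, d) \<in># hooks_partition n hs \<longrightarrow> (l', d') \<in># hooks_partition n hs \<longrightarrow>
        (l, d) \<noteq> (l', d') \<longrightarrow> \<bar>int d - int d'\<bar> < \<bar>l - l'\<bar>"
      unfolding set by (intro allI impI) (elim imageE, metis)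
  next
    have "\<bar>int d - (2 * int n - 2 * int i)\<bar> < l + 1" if h: "h \<in> set hs" "hook_part n h = (l, d)" for h l d
    proof -
      obtain a p where ap: "h = (a, p)" by (metis surj_pair)
      have "l = p - a" "int d = 2 * int n + 1 - a - p" "a \<le> int i" "int i < p"
        using h g(1,2,4)[of a p] unfolding ap by (auto simp: hook_part_def)
      then show ?thesis by linarith
    qed
    then show "\<forall>l d. (l, d) \<in># hooks_partition n hs \<longrightarrow> \<bar>int d - (2 * int n - 2 * int i)\<bar> < l + 1"
      unfolding set by (intro allI impI) (elim imageE, metis)
  qed
qed

lemma chain_sorted_list:
  fixes Y :: "(int \<times> int) set"
  assumes "finite Y" "\<And>a p a' p'. (a, p) \<in> Y \<Longrightarrow> (a', p') \<in> Y \<Longrightarrow> (a, p) \<noteq> (a', p') \<Longrightarrow>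
    a < a' \<and> p' < p \<or> a' < a \<and> p < p'"
  shows "\<exists>hs. set hs = Y \<and> sorted_wrt (\<lambda>(a, p) (a', p'). a < a' \<and> p' < p) hs"
  using assms
proof (induction "card Y" arbitrary: Y)
  case 0
  then show ?case by (intro exI[of _ "[]"]) auto
next
  case (Suc k)
  then have "Y \<noteq> {}" by auto
  then have "Max (snd ` Y) \<in> snd ` Y" using Suc.prems(1) by (intro Max_in) auto
  then obtain a p where ap: "(a, p) \<in> Y" "p = Max (snd ` Y)" by auto
  have max: "p' \<le> p" if "(a', p') \<in> Y" for a' p'
    unfolding ap(2) using Suc.prems(1) that by (intro Max_ge) force+
  have "\<exists>hs. set hs = Y - {(a, p)} \<and> sorted_wrt (\<lambda>(a, p) (a', p'). a < a' \<and> p' < p) hs"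
    using Suc ap by (intro Suc.hyps(1)) auto
  then obtain hs where hs: "set hs = Y - {(a, p)}" "sorted_wrt (\<lambda>(a, p) (a', p'). a < a' \<and> p' < p) hs" by blast
  have "a < a' \<and> p' < p" if "(a', p') \<in> set hs" for a' p'
    using Suc.prems(2)[OF ap(1), of a' p'] max[of a' p'] that hs(1) by auto
  then show ?case using hs ap by (intro exI[of _ "(a, p) # hs"]) auto
qed

lemma chain_partition_surj:
  assumes "i \<le> n" "chain_partition n i \<pi>"
  shows "\<exists>hs. good_list n i hs \<and> hooks_partition n hs = \<pi>"
proof -
  have c: "set_mset \<pi> \<subseteq> parts_from n 1" "\<And>u. count \<pi> u \<le> 1"
    "\<And>l d l' d'. (l, d) \<in># \<pi> \<Longrightarrow> (l', d') \<in># \<pi> \<Longrightarrow> (l, d) \<noteq> (l', d') \<Longrightarrow> \<bar>int d - int d'\<bar> < \<bar>l - l'\<bar>"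
    "\<And>l d. (l, d) \<in># \<pi> \<Longrightarrow> \<bar>int d - (2 * int n - 2 * int i)\<bar> < l + 1"
    using assms(2) unfolding chain_partition_def by meson+
  \<comment> \<open>The bound on a + p prevents truncation in \<open>hook_part\<close>, which is
    thereby injective on Y.\<close>
  define Y where "Y = {(a, p). a + p \<le> 2 * int n + 1 \<and> hook_part n (a, p) \<in># \<pi>}"
  have img: "hook_part n ` Y = set_mset \<pi>"
  proof
    show "set_mset \<pi> \<subseteq> hook_part n ` Y"
    proof safe
      fix l d assume u: "(l, d) \<in># \<pi>"
      then have ld: "d \<le> 2 * n" "(l - int d) mod 2 = 1" using c(1) by (auto simp: parts_from_def)
      then obtain t where t: "l = int d + 2 * t + 1" by (metis add.assoc add.commute diff_eq_eq mult_div_mod_eq)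
      \<comment> \<open>The solution of p - a = l and a + p = 2 n + 1 - d; it is integral because l
        - d is odd.\<close>
      have "hook_part n (int n - int d - t, int n + t + 1) = (l, d)" using t by (simp add: hook_part_def)
      moreover from this have "(int n - int d - t, int n + t + 1) \<in> Y" using u by (simp add: Y_def)
      ultimately show "(l, d) \<in> hook_part n ` Y" by (metis image_eqI)
    qed
  qed (auto simp: Y_def)
  have inj: "inj_on (hook_part n) Y" by (auto simp: inj_on_def Y_def hook_part_def)
  have finY: "finite Y" using finite_imageD[OF _ inj] img by simp
  have Y: "a \<le> int i \<and> int i < p \<and> 1 \<le> a + p \<and> a + p \<le> 2 * int n + 1" if ap: "(a, p) \<in> Y" for a p
  proof -
    have u: "(p - a, nat (2 * int n + 1 - a - p)) \<in># \<pi>" "a + p \<le> 2 * int n + 1" using ap by (auto simp: Y_def hook_part_def)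
    have "nat (2 * int n + 1 - a - p) \<le> 2 * n" using c(1) u(1) by (auto simp: parts_from_def)
    then show ?thesis using c(4)[OF u(1)] u(2) by auto
  qed
  have "a < a' \<and> p' < p \<or> a' < a \<and> p < p'" if Y': "(a, p) \<in> Y" "(a', p') \<in> Y" "(a, p) \<noteq> (a', p')" for a p a' p'
  proof -
    have "hook_part n (a, p) \<noteq> hook_part n (a', p')" using inj Y' by (auto simp: inj_on_def)
    moreover have "hook_part n (a, p) \<in># \<pi>" "hook_part n (a', p') \<in># \<pi>" using Y' by (auto simp: Y_def)
    ultimately have "\<bar>int (nat (2 * int n + 1 - a - p)) - int (nat (2 * int n + 1 - a' - p'))\<bar> < \<bar>p - a - (p' - a')\<bar>"
      unfolding hook_part_def prod.case using c(3) by blast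
    then have "\<bar>(p' - p) + (a' - a)\<bar> < \<bar>(p' - p) - (a' - a)\<bar>" using Y[OF Y'(1)] Y[OF Y'(2)] by simp
    then show ?thesis unfolding nested_iff by linarith
  qed
  then obtain hs where hs: "set hs = Y" "sorted_wrt (\<lambda>(a, p) (a', p'). a < a' \<and> p' < p) hs"
    using chain_sorted_list[OF finY] by blast
  have good: "good_list n i hs" unfolding good_list_def using hs Y by auto
  have "hooks_partition n hs = mset_set (hook_part n ` set hs)"
    using mset_set_set[of "map (hook_part n) hs"] good_list_distinct[OF good] inj hs(1)
    by (simp add: hooks_partition_def distinct_map)
  also have "\<dots> = mset_set (set_mset \<pi>)" using img hs(1) by simp
  also have "\<dots> = \<pi>"
  proof (rule multiset_eqI)
    fix u show "count (mset_set (set_mset \<pi>)) u = count \<pi> u"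
      using c(2)[of u] count_greater_zero_iff[of \<pi> u] by (cases "u \<in># \<pi>") (auto simp: count_mset_set' not_in_iff le_Suc_eq simp del: count_greater_zero_iff)
  qed
  finally show ?thesis using good by blast
qed

lemma good_list_set_unique:
  "good_list n i hs \<Longrightarrow> good_list n i hs' \<Longrightarrow> set hs = set hs' \<Longrightarrow> hs = hs'"
proof (induction hs arbitrary: hs')
  case (Cons h t)
  obtain a p where h: "h = (a, p)" by (cases h)
  obtain a' p' t' where hs': "hs' = (a', p') # t'" using Cons.prems(3) by (cases hs') auto
  have g: "good_list n i t" "good_list n i t'" "\<And>b q. (b, q) \<in> set t \<Longrightarrow> q < p" "\<And>b q. (b, q) \<in> set t' \<Longrightarrow> q < p'"
    using Cons.prems by (auto simp: h hs' good_list_Cons)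
  have eq: "(a, p) = (a', p')"
  proof (rule ccontr)
    assume "(a, p) \<noteq> (a', p')"
    then have "(a, p) \<in> set t'" "(a', p') \<in> set t" using Cons.prems(3) by (auto simp: h hs')
    then show False using g(3,4) by force
  qed
  have "(a, p) \<notin> set t" "(a, p) \<notin> set t'" using g(3,4) eq by force+
  then have "set t = set t'" using Cons.prems(3) eq by (auto simp: h hs')
  then show ?case using Cons.IH[OF g(1,2)] eq by (simp add: h hs')
qed simp

lemma bij_hooks_partition:
  assumes "i \<le> n"
  shows "bij_betw (hooks_partition n) {hs. good_list n i hs} (path_partitions n (- 1, 2 * n - 2 * i))"
  unfolding bij_betw_def
proof (intro conjI inj_onI)
  fix hs hs' assume hs: "hs \<in> {hs. good_list n i hs}" "hs' \<in> {hs. good_list n i hs}" "hooks_partition n hs = hooks_partition n hs'"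
  then have eq: "hook_part n ` set hs = hook_part n ` set hs'"
    unfolding hooks_partition_def by (metis set_map set_mset_mset)
  have "set hs \<subseteq> set hs'" if gl: "good_list n i hs" "good_list n i hs'" "hook_part n ` set hs = hook_part n ` set hs'" for hs hs'
  proof
    fix h assume h: "h \<in> set hs"
    then obtain h' where "h' \<in> set hs'" "hook_part n h = hook_part n h'" using gl(3) by blast
    then show "h \<in> set hs'" using hook_part_inj[OF gl(1,2) h] by blast
  qed
  then have "set hs = set hs'" using hs eq by (metis equalityI mem_Collect_eq)
  then show "hs = hs'" using good_list_set_unique hs by blast
next
  show "hooks_partition n ` {hs. good_list n i hs} = path_partitions n (- 1, 2 * n - 2 * i)"
  proof (intro equalityI subsetI)
    fix \<pi> assume "\<pi> \<in> hooks_partition n ` {hs. good_list n i hs}"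
    then show "\<pi> \<in> path_partitions n (- 1, 2 * n - 2 * i)"
      using chain_partition_hooks[OF assms] chain_partition_imp_path_partition[OF assms] by blast
  next
    fix \<pi> assume "\<pi> \<in> path_partitions n (- 1, 2 * n - 2 * i)"
    from chain_partition_surj[OF assms path_partition_imp_chain_partition[OF assms this]]
    show "\<pi> \<in> hooks_partition n ` {hs. good_list n i hs}" by blast
  qed
qed

lemma part_size_hooks_partition: "part_size (hooks_partition n hs) = hooks_size hs"
proof -
  have "(\<Sum>u\<in>#hooks_partition n hs. fst u) = (\<Sum>(a, p)\<leftarrow>hs. p - a)"
    by (induction hs) (auto simp: hooks_partition_def hook_part_def)
  then show ?thesis by (simp add: part_size_def hooks_size_def)
qed

section \<open>Generating functions of both sides\<close>

lemma infsum_fps_X_power: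
  assumes "\<And>N. finite {x \<in> A. g x = N}"
  shows "(\<Sum>\<^sub>\<infinity>x\<in>A. of_nat (c x) * fps_X ^ g x) =
    (Abs_fps (\<lambda>N. of_nat (\<Sum>x\<in>{x \<in> A. g x = N}. c x)) :: complex fps)"
proof (rule infsumI, rule has_sum_fpsI)
  fix N
  have nth: "fps_nth (of_nat (c x) * fps_X ^ g x :: complex fps) N = (if g x = N then of_nat (c x) else 0)" for x
    by (simp add: fps_mult_of_nat_nth(1))
  let ?S = "{x \<in> A. fps_nth (of_nat (c x) * fps_X ^ g x :: complex fps) N \<noteq> 0}"
  have sub: "?S \<subseteq> {x \<in> A. g x = N}" by (auto simp: nth split: if_splits)
  show "finite ?S" using finite_subset[OF sub assms] .
  have "(\<Sum>x\<in>?S. fps_nth (of_nat (c x) * fps_X ^ g x :: complex fps) N) = (\<Sum>x\<in>{x \<in> A. g x = N}. of_nat (c x))"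
    using sub assms by (intro sum.mono_neutral_cong_left) (auto simp: nth)
  then show "fps_nth (Abs_fps (\<lambda>N. of_nat (\<Sum>x\<in>{x \<in> A. g x = N}. c x))) N =
      (\<Sum>x\<in>?S. fps_nth (of_nat (c x) * fps_X ^ g x :: complex fps) N)"
    by simp
qed

lemma path_partitions_gf:
  assumes "i \<le> n"
  shows "(\<Sum>\<^sub>\<infinity>\<pi>\<in>path_partitions n (- 1, 2 * n - 2 * i). fps_X ^ part_size \<pi>) =
    (Abs_fps (\<lambda>N. of_nat (card (good_lists n i N))) :: complex fps)"
proof -
  let ?P = "path_partitions n (- 1, 2 * n - 2 * i)"
  have bij: "bij_betw (hooks_partition n) (good_lists n i N) {\<pi> \<in> ?P. part_size \<pi> = N}" for N
  proof -
    have "bij_betw (hooks_partition n) (good_lists n i N) (hooks_partition n ` good_lists n i N)"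
      using bij_hooks_partition[OF assms] unfolding good_lists_def
      by (intro inj_on_imp_bij_betw) (auto simp: bij_betw_def intro: inj_on_subset)
    moreover have "hooks_partition n ` good_lists n i N = {\<pi> \<in> ?P. part_size \<pi> = N}"
    proof -
      have "?P = hooks_partition n ` {hs. good_list n i hs}"
        using bij_hooks_partition[OF assms] by (simp add: bij_betw_def)
      then show ?thesis by (auto simp: good_lists_def part_size_hooks_partition)
    qed
    ultimately show ?thesis by simp
  qed
  have fin: "finite {\<pi> \<in> ?P. part_size \<pi> = N}" for N
    using bij_betw_finite[OF bij] finite_good_lists by blast
  have "(\<Sum>\<^sub>\<infinity>\<pi>\<in>?P. fps_X ^ part_size \<pi>) = (\<Sum>\<^sub>\<infinity>\<pi>\<in>?P. of_nat 1 * fps_X ^ part_size \<pi> :: complex fps)" by simp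
  also have "\<dots> = Abs_fps (\<lambda>N. of_nat (\<Sum>\<pi>\<in>{\<pi> \<in> ?P. part_size \<pi> = N}. 1))"
    using fin by (rule infsum_fps_X_power)
  also have "(\<lambda>N. of_nat (\<Sum>\<pi>\<in>{\<pi> \<in> ?P. part_size \<pi> = N}. 1)) = (\<lambda>N. of_nat (card (good_lists n i N)) :: complex)"
    using bij_betw_same_card[OF bij] by simp
  finally show ?thesis .
qed

lemma (in fundamental_module) principal_specialisation_ch:
  "principal_specialisation n (exp_times (- fund_weight i) ch) =
    Abs_fps (\<lambda>N. of_nat (card (good_lists n i N)))"
proof -
  have ch: "exp_times (- fund_weight i) ch (- root_combination n m) = dim (weight_space (weight_of m))" for m
    by (simp add: exp_times_def ch_def weight_of_def)
  have "principal_specialisation n (exp_times (- fund_weight i) ch) =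
     (\<Sum>\<^sub>\<infinity>m\<in>contents n. of_nat (dim (weight_space (weight_of m))) * fps_X ^ (\<Sum>j\<le>n. m j))"
    unfolding principal_specialisation_def ch contents_def ..
  also have "\<dots> = Abs_fps (\<lambda>N. of_nat (\<Sum>m\<in>{m \<in> contents n. (\<Sum>j\<le>n. m j) = N}. dim (weight_space (weight_of m))))"
    using finite_contents by (rule infsum_fps_X_power)
  finally show ?thesis unfolding sum_dim_weight_space .
qed

theorem theorem1p15:
  fixes n i :: nat
    and scale :: "complex \<Rightarrow> 'v::ab_group_add \<Rightarrow> 'v"
    and L :: "'v set"
    and act :: "lie_elem \<Rightarrow> 'v \<Rightarrow> 'v"
  assumes "n \<ge> 1" and "i \<le> n"
    and "irreducible_highest_weight_module scale n L act (fund_weight i)"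
  shows "(\<Sum>\<^sub>\<infinity>\<pi>\<in>path_partitions n (-1, 2 * n - 2 * i). fps_X ^ part_size \<pi>) =
           principal_specialisation n
             (exp_times (- fund_weight i) (C1_module.ch scale n L act))
       \<and> principal_specialisation n
             (exp_times (- fund_weight i) (C1_module.ch scale n L act)) =
           qpoch (fps_X ^ (2 * n + 4)) (fps_X ^ (2 * n + 4))
         * qpoch (fps_X ^ (2 * i + 2)) (fps_X ^ (2 * n + 4))
         * qpoch (fps_X ^ (2 * n - 2 * i + 2)) (fps_X ^ (2 * n + 4))
         / qpoch fps_X fps_X"
proof -
  interpret irreducible_highest_weight_module scale n L act "fund_weight i" by fact
  \<comment> \<open>The intermediate locales depend on the choice of a highest weight vector; the
    conclusion does not mention it.\<close>
  obtain v where "v \<in> weight_space (fund_weight i)" "v \<noteq> 0" "\<forall>j\<le>n. op_e j v = 0"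
      "\<forall>W. submodule W \<and> v \<in> W \<longrightarrow> W = L"
    using highest_weight unfolding highest_weight_module_def by blast
  then interpret fundamental_module scale n L act i v
    using assms(1,2) by unfold_locales auto
  show ?thesis
    unfolding path_partitions_gf[OF assms(2)] principal_specialisation_ch
    using good_list_gf[OF assms(2)] by (simp add: good_lists_def)
qed

end
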